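(* Let $\alpha>-1$ and $0<p<\infty$. Suppose that $\varphi$ and $\psi$ are nonconstant linear fractional self-maps of $\mathbb D$. Then $$C_\psi^*C_\varphi\in S_p(\mathcal D_\alpha)$$ if and only if $$\varphi^{-1}(\mathbb T)\cap\psi^{-1}(\mathbb T)\cap\mathbb T=\varnothing .$$ If this condition holds, then $C_\psi^*C_\varphi\in S_q(\mathcal D_\alpha)$ for every $0<q<\infty$.
   Context: $\mathbb D$ is the open unit disk in $\mathbb C$, $\mathbb T$ is the unit circle, and $dA$ is the normalized area measure on $\mathbb D$. For $\alpha>-1$, $dA_\alpha(z)=(1+\alpha)(1-|z|^2)^\alpha\,dA(z)$. The weighted Dirichlet space $\mathcal D_\alpha$ is the Hilbert space of analytic functions $f$ on $\mathbb D$ with $\|f\|_{\mathcal D_\alpha}^2=|f(0)|^2+\int_{\mathbb D}|f'(z)|^2\,dA_\alpha(z)<\infty$, with the associated inner product. A nonconstant linear fractional self-map of $\mathbb D$ is a map $\varphi(z)=\frac{az+b}{cz+d}$ with $ad-bc\neq0$ and $\varphi(\mathbb D)\subset\mathbb D$; it extends analytically to a neighborhood of $\overline{\mathbb D}$. Thus $\varphi^{-1}(\mathbb T)\cap\psi^{-1}(\mathbb T)\cap\mathbb T=\{\lambda\in\mathbb T:|\varphi(\lambda)|=|\psi(\lambda)|=1\}$. The composition operator is $C_\varphi f=f\circ\varphi$; for such $\varphi$ it is bounded on $\mathcal D_\alpha$. $C_\psi^*$ is the Hilbert space adjoint of $C_\psi$ on $\mathcal D_\alpha$. For a separable Hilbert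 space $\mathcal H$ and $0<p<\infty$, the Schatten class $S_p(\mathcal H)$ consists of the compact operators $T$ on $\mathcal H$ whose singular values $s_1(T)\ge s_2(T)\ge\cdots\ge0$ satisfy $\sum_n s_n(T)^p<\infty$. *)

theory Defs
  imports "HOL-Complex_Analysis.Complex_Analysis" "HOL-Library.Function_Algebras"
begin

text \<open>
  A Hilbert space of complex-valued functions is given by a carrier \<open>H\<close> and an inner product
  \<open>ip\<close>, linear in the first argument, that is positive definite on \<open>H\<close>. Addition and subtraction
  of functions are pointwise. Operators are functions whose values matter on \<open>H\<close> only.
\<close>

definition fscale :: "complex \<Rightarrow> ('a \<Rightarrow> complex) \<Rightarrow> 'a \<Rightarrow> complex" where
  "fscale c f = (\<lambda>x. c * f x)"

definition ip_norm ::
    "(('a \<Rightarrow> complex) \<Rightarrow> ('a \<Rightarrow> complex) \<Rightarrow> complex) \<Rightarrow> ('a \<Rightarrow> complex) \<Rightarrow> real" where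
  "ip_norm ip f = sqrt (Re (ip f f))"

definition linear_operator ::
    "('a \<Rightarrow> complex) set \<Rightarrow> (('a \<Rightarrow> complex) \<Rightarrow> ('a \<Rightarrow> complex)) \<Rightarrow> bool" where
  "linear_operator H T \<longleftrightarrow>
     (\<forall>f\<in>H. T f \<in> H) \<and>
     (\<forall>f\<in>H. \<forall>g\<in>H. T (f + g) = T f + T g) \<and>
     (\<forall>c. \<forall>f\<in>H. T (fscale c f) = fscale c (T f))"

definition compact_operator ::
    "('a \<Rightarrow> complex) set \<Rightarrow> (('a \<Rightarrow> complex) \<Rightarrow> ('a \<Rightarrow> complex) \<Rightarrow> complex) \<Rightarrow>
     (('a \<Rightarrow> complex) \<Rightarrow> ('a \<Rightarrow> complex)) \<Rightarrow> bool" where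
  "compact_operator H ip T \<longleftrightarrow>
     linear_operator H T \<and>
     (\<forall>F :: nat \<Rightarrow> 'a \<Rightarrow> complex. \<forall>B. (\<forall>n. F n \<in> H \<and> ip_norm ip (F n) \<le> B) \<longrightarrow>
        (\<exists>r g. strict_mono (r :: nat \<Rightarrow> nat) \<and> g \<in> H \<and>
               (\<lambda>n. ip_norm ip (T (F (r n)) - g)) \<longlonglongrightarrow> 0))"

text \<open>
  For a bounded operator on a Hilbert space the described vector exists and is unique by the Riesz
  representation theorem.
\<close>

definition hilbert_adjoint ::
    "('a \<Rightarrow> complex) set \<Rightarrow> (('a \<Rightarrow> complex) \<Rightarrow> ('a \<Rightarrow> complex) \<Rightarrow> complex) \<Rightarrow>
     (('a \<Rightarrow> complex) \<Rightarrow> ('a \<Rightarrow> complex)) \<Rightarrow> (('a \<Rightarrow> complex) \<Rightarrow> ('a \<Rightarrow> complex))" where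
  "hilbert_adjoint H ip T g = (THE h. h \<in> H \<and> (\<forall>f\<in>H. ip (T f) g = ip f h))"

text \<open>
  The singular values of a compact operator \<open>T\<close> are the square roots of the eigenvalues of \<open>T\<^sup>*T\<close>,
  listed in decreasing order and with multiplicity. If there are only finitely many positive ones,
  the condition below forces the remaining entries of the sequence to be \<open>0\<close>; if there are
  infinitely many, the value \<open>0\<close> is not listed. Thus \<open>s\<close> is determined by \<open>T\<close>.
\<close>

definition singular_values ::
    "('a \<Rightarrow> complex) set \<Rightarrow> (('a \<Rightarrow> complex) \<Rightarrow> ('a \<Rightarrow> complex) \<Rightarrow> complex) \<Rightarrow>
     (('a \<Rightarrow> complex) \<Rightarrow> ('a \<Rightarrow> complex)) \<Rightarrow> (nat \<Rightarrow> real) \<Rightarrow> bool" where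
  "singular_values H ip T s \<longleftrightarrow>
     decseq s \<and> (\<forall>n. 0 \<le> s n) \<and>
     (\<forall>t>0. finite {n. s n = t} \<and>
        card {n. s n = t} =
          vector_space.dim fscale
            {f \<in> H. hilbert_adjoint H ip T (T f) = fscale (complex_of_real (t\<^sup>2)) f})"

definition schatten_class ::
    "real \<Rightarrow> ('a \<Rightarrow> complex) set \<Rightarrow> (('a \<Rightarrow> complex) \<Rightarrow> ('a \<Rightarrow> complex) \<Rightarrow> complex) \<Rightarrow>
     (('a \<Rightarrow> complex) \<Rightarrow> ('a \<Rightarrow> complex)) set" where
  "schatten_class p H ip =
     {T. compact_operator H ip T \<and>
         (\<exists>s. singular_values H ip T s \<and> summable (\<lambda>n. s n powr p))}"

abbreviation unit_disk :: "complex set" where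
  "unit_disk \<equiv> ball 0 1"

abbreviation unit_circle :: "complex set" where
  "unit_circle \<equiv> sphere 0 1"

definition disk_area :: "complex measure" where
  "disk_area = density (restrict_space lborel unit_disk) (\<lambda>_. ennreal (1 / pi))"

definition weighted_disk_area :: "real \<Rightarrow> complex measure" where
  "weighted_disk_area \<alpha> =
     density disk_area (\<lambda>z. ennreal ((1 + \<alpha>) * (1 - (cmod z)\<^sup>2) powr \<alpha>))"

text \<open>
  Analytic functions on the disk are represented by their extension by \<open>0\<close> to the plane, so that
  equality of elements is equality on the disk.
\<close>

definition dirichlet_space :: "real \<Rightarrow> (complex \<Rightarrow> complex) set" where
  "dirichlet_space \<alpha> =
     {f. f holomorphic_on unit_disk \<and> (\<forall>z. z \<notin> unit_disk \<longrightarrow> f z = 0) \<and>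
         integrable (weighted_disk_area \<alpha>) (\<lambda>z. (cmod (deriv f z))\<^sup>2)}"

definition dirichlet_ip ::
    "real \<Rightarrow> (complex \<Rightarrow> complex) \<Rightarrow> (complex \<Rightarrow> complex) \<Rightarrow> complex" where
  "dirichlet_ip \<alpha> f g =
     f 0 * cnj (g 0) + (\<integral>z. deriv f z * cnj (deriv g z) \<partial>weighted_disk_area \<alpha>)"

definition comp_op :: "(complex \<Rightarrow> complex) \<Rightarrow> (complex \<Rightarrow> complex) \<Rightarrow> complex \<Rightarrow> complex" where
  "comp_op \<phi> f = (\<lambda>z. if z \<in> unit_disk then f (\<phi> z) else 0)"

text \<open>
  The pole has to be excluded explicitly, because division by \<open>0\<close> yields \<open>0\<close>. As the image of the
  disk is bounded, there is then no pole on the circle either, so \<open>\<phi>\<close> agrees with its analytic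
  extension on the closed disk.
\<close>

definition linear_fractional_self_map :: "(complex \<Rightarrow> complex) \<Rightarrow> bool" where
  "linear_fractional_self_map \<phi> \<longleftrightarrow>
     (\<exists>a b c d. a * d - b * c \<noteq> 0 \<and>
        (\<forall>z\<in>unit_disk. c * z + d \<noteq> 0) \<and>
        \<phi> = (\<lambda>z. (a * z + b) / (c * z + d)) \<and>
        \<phi> ` unit_disk \<subseteq> unit_disk)"

end

theory Submission
  imports Defs
begin

text \<open>
  Let \<open>T\<close> be the adjoint of composition with \<open>\<psi>\<close> after composition with \<open>\<phi>\<close>, so that
  \<open>\<langle>T f, g\<rangle> = \<langle>f \<circ> \<phi>, g \<circ> \<psi>\<rangle>\<close>. This is \<open>f (\<phi> 0) cnj (g (\<psi> 0))\<close> plus the weighted integral of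
  \<open>u cnj v\<close>, where \<open>u = (f' \<circ> \<phi>) \<phi>'\<close> and \<open>v = (g' \<circ> \<psi>) \<psi>'\<close>.

  Suppose that no point of the circle is mapped to the circle by both maps. By compactness of the
  closed disk there is \<open>r < 1\<close> such that at each point \<open>cmod \<phi> \<le> r\<close> or \<open>cmod \<psi> \<le> r\<close>. On the set where
  \<open>cmod \<psi> \<le> r\<close> one replaces \<open>g'\<close> by a Taylor polynomial, on the rest \<open>f'\<close>; with \<open>N\<close> terms the error is
  at most a multiple of \<open>\<rho>\<^sup>N \<parallel>f\<parallel> \<parallel>g\<parallel>\<close> for some \<open>\<rho> < 1\<close>. So \<open>\<parallel>T f\<parallel>\<close> is bounded by the values of \<open>2 N + 1\<close>
  functionals at \<open>f\<close>, up to \<open>C \<rho>\<^sup>N \<parallel>f\<parallel>\<close> (\<open>adjoint_comp_approximable\<close>). Such an operator is compact. A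
  dimension count shows that at most \<open>2 N + 1\<close> of its singular values exceed \<open>C \<rho>\<^sup>N\<close>, so they decay
  geometrically and are summable to every positive power (\<open>schatten_if_approximable\<close>).

  Suppose that \<open>\<zeta>\<close> is a common contact point. A function with a pole just outside the disk, on the ray
  through \<open>\<zeta>\<close>, can be written as \<open>F \<circ> \<phi>\<close> and as \<open>G \<circ> \<psi>\<close>, because both maps are linear fractional.
  The poles of \<open>F\<close> and \<open>G\<close> are at comparable distances from the disk, by the Schwarz-Pick lemma. With
  suitable normalization the norms of \<open>F\<close> and \<open>G\<close> stay bounded and \<open>\<langle>T F, G\<rangle>\<close> stays away from \<open>0\<close>
  while the pole approaches \<open>\<zeta>\<close> and \<open>G\<close> tends weakly to \<open>0\<close>. This is impossible for compact \<open>T\<close>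
  (\<open>not_compact_if_common_contact\<close>), and all members of the Schatten classes are compact.

  That composition is bounded rests on an estimate in the weighted Bergman space
  (\<open>nn_integral_composition\<close>), which combines Littlewood's subordination inequality on circles with a
  change of variables for Moebius maps. Applied to constant maps, the same estimate bounds point
  evaluations and thus yields completeness of the Dirichlet space; adjoints are then provided by
  the Riesz representation theorem.
\<close>

section \<open>Hilbert spaces of functions and their adjoints\<close>

locale function_hilbert_space =
  fixes H :: "('a \<Rightarrow> complex) set"
    and ip :: "('a \<Rightarrow> complex) \<Rightarrow> ('a \<Rightarrow> complex) \<Rightarrow> complex"
  assumes zero_mem [simp]: "0 \<in> H"
    and add_mem [simp]: "f \<in> H \<Longrightarrow> g \<in> H \<Longrightarrow> f + g \<in> H"
    and scale_mem [simp]: "f \<in> H \<Longrightarrow> fscale c f \<in> H"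
    and ip_add_left [simp]: "f \<in> H \<Longrightarrow> g \<in> H \<Longrightarrow> h \<in> H \<Longrightarrow> ip (f + g) h = ip f h + ip g h"
    and ip_scale_left [simp]: "f \<in> H \<Longrightarrow> h \<in> H \<Longrightarrow> ip (fscale c f) h = c * ip f h"
    and ip_commute: "f \<in> H \<Longrightarrow> g \<in> H \<Longrightarrow> ip g f = cnj (ip f g)"
    and ip_self_nonneg: "f \<in> H \<Longrightarrow> 0 \<le> Re (ip f f)"
    and ip_self_eq_0D: "f \<in> H \<Longrightarrow> ip f f = 0 \<Longrightarrow> f = 0"
    and complete: "(\<And>n. F n \<in> H) \<Longrightarrow>
      (\<And>e. e > 0 \<Longrightarrow> \<exists>N. \<forall>m\<ge>N. \<forall>n\<ge>N. ip_norm ip (F m - F n) < e) \<Longrightarrow>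
      \<exists>g\<in>H. (\<lambda>n::nat. ip_norm ip (F n - g)) \<longlonglongrightarrow> 0"
begin

abbreviation nrm :: "('a \<Rightarrow> complex) \<Rightarrow> real" where
  "nrm \<equiv> ip_norm ip"

lemma diff_eq_add_scale: "f - g = f + fscale (-1) g"
  by (auto simp: fscale_def fun_eq_iff)

lemma diff_mem [simp]: "f \<in> H \<Longrightarrow> g \<in> H \<Longrightarrow> f - g \<in> H"
  by (simp add: diff_eq_add_scale)

lemma ip_diff_left [simp]:
  "f \<in> H \<Longrightarrow> g \<in> H \<Longrightarrow> h \<in> H \<Longrightarrow> ip (f - g) h = ip f h - ip g h"
  by (simp add: diff_eq_add_scale)

lemma ip_add_right [simp]:
  "f \<in> H \<Longrightarrow> g \<in> H \<Longrightarrow> h \<in> H \<Longrightarrow> ip h (f + g) = ip h f + ip h g"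
  by (metis add_mem complex_cnj_add ip_add_left ip_commute)

lemma ip_scale_right [simp]:
  "f \<in> H \<Longrightarrow> h \<in> H \<Longrightarrow> ip h (fscale c f) = cnj c * ip h f"
  by (metis scale_mem complex_cnj_mult ip_scale_left ip_commute)

lemma ip_diff_right [simp]:
  "f \<in> H \<Longrightarrow> g \<in> H \<Longrightarrow> h \<in> H \<Longrightarrow> ip h (f - g) = ip h f - ip h g"
  by (simp add: diff_eq_add_scale)

lemma ip_zero_left [simp]: "f \<in> H \<Longrightarrow> ip 0 f = 0"
  using ip_diff_left[of 0 0 f] by simp

lemma ip_zero_right [simp]: "f \<in> H \<Longrightarrow> ip f 0 = 0"
  using ip_diff_right[of 0 0 f] by simp

lemma sum_mem: "(\<And>i. i \<in> I \<Longrightarrow> F i \<in> H) \<Longrightarrow> sum F I \<in> H"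
  by (induction I rule: infinite_finite_induct) auto

lemma ip_sum_left:
  "(\<And>i. i \<in> I \<Longrightarrow> F i \<in> H) \<Longrightarrow> h \<in> H \<Longrightarrow> ip (sum F I) h = (\<Sum>i\<in>I. ip (F i) h)"
  by (induction I rule: infinite_finite_induct) (auto simp: sum_mem)

lemma ip_sum_right:
  "(\<And>i. i \<in> I \<Longrightarrow> F i \<in> H) \<Longrightarrow> h \<in> H \<Longrightarrow> ip h (sum F I) = (\<Sum>i\<in>I. ip h (F i))"
  by (induction I rule: infinite_finite_induct) (auto simp: sum_mem)

lemma ip_self: "f \<in> H \<Longrightarrow> ip f f = complex_of_real ((nrm f)\<^sup>2)"
  using ip_commute[of f f] ip_self_nonneg[of f]
  by (auto simp: ip_norm_def complex_eq_iff)

lemma nrm_nonneg [simp]: "f \<in> H \<Longrightarrow> 0 \<le> nrm f"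
  by (simp add: ip_norm_def ip_self_nonneg)

lemma nrm_zero [simp]: "nrm 0 = 0"
  by (simp add: ip_norm_def)

lemma nrm_eq_0D: "f \<in> H \<Longrightarrow> nrm f = 0 \<Longrightarrow> f = 0"
  using ip_self ip_self_eq_0D by force

lemma nrm_scale [simp]: "f \<in> H \<Longrightarrow> nrm (fscale c f) = cmod c * nrm f"
proof -
  assume f: "f \<in> H"
  have "ip (fscale c f) (fscale c f) = (c * cnj c) * ip f f"
    using f by simp
  also have "\<dots> = complex_of_real ((cmod c)\<^sup>2 * (nrm f)\<^sup>2)"
    unfolding complex_norm_square[symmetric] ip_self[OF f] by simp
  finally show ?thesis
    using f by (simp add: ip_norm_def[of ip "fscale c f"] real_sqrt_mult)
qed

lemma nrm_add_square:
  assumes "f \<in> H" "g \<in> H"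
  shows "(nrm (f + g))\<^sup>2 = (nrm f)\<^sup>2 + 2 * Re (ip f g) + (nrm g)\<^sup>2"
proof -
  have "complex_of_real ((nrm (f + g))\<^sup>2) = ip (f + g) (f + g)"
    using assms by (simp only: ip_self add_mem)
  also have "\<dots> = ip f f + (ip f g + cnj (ip f g)) + ip g g"
    using assms ip_commute[of f g] by simp
  also have "\<dots> = complex_of_real ((nrm f)\<^sup>2 + 2 * Re (ip f g) + (nrm g)\<^sup>2)"
    using assms by (simp add: ip_self complex_add_cnj)
  finally show ?thesis
    by (simp only: of_real_eq_iff)
qed

lemma nrm_diff_square:
  assumes "f \<in> H" "g \<in> H"
  shows "(nrm (f - g))\<^sup>2 = (nrm f)\<^sup>2 - 2 * Re (ip f g) + (nrm g)\<^sup>2"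
  using nrm_add_square[of f "fscale (-1) g"] assms by (simp add: diff_eq_add_scale)

lemma cauchy_schwarz:
  assumes "f \<in> H" "g \<in> H"
  shows "cmod (ip f g) \<le> nrm f * nrm g"
proof (cases "nrm g = 0")
  case True
  then show ?thesis using assms nrm_eq_0D[of g] by simp
next
  case False
  then have pos: "nrm g > 0" using nrm_nonneg[OF assms(2)] by simp
  define c where "c = ip f g / complex_of_real ((nrm g)\<^sup>2)"
  have "0 \<le> (nrm (f - fscale c g))\<^sup>2" by simp
  also have "\<dots> = (nrm f)\<^sup>2 - 2 * Re (cnj c * ip f g) + (cmod c * nrm g)\<^sup>2"
    using assms by (simp add: nrm_diff_square)
  also have "cnj c * ip f g = complex_of_real ((cmod (ip f g))\<^sup>2 / (nrm g)\<^sup>2)"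
    using complex_norm_square[of "ip f g"] by (simp add: c_def mult.commute)
  also have "(cmod c * nrm g)\<^sup>2 = (cmod (ip f g))\<^sup>2 / (nrm g)\<^sup>2"
  proof -
    have "cmod c = cmod (ip f g) / (nrm g)\<^sup>2"
      unfolding c_def norm_divide norm_of_real by simp
    then have "cmod c * nrm g = cmod (ip f g) / nrm g"
      using pos by (simp add: power2_eq_square)
    then show ?thesis by (simp add: power_divide)
  qed
  finally have "(cmod (ip f g))\<^sup>2 / (nrm g)\<^sup>2 \<le> (nrm f)\<^sup>2"
    by simp
  then have "(cmod (ip f g))\<^sup>2 \<le> (nrm f * nrm g)\<^sup>2"
    using pos by (simp add: field_simps power_mult_distrib)
  then show ?thesis
    using assms power2_le_imp_le by (metis mult_nonneg_nonneg nrm_nonneg)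
qed

lemma nrm_triangle:
  assumes "f \<in> H" "g \<in> H"
  shows "nrm (f + g) \<le> nrm f + nrm g"
proof -
  have "Re (ip f g) \<le> nrm f * nrm g"
    using cauchy_schwarz[OF assms] complex_Re_le_cmod order_trans by blast
  then have "(nrm (f + g))\<^sup>2 \<le> (nrm f + nrm g)\<^sup>2"
    using assms by (simp add: nrm_add_square power2_sum)
  then show ?thesis
    using assms power2_le_imp_le by (metis add_nonneg_nonneg nrm_nonneg)
qed

lemma nrm_triangle_diff:
  assumes "f \<in> H" "g \<in> H"
  shows "nrm (f - g) \<le> nrm f + nrm g"
  using nrm_triangle[of f "fscale (-1) g"] assms by (simp add: diff_eq_add_scale)

lemma nrm_abs_diff:
  assumes "f \<in> H" "g \<in> H"
  shows "\<bar>nrm f - nrm g\<bar> \<le> nrm (f - g)"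
proof -
  have "nrm f \<le> nrm (f - g) + nrm g" "nrm g \<le> nrm f + nrm (f - g)"
    using nrm_triangle[of "f - g" g] nrm_triangle_diff[of f "f - g"] assms by auto
  then show ?thesis by auto
qed

definition bounded_functional :: "(('a \<Rightarrow> complex) \<Rightarrow> complex) \<Rightarrow> bool" where
  "bounded_functional L \<longleftrightarrow>
     (\<forall>f\<in>H. \<forall>g\<in>H. L (f + g) = L f + L g) \<and>
     (\<forall>c. \<forall>f\<in>H. L (fscale c f) = c * L f) \<and>
     (\<exists>K\<ge>0. \<forall>f\<in>H. cmod (L f) \<le> K * nrm f)"

lemma bounded_functionalI:
  assumes "\<And>f g. f \<in> H \<Longrightarrow> g \<in> H \<Longrightarrow> L (f + g) = L f + L g"
    and "\<And>c f. f \<in> H \<Longrightarrow> L (fscale c f) = c * L f"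
    and "\<And>f. f \<in> H \<Longrightarrow> cmod (L f) \<le> K * nrm f"
  shows "bounded_functional L"
proof -
  have "cmod (L f) \<le> \<bar>K\<bar> * nrm f" if "f \<in> H" for f
    by (rule order_trans[OF assms(3)[OF that]]) (use that in \<open>auto intro!: mult_right_mono\<close>)
  then show ?thesis
    unfolding bounded_functional_def using assms(1,2) abs_ge_zero by blast
qed

lemma bounded_functional_diff:
  "bounded_functional L \<Longrightarrow> f \<in> H \<Longrightarrow> g \<in> H \<Longrightarrow> L (f - g) = L f - L g"
  unfolding bounded_functional_def diff_eq_add_scale
  by (metis add_uminus_conv_diff mult_minus1 scale_mem)

lemma bounded_functional_zero: "bounded_functional L \<Longrightarrow> L 0 = 0"
  using bounded_functional_diff[of L 0 0] by simp

lemma bounded_functional_sum: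
  assumes "bounded_functional L"
  shows "(\<And>i. i \<in> I \<Longrightarrow> F i \<in> H) \<Longrightarrow> L (\<Sum>i\<in>I. fscale (c i) (F i)) = (\<Sum>i\<in>I. c i * L (F i))"
proof (induction I rule: infinite_finite_induct)
  case (insert x A)
  have mem: "F x \<in> H" "(\<Sum>i\<in>A. fscale (c i) (F i)) \<in> H"
    using insert.prems by (auto intro!: sum_mem)
  have "L (fscale (c x) (F x) + (\<Sum>i\<in>A. fscale (c i) (F i)))
      = L (fscale (c x) (F x)) + L (\<Sum>i\<in>A. fscale (c i) (F i))"
    using assms mem scale_mem unfolding bounded_functional_def by blast
  also have "L (fscale (c x) (F x)) = c x * L (F x)"
    using assms mem unfolding bounded_functional_def by blast
  finally show ?case
    using insert.IH insert.prems by (simp only: sum.insert[OF insert.hyps]) simp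
qed (auto simp: bounded_functional_zero[OF assms])

text \<open>
  The representing vector is the minimizer of \<open>\<parallel>f\<parallel>\<^sup>2 - 2 Re (L f)\<close>. By the parallelogram law
  a minimizing sequence is Cauchy, and the first variation at the minimum vanishes.
\<close>

theorem riesz_representation:
  assumes L: "bounded_functional L"
  shows "\<exists>h\<in>H. \<forall>f\<in>H. L f = ip f h"
proof -
  obtain K where K: "K \<ge> 0" "\<And>f. f \<in> H \<Longrightarrow> cmod (L f) \<le> K * nrm f"
    using L unfolding bounded_functional_def by blast
  have Ladd: "L (f + g) = L f + L g" if "f \<in> H" "g \<in> H" for f g
    using L that unfolding bounded_functional_def by blast
  have Lscale: "L (fscale c f) = c * L f" if "f \<in> H" for c f
    using L that unfolding bounded_functional_def by blast
  define J where "J f = (nrm f)\<^sup>2 - 2 * Re (L f)" for f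
  have lower: "- (K\<^sup>2) \<le> J f" if "f \<in> H" for f
  proof -
    have "Re (L f) \<le> K * nrm f"
      using K(2)[OF that] complex_Re_le_cmod order_trans by blast
    then have "J f \<ge> (nrm f)\<^sup>2 - 2 * (K * nrm f)"
      by (simp add: J_def)
    moreover have "(nrm f - K)\<^sup>2 \<ge> 0" by simp
    ultimately show ?thesis by (simp add: power2_diff mult.commute)
  qed
  define m where "m = Inf (J ` H)"
  have bdd: "bdd_below (J ` H)" using lower by (auto intro!: bdd_belowI2)
  have m_le: "m \<le> J f" if "f \<in> H" for f
    unfolding m_def using bdd that by (auto intro: cInf_lower)
  have "\<exists>f\<in>H. J f < m + 1 / real (Suc n)" for n
  proof -
    have "J ` H \<noteq> {}" using zero_mem by blast
    moreover have "Inf (J ` H) < m + 1 / real (Suc n)" by (simp add: m_def)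
    ultimately obtain x where "x \<in> J ` H" "x < m + 1 / real (Suc n)"
      by (rule cInf_lessD[elim_format]) auto
    then show ?thesis by auto
  qed
  then have "\<forall>n. \<exists>f. f \<in> H \<and> J f < m + 1 / real (Suc n)" by blast
  from choice[OF this] obtain F
    where F: "\<And>n. F n \<in> H" "\<And>n. J (F n) < m + 1 / real (Suc n)" by blast
  have par: "(nrm (f - g))\<^sup>2 \<le> 2 * J f + 2 * J g - 4 * m" if "f \<in> H" "g \<in> H" for f g
  proof -
    have "m \<le> J (fscale (1/2) (f + g))" using that by (intro m_le) auto
    also have "\<dots> = (nrm (f + g))\<^sup>2 / 4 - Re (L f) - Re (L g)"
      using that by (simp add: J_def Lscale Ladd power_mult_distrib power_divide field_simps)
    finally show ?thesis
      unfolding J_def nrm_add_square[OF that] nrm_diff_square[OF that] by argo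
  qed
  have "\<exists>N. \<forall>i\<ge>N. \<forall>j\<ge>N. nrm (F i - F j) < e" if "e > 0" for e
  proof -
    obtain N where N: "1 / real (Suc N) < e\<^sup>2 / 4"
      using reals_Archimedean[of "e\<^sup>2 / 4", unfolded inverse_eq_divide] \<open>e > 0\<close>
      by (meson divide_pos_pos zero_less_numeral zero_less_power)
    have "nrm (F i - F j) < e" if "i \<ge> N" "j \<ge> N" for i j
    proof -
      have "1 / real (Suc i) \<le> 1 / real (Suc N)" "1 / real (Suc j) \<le> 1 / real (Suc N)"
        using that by (auto simp: field_simps)
      then have "(nrm (F i - F j))\<^sup>2 < e\<^sup>2"
        using par[OF F(1)[of i] F(1)[of j]] F(2)[of i] F(2)[of j] N by linarith
      then show ?thesis using \<open>e > 0\<close> by (intro power2_less_imp_less[of _ e]) auto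
    qed
    then show ?thesis by blast
  qed
  then obtain h where h: "h \<in> H" "(\<lambda>n. nrm (F n - h)) \<longlonglongrightarrow> 0"
    using complete[of F] F(1) by blast
  have "(\<lambda>n. nrm (F n)) \<longlonglongrightarrow> nrm h"
  proof (rule LIM_zero_cancel, rule Lim_null_comparison[OF _ h(2)])
    show "\<forall>\<^sub>F n in sequentially. norm (nrm (F n) - nrm h) \<le> nrm (F n - h)"
      using nrm_abs_diff F(1) h(1) by auto
  qed
  moreover have "(\<lambda>n. L (F n)) \<longlonglongrightarrow> L h"
  proof (rule LIM_zero_cancel, rule Lim_null_comparison)
    show "\<forall>\<^sub>F n in sequentially. norm (L (F n) - L h) \<le> K * nrm (F n - h)"
      using K(2)[of "F _ - h"] bounded_functional_diff[OF L] F(1) h(1) by auto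
    show "(\<lambda>n. K * nrm (F n - h)) \<longlonglongrightarrow> 0"
      using tendsto_mult_right_zero[OF h(2)] .
  qed
  ultimately have "(\<lambda>n. J (F n)) \<longlonglongrightarrow> J h"
    unfolding J_def by (intro tendsto_intros)
  moreover have "(\<lambda>n. m + 1 / real (Suc n)) \<longlonglongrightarrow> m + 0"
    using LIMSEQ_inverse_real_of_nat by (intro tendsto_intros) (simp add: inverse_eq_divide)
  ultimately have Jh: "J h \<le> m"
    using F(2) LIMSEQ_le[of "\<lambda>n. J (F n)" "J h" "\<lambda>n. m + 1 / real (Suc n)" "m + 0"]
    by (auto intro: less_imp_le)
  have "L f = ip f h" if f: "f \<in> H" for f
  proof -
    define d where "d = ip f h - L f"
    \<comment> \<open>first variation of \<open>J\<close> at \<open>h\<close> in the direction \<open>- cnj d \<cdot> f\<close>\<close>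
    have key: "0 \<le> t\<^sup>2 * ((cmod d)\<^sup>2 * (nrm f)\<^sup>2) - 2 * t * (cmod d)\<^sup>2" for t :: real
    proof -
      define c where "c = - complex_of_real t * cnj d"
      have dd: "cnj d * d = complex_of_real ((cmod d)\<^sup>2)"
        unfolding complex_norm_square by (rule mult.commute)
      have "Re (ip h (fscale c f)) = Re (c * ip f h)"
        using f h(1) by (simp add: ip_commute[of f h])
      then have "J (h + fscale c f) - J h = (cmod c * nrm f)\<^sup>2 + 2 * Re (c * d)"
        using f h(1) unfolding J_def d_def
        by (simp add: nrm_add_square Ladd Lscale algebra_simps)
      moreover have "J (h + fscale c f) \<ge> J h"
        using m_le[of "h + fscale c f"] Jh f h(1) by auto
      moreover have "(cmod c * nrm f)\<^sup>2 = t\<^sup>2 * ((cmod d)\<^sup>2 * (nrm f)\<^sup>2)"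
        by (simp add: c_def norm_mult power_mult_distrib)
      moreover have "Re (c * d) = - (t * (cmod d)\<^sup>2)"
        unfolding c_def mult.assoc dd by simp
      ultimately show ?thesis by simp
    qed
    have "(cmod d)\<^sup>2 = 0"
    proof (rule ccontr)
      assume "(cmod d)\<^sup>2 \<noteq> 0"
      then have pos: "(cmod d)\<^sup>2 > 0" by simp
      define t where "t = 1 / ((nrm f)\<^sup>2 + 1)"
      have t: "t > 0" "t * (nrm f)\<^sup>2 < 1"
        by (auto simp: t_def field_simps add_pos_nonneg add_nonneg_pos)
      have "0 \<le> (t * (cmod d)\<^sup>2) * (t * (nrm f)\<^sup>2 - 2)"
        using key[of t] by (simp add: power2_eq_square algebra_simps)
      moreover have "(t * (cmod d)\<^sup>2) * (t * (nrm f)\<^sup>2 - 2) < 0"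
        using t pos by (intro mult_pos_neg) auto
      ultimately show False by simp
    qed
    then show ?thesis by (simp add: d_def)
  qed
  then show ?thesis using h(1) by blast
qed

definition bounded_operator :: "(('a \<Rightarrow> complex) \<Rightarrow> ('a \<Rightarrow> complex)) \<Rightarrow> bool" where
  "bounded_operator A \<longleftrightarrow> linear_operator H A \<and> (\<exists>K\<ge>0. \<forall>f\<in>H. nrm (A f) \<le> K * nrm f)"

lemma bounded_operatorI:
  assumes "linear_operator H A" "\<And>f. f \<in> H \<Longrightarrow> nrm (A f) \<le> K * nrm f"
  shows "bounded_operator A"
proof -
  have "nrm (A f) \<le> \<bar>K\<bar> * nrm f" if "f \<in> H" for f
    by (rule order_trans[OF assms(2)[OF that]]) (use that in \<open>auto intro!: mult_right_mono\<close>)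
  then show ?thesis
    unfolding bounded_operator_def using assms(1) abs_ge_zero by blast
qed

lemma bounded_operator_add:
  "bounded_operator A \<Longrightarrow> f \<in> H \<Longrightarrow> g \<in> H \<Longrightarrow> A (f + g) = A f + A g"
  unfolding bounded_operator_def linear_operator_def by blast

lemma bounded_operator_scale:
  "bounded_operator A \<Longrightarrow> f \<in> H \<Longrightarrow> A (fscale c f) = fscale c (A f)"
  unfolding bounded_operator_def linear_operator_def by blast

lemma bounded_operator_mem: "bounded_operator A \<Longrightarrow> f \<in> H \<Longrightarrow> A f \<in> H"
  by (simp add: bounded_operator_def linear_operator_def)

lemma ip_right_cancel:
  assumes "h \<in> H" "h' \<in> H" "\<And>f. f \<in> H \<Longrightarrow> ip f h = ip f h'"
  shows "h = h'"
proof -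
  have "ip (h - h') (h - h') = ip (h - h') h - ip (h - h') h'"
    using assms(1,2) by (intro ip_diff_right) auto
  also have "\<dots> = 0"
    unfolding assms(3)[OF diff_mem[OF assms(1,2)]] by simp
  finally have "ip (h - h') (h - h') = 0" .
  then have "h - h' = 0" by (rule ip_self_eq_0D[OF diff_mem[OF assms(1,2)]])
  then show ?thesis by simp
qed

lemma hilbert_adjoint:
  assumes A: "bounded_operator A" and g: "g \<in> H"
  shows "hilbert_adjoint H ip A g \<in> H"
    and "\<And>f. f \<in> H \<Longrightarrow> ip (A f) g = ip f (hilbert_adjoint H ip A g)"
proof -
  obtain K where K: "K \<ge> 0" "\<And>f. f \<in> H \<Longrightarrow> nrm (A f) \<le> K * nrm f"
    using A unfolding bounded_operator_def by blast
  have "bounded_functional (\<lambda>f. ip (A f) g)"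
  proof (rule bounded_functionalI)
    fix f assume f: "f \<in> H"
    have "cmod (ip (A f) g) \<le> nrm (A f) * nrm g"
      by (rule cauchy_schwarz[OF bounded_operator_mem[OF A f] g])
    also have "\<dots> \<le> K * nrm f * nrm g"
      using K(2)[OF f] g by (intro mult_right_mono) auto
    finally show "cmod (ip (A f) g) \<le> K * nrm g * nrm f" by (simp add: mult_ac)
  next
    fix f f' assume f: "f \<in> H" "f' \<in> H"
    then show "ip (A (f + f')) g = ip (A f) g + ip (A f') g"
      by (simp only: bounded_operator_add[OF A] ip_add_left bounded_operator_mem[OF A] g)
  next
    fix c f assume f: "f \<in> H"
    then show "ip (A (fscale c f)) g = c * ip (A f) g"
      by (simp only: bounded_operator_scale[OF A] ip_scale_left bounded_operator_mem[OF A] g)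
  qed
  from riesz_representation[OF this]
  obtain h where h: "h \<in> H" "\<forall>f\<in>H. ip (A f) g = ip f h" by blast
  have "\<exists>!h. h \<in> H \<and> (\<forall>f\<in>H. ip (A f) g = ip f h)"
  proof (rule ex1I[of _ h])
    show "h \<in> H \<and> (\<forall>f\<in>H. ip (A f) g = ip f h)" using h by blast
    fix h' assume h': "h' \<in> H \<and> (\<forall>f\<in>H. ip (A f) g = ip f h')"
    show "h' = h"
    proof (rule ip_right_cancel)
      fix f assume "f \<in> H"
      then have "ip (A f) g = ip f h" "ip (A f) g = ip f h'" using h(2) h' by blast+
      then show "ip f h' = ip f h" by (rule trans[OF sym, rotated])
    qed (use h(1) h' in blast)+
  qed
  note adj = theI'[OF this, folded hilbert_adjoint_def[of H ip A g]]
  show "hilbert_adjoint H ip A g \<in> H"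
    and "\<And>f. f \<in> H \<Longrightarrow> ip (A f) g = ip f (hilbert_adjoint H ip A g)"
    by (rule adj[THEN conjunct1], rule adj[THEN conjunct2, THEN bspec])
qed

lemma bounded_operator_adjoint:
  assumes A: "bounded_operator A"
  shows "bounded_operator (hilbert_adjoint H ip A)"
proof -
  let ?S = "hilbert_adjoint H ip A"
  note S = hilbert_adjoint[OF A]
  note Am = bounded_operator_mem[OF A]
  obtain K where K: "K \<ge> 0" "\<And>f. f \<in> H \<Longrightarrow> nrm (A f) \<le> K * nrm f"
    using A unfolding bounded_operator_def by blast
  show ?thesis
  proof (rule bounded_operatorI)
    show "linear_operator H ?S"
      unfolding linear_operator_def
    proof (intro conjI ballI allI)
      show "?S f \<in> H" if "f \<in> H" for f using S(1)[OF that] .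
    next
      fix f g assume f: "f \<in> H" and g: "g \<in> H"
      show "?S (f + g) = ?S f + ?S g"
      proof (rule ip_right_cancel)
        fix h assume h: "h \<in> H"
        have "ip h (?S (f + g)) = ip (A h) (f + g)"
          using S(2)[OF add_mem[OF f g] h] by simp
        also have "\<dots> = ip h (?S f) + ip h (?S g)"
          using f g h by (simp only: ip_add_right Am S(2)[OF f] S(2)[OF g])
        also have "\<dots> = ip h (?S f + ?S g)"
          using f g h by (simp only: ip_add_right S(1))
        finally show "ip h (?S (f + g)) = ip h (?S f + ?S g)" .
      qed (auto simp: f g S(1))
    next
      fix f c assume f: "f \<in> H"
      show "?S (fscale c f) = fscale c (?S f)"
      proof (rule ip_right_cancel)
        fix h assume h: "h \<in> H"
        have "ip h (?S (fscale c f)) = ip (A h) (fscale c f)"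
          using S(2)[OF scale_mem[OF f] h] by simp
        also have "\<dots> = cnj c * ip h (?S f)"
          using f h by (simp only: ip_scale_right Am S(2)[OF f])
        also have "\<dots> = ip h (fscale c (?S f))"
          using f h by (simp only: ip_scale_right S(1))
        finally show "ip h (?S (fscale c f)) = ip h (fscale c (?S f))" .
      qed (auto simp: f S(1))
    qed
    fix g assume g: "g \<in> H"
    show "nrm (?S g) \<le> K * nrm g"
    proof (cases "nrm (?S g) = 0")
      case True
      then show ?thesis using K g by simp
    next
      case False
      then have pos: "nrm (?S g) > 0" using nrm_nonneg[OF S(1)[OF g]] by simp
      have "(nrm (?S g))\<^sup>2 = cmod (ip (?S g) (?S g))"
        using S(1)[OF g] by (simp add: ip_self norm_power)
      also have "\<dots> = cmod (ip (A (?S g)) g)" using S(2)[OF g S(1)[OF g]] by (rule arg_cong[OF sym])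
      also have "\<dots> \<le> nrm (A (?S g)) * nrm g"
        by (rule cauchy_schwarz[OF Am[OF S(1)[OF g]] g])
      also have "\<dots> \<le> K * nrm (?S g) * nrm g"
        using K(2)[OF S(1)[OF g]] g by (intro mult_right_mono) auto
      finally have "nrm (?S g) * nrm (?S g) \<le> (K * nrm g) * nrm (?S g)"
        by (simp only: power2_eq_square mult_ac)
      then show ?thesis using pos by (rule mult_right_le_imp_le)
    qed
  qed
qed

lemma bounded_operator_comp:
  assumes "bounded_operator A" "bounded_operator B"
  shows "bounded_operator (A \<circ> B)"
proof -
  obtain K where K: "K \<ge> 0" "\<And>f. f \<in> H \<Longrightarrow> nrm (A f) \<le> K * nrm f"
    using assms(1) unfolding bounded_operator_def by blast
  obtain M where M: "M \<ge> 0" "\<And>f. f \<in> H \<Longrightarrow> nrm (B f) \<le> M * nrm f"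
    using assms(2) unfolding bounded_operator_def by blast
  show ?thesis
  proof (rule bounded_operatorI)
    show "linear_operator H (A \<circ> B)"
      unfolding linear_operator_def o_apply
      by (simp add: assms[THEN bounded_operator_add] assms[THEN bounded_operator_scale]
            assms[THEN bounded_operator_mem])
    fix f assume f: "f \<in> H"
    have "nrm (A (B f)) \<le> K * nrm (B f)"
      by (rule K(2)[OF bounded_operator_mem[OF assms(2) f]])
    also have "\<dots> \<le> K * (M * nrm f)"
      using K(1) M(2)[OF f] by (rule mult_left_mono[rotated])
    finally show "nrm ((A \<circ> B) f) \<le> K * M * nrm f" by (simp only: mult.assoc o_apply)
  qed
qed


subsection \<open>Operators controlled by finitely many functionals\<close>

text \<open>
  On the common kernel of the functionals only the term in \<open>\<delta>\<close> remains; with the best choice of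
  \<open>M\<close> functionals this \<open>\<delta>\<close> is a Gelfand number of \<open>T\<close>. The term in \<open>K\<close> makes the estimate usable for vectors on which the
  functionals are merely small, such as differences of members of a sequence.
\<close>

definition approximable :: "(('a \<Rightarrow> complex) \<Rightarrow> ('a \<Rightarrow> complex)) \<Rightarrow> nat \<Rightarrow> real \<Rightarrow> bool" where
  "approximable T M \<delta> \<longleftrightarrow>
     (\<exists>K l. K \<ge> 0 \<and> (\<forall>j<M. bounded_functional (l j)) \<and>
        (\<forall>f\<in>H. nrm (T f) \<le> K * (\<Sum>j<M. cmod (l j f)) + \<delta> * nrm f))"

text \<open>
  Countably many bounded functionals occur, so a diagonal subsequence makes all of them converge along
  the given bounded sequence. The estimate of level \<open>n\<close> then bounds the differences of the images by
  a null sequence plus a multiple of \<open>\<delta> n\<close>, and the images form a Cauchy sequence.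
\<close>

theorem compact_if_approximable:
  assumes T: "bounded_operator T"
    and approx: "\<And>n. approximable T (M n) (\<delta> n)" and lim: "\<delta> \<longlonglongrightarrow> 0"
  shows "compact_operator H ip T"
  unfolding compact_operator_def
proof (intro conjI allI impI)
  show "linear_operator H T" using T by (simp add: bounded_operator_def)
  fix F :: "nat \<Rightarrow> 'a \<Rightarrow> complex" and B
  assume "\<forall>n. F n \<in> H \<and> nrm (F n) \<le> B"
  then have F: "\<And>n. F n \<in> H" "\<And>n. nrm (F n) \<le> B" by auto
  have B: "B \<ge> 0" using F(2)[of 0] nrm_nonneg[OF F(1)[of 0]] by linarith
  have "\<forall>n. \<exists>K l. K \<ge> 0 \<and> (\<forall>j<M n. bounded_functional (l j)) \<and>
        (\<forall>f\<in>H. nrm (T f) \<le> K * (\<Sum>j<M n. cmod (l j f)) + \<delta> n * nrm f)"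
    using approx unfolding approximable_def by blast
  then obtain K l where K: "\<And>n. K n \<ge> 0"
    and l: "\<And>n j. j < M n \<Longrightarrow> bounded_functional (l n j)"
    and est: "\<And>n f. f \<in> H \<Longrightarrow> nrm (T f) \<le> K n * (\<Sum>j<M n. cmod (l n j f)) + \<delta> n * nrm f"
    by metis
  have "\<forall>x\<in>{x. snd x < M (fst x)}. \<exists>C\<ge>0. \<forall>f\<in>H. cmod (l (fst x) (snd x) f) \<le> C * nrm f"
    using l unfolding bounded_functional_def by blast
  from bchoice[OF this] obtain C
    where C0: "\<forall>x\<in>{x. snd x < M (fst x)}.
      0 \<le> C x \<and> (\<forall>f\<in>H. cmod (l (fst x) (snd x) f) \<le> C x * nrm f)" ..
  have C: "0 \<le> C x" "f \<in> H \<Longrightarrow> cmod (l (fst x) (snd x) f) \<le> C x * nrm f"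
    if "snd x < M (fst x)" for x f
    using bspec[OF C0, of x] that by auto
  \<comment> \<open>dividing by the norms makes the whole family uniformly bounded on the sequence\<close>
  define X where "X k x = l (fst x) (snd x) (F k) / complex_of_real (C x + 1)" for k x
  have X_bound: "norm (X k x) \<le> B" if "x \<in> {x. snd x < M (fst x)}" for k x
  proof -
    have x: "snd x < M (fst x)" using that by simp
    have "cmod (l (fst x) (snd x) (F k)) \<le> C x * nrm (F k)" by (rule C(2)[OF x F(1)])
    also have "\<dots> \<le> C x * B" by (rule mult_left_mono[OF F(2) C(1)[OF x]])
    also have "\<dots> \<le> B * (C x + 1)" using B by (simp add: algebra_simps)
    finally have le: "cmod (l (fst x) (snd x) (F k)) \<le> B * (C x + 1)" .
    have "\<bar>C x + 1\<bar> = C x + 1" "0 < C x + 1" using C(1)[OF x] by auto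
    then show ?thesis
      unfolding X_def norm_divide norm_of_real using le by (simp only: pos_divide_le_eq)
  qed
  have "\<exists>r :: nat \<Rightarrow> nat. strict_mono r \<and>
      (\<forall>x. snd x < M (fst x) \<longrightarrow> (\<exists>L. (\<lambda>k. X (r k) x) \<longlonglongrightarrow> L))"
  proof (rule function_convergent_subsequence[of _ X, OF countableI_type X_bound])
    fix k :: "nat \<Rightarrow> nat"
    assume k: "strict_mono k"
      "\<And>x. x \<in> {x. snd x < M (fst x)} \<Longrightarrow> \<exists>L. (\<lambda>n. X (k n) x) \<longlonglongrightarrow> L"
    show ?thesis
    proof (intro exI[of _ k] conjI allI impI)
      fix x assume "snd x < M (fst x)"
      then show "\<exists>L. (\<lambda>n. X (k n) x) \<longlonglongrightarrow> L" by (intro k(2)) simp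
    qed (rule k(1))
  qed
  then obtain r :: "nat \<Rightarrow> nat" where r: "strict_mono r"
    and conv: "\<And>x. snd x < M (fst x) \<Longrightarrow> \<exists>L. (\<lambda>k. X (r k) x) \<longlonglongrightarrow> L"
    by blast
  have conv': "\<exists>L. (\<lambda>k. l n j (F (r k))) \<longlonglongrightarrow> L" if "j < M n" for n j
  proof -
    obtain L where L: "(\<lambda>k. X (r k) (n, j)) \<longlonglongrightarrow> L" using conv[of "(n, j)"] \<open>j < M n\<close> by auto
    have "complex_of_real (C (n, j) + 1) \<noteq> 0"
      using C(1)[of "(n, j)"] \<open>j < M n\<close> unfolding of_real_eq_0_iff by simp
    then have "(\<lambda>k. l n j (F (r k))) = (\<lambda>k. X (r k) (n, j) * complex_of_real (C (n, j) + 1))"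
      unfolding X_def fst_conv snd_conv by simp
    then show ?thesis using tendsto_mult_right[OF L] by auto
  qed
  have diffT: "T (f - g) = T f - T g" if "f \<in> H" "g \<in> H" for f g
    using that unfolding diff_eq_add_scale
    by (simp only: bounded_operator_add[OF T] bounded_operator_scale[OF T] scale_mem)
  have "\<exists>N. \<forall>a\<ge>N. \<forall>b\<ge>N. nrm (T (F (r a)) - T (F (r b))) < e" if "e > 0" for e
  proof -
    have "\<forall>\<^sub>F n in sequentially. norm (\<delta> n - 0) < e / (4 * (B + 1))"
      using B \<open>e > 0\<close> by (intro tendstoD[OF lim, unfolded dist_norm]) auto
    then obtain n where n: "\<bar>\<delta> n\<bar> < e / (4 * (B + 1))"
      unfolding eventually_sequentially by auto
    have small: "\<delta> n * (2 * B) < e / 2"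
    proof -
      have "\<delta> n * (2 * B) \<le> \<bar>\<delta> n\<bar> * (2 * (B + 1))"
        using B by (intro mult_mono) auto
      also have "\<dots> < e / (4 * (B + 1)) * (2 * (B + 1))"
        using n B by (intro mult_strict_right_mono) auto
      also have "\<dots> = e / 2" using B by (simp add: field_simps)
      finally show ?thesis .
    qed
    obtain L where L: "\<And>j. j < M n \<Longrightarrow> (\<lambda>k. l n j (F (r k))) \<longlonglongrightarrow> L j"
    proof -
      have "\<forall>j\<in>{..<M n}. \<exists>L. (\<lambda>k. l n j (F (r k))) \<longlonglongrightarrow> L" using conv' by blast
      from bchoice[OF this] show thesis using that by blast
    qed
    define S where "S k = (\<Sum>j<M n. cmod (l n j (F (r k)) - L j))" for k
    have "S \<longlonglongrightarrow> (\<Sum>j<M n. 0)" unfolding S_def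
      by (intro tendsto_sum tendsto_norm_zero LIM_zero L) auto
    then have "(\<lambda>k. K n * S k) \<longlonglongrightarrow> 0" by (simp add: tendsto_mult_right_zero)
    from tendstoD[OF this, of "e / 4"]
    have "\<forall>\<^sub>F k in sequentially. norm (K n * S k - 0) < e / 4"
      using \<open>e > 0\<close> by (simp add: dist_norm)
    then obtain N where N': "\<forall>k\<ge>N. norm (K n * S k - 0) < e / 4"
      unfolding eventually_sequentially by blast
    have N: "K n * S k < e / 4" if "k \<ge> N" for k
      using spec[OF N', of k] that by (simp add: abs_less_iff)
    have "nrm (T (F (r a)) - T (F (r b))) < e" if "a \<ge> N" "b \<ge> N" for a b
    proof -
      let ?f = "F (r a) - F (r b)"
      have f: "?f \<in> H" using F by simp
      have "cmod (l n j ?f) \<le> cmod (l n j (F (r a)) - L j) + cmod (l n j (F (r b)) - L j)"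
        if "j < M n" for j
        using norm_triangle_ineq4[of "l n j (F (r a)) - L j" "l n j (F (r b)) - L j"]
          bounded_functional_diff[OF l[OF that]] F(1) by simp
      then have "(\<Sum>j<M n. cmod (l n j ?f)) \<le> S a + S b"
        unfolding S_def sum.distrib[symmetric] by (intro sum_mono) auto
      then have "K n * (\<Sum>j<M n. cmod (l n j ?f)) \<le> K n * S a + K n * S b"
        using K[of n] by (metis distrib_left mult_left_mono)
      moreover have "\<delta> n * nrm ?f \<le> e / 2"
      proof (cases "\<delta> n \<ge> 0")
        case True
        have "nrm ?f \<le> 2 * B" using nrm_triangle_diff[OF F(1) F(1), of "r a" "r b"]
            F(2)[of "r a"] F(2)[of "r b"] by linarith
        then show ?thesis using small True mult_left_mono[of "nrm ?f" "2 * B" "\<delta> n"] by linarith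
      next
        case False
        then show ?thesis using \<open>e > 0\<close> nrm_nonneg[OF f]
          by (smt (verit) field_sum_of_halves mult_nonneg_nonneg mult_minus_left)
      qed
      ultimately show ?thesis
        using est[OF f, of n] N[OF \<open>a \<ge> N\<close>] N[OF \<open>b \<ge> N\<close>] diffT[OF F(1) F(1), of "r a" "r b"]
        by simp
    qed
    then show ?thesis by blast
  qed
  then obtain g where "g \<in> H" "(\<lambda>n. nrm (T (F (r n)) - g)) \<longlonglongrightarrow> 0"
    using complete[of "\<lambda>n. T (F (r n))"] bounded_operator_mem[OF T F(1)] by blast
  then show "\<exists>r g. strict_mono r \<and> g \<in> H \<and> (\<lambda>n. nrm (T (F (r n)) - g)) \<longlonglongrightarrow> 0"
    using r by blast
qed

end

section \<open>Counting singular values\<close>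

text \<open>
  Gaussian elimination: an unknown with a nonzero coefficient in the last equation is solved for and
  substituted into the others.
\<close>

lemma exists_nontrivial_solution:
  fixes A :: "nat \<Rightarrow> 'b \<Rightarrow> complex"
  assumes "finite B" "card B > M"
  shows "\<exists>c. (\<exists>b\<in>B. c b \<noteq> 0) \<and> (\<forall>j<M. (\<Sum>b\<in>B. A j b * c b) = 0)"
  using assms
proof (induction M arbitrary: A B)
  case 0
  then show ?case by (intro exI[of _ "\<lambda>_. 1"]) (auto simp: card_gt_0_iff)
next
  case (Suc M)
  show ?case
  proof (cases "\<forall>b\<in>B. A M b = 0")
    case True
    obtain c where "\<exists>b\<in>B. c b \<noteq> 0" "\<forall>j<M. (\<Sum>b\<in>B. A j b * c b) = 0"
      using Suc.IH[of B A] Suc.prems by auto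
    then show ?thesis using True by (intro exI[of _ c]) (auto simp: less_Suc_eq)
  next
    case False
    then obtain b0 where b0: "b0 \<in> B" "A M b0 \<noteq> 0" by blast
    define B' where "B' = B - {b0}"
    have B': "finite B'" "card B' > M" "b0 \<notin> B'" "B = insert b0 B'"
      using Suc.prems b0 by (auto simp: B'_def)
    define A' where "A' j b = A j b - A j b0 * A M b / A M b0" for j b
    obtain c' where c': "\<exists>b\<in>B'. c' b \<noteq> 0" "\<forall>j<M. (\<Sum>b\<in>B'. A' j b * c' b) = 0"
      using Suc.IH[of B' A'] B' by auto
    define x where "x = - (\<Sum>b\<in>B'. A M b * c' b) / A M b0"
    define c where "c = c'(b0 := x)"
    have sum_c: "(\<Sum>b\<in>B. A j b * c b) = A j b0 * x + (\<Sum>b\<in>B'. A j b * c' b)" for j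
    proof -
      have "(\<Sum>b\<in>B'. A j b * c b) = (\<Sum>b\<in>B'. A j b * c' b)"
        using B'(3) by (intro sum.cong) (auto simp: c_def)
      then show ?thesis using B' by (simp add: c_def)
    qed
    have "(\<Sum>b\<in>B. A j b * c b) = 0" if "j < Suc M" for j
    proof (cases "j = M")
      case True
      then show ?thesis using b0(2) by (simp add: sum_c x_def)
    next
      case False
      then have "(\<Sum>b\<in>B'. A' j b * c' b) = 0" using c'(2) that by auto
      then have "(\<Sum>b\<in>B'. A j b * c' b) = A j b0 / A M b0 * (\<Sum>b\<in>B'. A M b * c' b)"
        by (simp add: A'_def algebra_simps sum_subtractf sum_distrib_left)
      then show ?thesis by (simp add: sum_c x_def)
    qed
    moreover have "\<exists>b\<in>B. c b \<noteq> 0"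
      using c'(1) B'(3,4) by (auto simp: c_def)
    ultimately show ?thesis by blast
  qed
qed

text \<open>
  The \<open>n\<close>-th entry is the largest value \<open>t\<close> such that the values \<open>\<ge> t\<close>, counted with the
  multiplicity \<open>d\<close>, number more than \<open>n\<close>, and it is \<open>0\<close> if there is no such \<open>t\<close>. Hence \<open>t\<close> fills
  exactly the positions between the count of the values \<open>> t\<close> and that of the values \<open>\<ge> t\<close>.
\<close>

lemma decreasing_enumeration:
  fixes d :: "real \<Rightarrow> nat"
  assumes fin: "\<And>e. e > 0 \<Longrightarrow> finite {t. e \<le> t \<and> 0 < d t}"
  obtains s :: "nat \<Rightarrow> real" where "decseq s" "\<And>n. 0 \<le> s n"
    "\<And>t. t > 0 \<Longrightarrow> finite {n. s n = t} \<and> card {n. s n = t} = d t"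
    "\<And>n. s n > 0 \<Longrightarrow> n < sum d {t. s n \<le> t \<and> 0 < d t}"
proof -
  define c where "c e = sum d {t. e \<le> t \<and> 0 < d t}" for e
  define P where "P n = {t. 0 < t \<and> 0 < d t \<and> n < c t}" for n
  have ex_max: "\<exists>t. t \<in> P n \<and> (\<forall>u\<in>P n. u \<le> t)" if ne: "P n \<noteq> {}" for n
  proof -
    obtain t0 where t0: "t0 \<in> P n" using ne by blast
    have "finite {t \<in> P n. t0 \<le> t}"
      using t0 by (intro finite_subset[OF _ fin[of t0]]) (auto simp: P_def)
    then have "\<forall>u\<in>{t \<in> P n. t0 \<le> t}. u \<le> Max {t \<in> P n. t0 \<le> t}"
      and "Max {t \<in> P n. t0 \<le> t} \<in> {t \<in> P n. t0 \<le> t}"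
      using t0 by (intro ballI Max_ge Max_in; blast)+
    then show ?thesis by (intro exI[of _ "Max {t \<in> P n. t0 \<le> t}"]) force
  qed
  define s where "s n = (if P n = {} then 0 else SOME t. t \<in> P n \<and> (\<forall>u\<in>P n. u \<le> t))" for n
  have s0: "s n = 0" if "P n = {}" for n using that by (simp add: s_def)
  have s: "s n \<in> P n" "\<And>u. u \<in> P n \<Longrightarrow> u \<le> s n" if "P n \<noteq> {}" for n
    using someI_ex[OF ex_max[OF that]] that by (auto simp: s_def)
  have Ppos: "t > 0" if "t \<in> P n" for t n using that by (simp add: P_def)
  have s_nonneg: "0 \<le> s n" for n
    using s0[of n] s(1)[of n] Ppos[of "s n" n] by fastforce
  have s_iff: "s n = t \<longleftrightarrow> t \<in> P n \<and> (\<forall>u\<in>P n. u \<le> t)" if "t > 0" for n t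
    using s0[of n] s[of n] that by (cases "P n = {}") (auto intro: antisym)
  have "decseq s"
  proof (rule decseq_SucI)
    fix n
    have "P (Suc n) \<subseteq> P n" by (auto simp: P_def)
    then show "s (Suc n) \<le> s n"
      using s0[of "Suc n"] s[of "Suc n"] s[of n] s_nonneg[of n] by (cases "P (Suc n) = {}") auto
  qed
  moreover have "finite {n. s n = t} \<and> card {n. s n = t} = d t" if t: "t > 0" for t
  proof (cases "d t = 0")
    case True
    then have "{n. s n = t} = {}" using s_iff[OF t] by (auto simp: P_def)
    then show ?thesis using True by simp
  next
    case False
    define U where "U = {u. t \<le> u \<and> 0 < d u} - {t}"
    have finU: "finite U" unfolding U_def using fin[OF t] by blast
    have ct: "c t = d t + sum d U"
      unfolding c_def U_def using False fin[OF t] by (intro sum.remove) auto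
    have "s n = t \<longleftrightarrow> sum d U \<le> n \<and> n < c t" for n
    proof -
      have cu: "c u \<le> sum d U" if "t < u" for u
        unfolding c_def using finU that by (intro sum_mono2) (auto simp: U_def)
      have le: "sum d U \<le> n" if tP: "t \<in> P n" and max: "\<forall>u\<in>P n. u \<le> t"
      proof (cases "U = {}")
        case True
        then show ?thesis by simp
      next
        case False
        note MinU = Min_in[OF finU False]
        have "{u. Min U \<le> u \<and> 0 < d u} = U"
          using MinU Min_le[OF finU] by (auto simp: U_def)
        then have "c (Min U) = sum d U" by (simp add: c_def)
        moreover have "t < Min U" "0 < d (Min U)" using MinU by (auto simp: U_def)
        moreover have "Min U \<notin> P n" using max \<open>t < Min U\<close> by auto
        ultimately show ?thesis using t by (simp add: P_def)
      qed
      show ?thesis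
      proof
        assume "s n = t"
        then have "t \<in> P n" "\<forall>u\<in>P n. u \<le> t" using s_iff[OF t] by auto
        then show "sum d U \<le> n \<and> n < c t" using le by (simp add: P_def)
      next
        assume n: "sum d U \<le> n \<and> n < c t"
        have "u \<le> t" if "u \<in> P n" for u
        proof (rule ccontr)
          assume "\<not> u \<le> t"
          then have "c u \<le> n" using cu[of u] n by simp
          then show False using that by (simp add: P_def)
        qed
        then show "s n = t" using s_iff[OF t] n t False by (simp add: P_def)
      qed
    qed
    then have "{n. s n = t} = {sum d U..<c t}"
      by (intro set_eqI) (simp only: mem_Collect_eq atLeastLessThan_iff)
    then show ?thesis using ct by simp
  qed
  moreover have "n < sum d {t. s n \<le> t \<and> 0 < d t}" if "s n > 0" for n
  proof -
    have "P n \<noteq> {}" using that s0[of n] by fastforce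
    from s(1)[OF this] show ?thesis by (simp add: P_def c_def)
  qed
  ultimately show thesis using that s_nonneg by blast
qed

lemma powr_of_power: "0 < x \<Longrightarrow> (x ^ n) powr q = (x powr q) ^ n" for x q :: real
  by (induction n) (simp_all add: powr_mult)

text \<open>
  The best exponent for the index \<open>n\<close> is \<open>N = (n - 1) div 2\<close>, so the sequence is dominated by a
  geometric one of ratio \<open>sqrt \<rho>\<close>, and so are its powers, with ratio \<open>(sqrt \<rho>) powr q\<close>.
\<close>

lemma summable_powr_of_geometric_bound:
  fixes s :: "nat \<Rightarrow> real"
  assumes "\<And>n. 0 \<le> s n" "0 < \<rho>" "\<rho> < 1" "q > 0"
    and bound: "\<And>N n. 2 * N + 1 \<le> n \<Longrightarrow> s n \<le> C * \<rho> ^ N"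
  shows "summable (\<lambda>n. s n powr q)"
proof -
  define \<sigma> where "\<sigma> = sqrt \<rho>"
  have \<sigma>: "0 < \<sigma>" "\<sigma> < 1" "\<sigma>\<^sup>2 = \<rho>" using assms(2,3) by (auto simp: \<sigma>_def)
  have C: "C \<ge> 0" using bound[of 0 1] assms(1)[of 1] by simp
  have le: "s n \<le> C / \<rho> * \<sigma> ^ n" if "n \<ge> 1" for n
  proof -
    let ?N = "(n - 1) div 2"
    have "\<rho> ^ ?N = \<sigma> ^ (2 * ?N)" unfolding power_mult \<sigma>(3) ..
    also have "\<sigma> ^ (2 * ?N) = \<sigma> ^ (2 * ?N + 2) / \<rho>"
      unfolding power_add \<sigma>(3) using assms(2) by simp
    also have "\<dots> \<le> \<sigma> ^ n / \<rho>"
      using \<sigma> assms(2) that by (intro divide_right_mono power_decreasing) auto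
    finally have "C * \<rho> ^ ?N \<le> C * (\<sigma> ^ n / \<rho>)" using C by (rule mult_left_mono)
    moreover have "s n \<le> C * \<rho> ^ ?N" using that by (intro bound) auto
    ultimately show ?thesis by simp
  qed
  have "summable (\<lambda>n. (C / \<rho>) powr q * (\<sigma> powr q) ^ n)"
    using \<sigma> assms(4) by (intro summable_mult summable_geometric) (auto simp: powr01_less_one)
  then show ?thesis
  proof (rule summable_comparison_test'[where N = 1])
    fix n :: nat assume n: "n \<ge> 1"
    have "s n powr q \<le> (C / \<rho> * \<sigma> ^ n) powr q"
      using le[OF n] assms(1,4) by (intro powr_mono2) auto
    also have "\<dots> = (C / \<rho>) powr q * (\<sigma> powr q) ^ n"
    proof -
      have "(\<sigma> ^ n) powr q = (\<sigma> powr q) ^ n" using \<sigma>(1) by (rule powr_of_power)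
      then show ?thesis
        using C \<sigma>(1) assms(2) by (subst powr_mult) auto
    qed
    finally show "norm (s n powr q) \<le> (C / \<rho>) powr q * (\<sigma> powr q) ^ n" by simp
  qed
qed

interpretation fun_space: vector_space "fscale :: complex \<Rightarrow> ('a \<Rightarrow> complex) \<Rightarrow> ('a \<Rightarrow> complex)"
  by unfold_locales (auto simp: fscale_def fun_eq_iff algebra_simps)

context function_hilbert_space
begin

definition singular_space :: "(('a \<Rightarrow> complex) \<Rightarrow> ('a \<Rightarrow> complex)) \<Rightarrow> real \<Rightarrow> ('a \<Rightarrow> complex) set" where
  "singular_space T t = {f \<in> H. hilbert_adjoint H ip T (T f) = fscale (complex_of_real (t\<^sup>2)) f}"

lemma singular_space_ip:
  assumes T: "bounded_operator T" and f: "f \<in> singular_space T t" and g: "g \<in> H"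
  shows "ip (T f) (T g) = of_real (t\<^sup>2) * ip f g"
proof -
  have fH: "f \<in> H" and eig: "hilbert_adjoint H ip T (T f) = fscale (complex_of_real (t\<^sup>2)) f"
    using f by (auto simp: singular_space_def)
  note m = bounded_operator_mem[OF T]
  have "ip (T f) (T g) = cnj (ip (T g) (T f))" by (rule ip_commute[OF m[OF g] m[OF fH]])
  also have "ip (T g) (T f) = ip g (hilbert_adjoint H ip T (T f))"
    by (rule hilbert_adjoint(2)[OF T m[OF fH] g])
  also have "\<dots> = of_real (t\<^sup>2) * cnj (ip f g)"
    unfolding eig using fH g ip_commute[OF fH g] by simp
  finally show ?thesis by simp
qed

text \<open>
  Both \<open>t\<^sup>2 \<langle>f, g\<rangle>\<close> and \<open>u\<^sup>2 \<langle>f, g\<rangle>\<close> are equal to \<open>\<langle>T f, T g\<rangle>\<close>.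
\<close>

lemma singular_space_orthogonal:
  assumes T: "bounded_operator T" and f: "f \<in> singular_space T t" and g: "g \<in> singular_space T u"
    and tu: "0 < t" "0 < u" "t \<noteq> u"
  shows "ip f g = 0"
proof -
  have fg: "f \<in> H" "g \<in> H" using f g by (auto simp: singular_space_def)
  note m = bounded_operator_mem[OF T]
  have "of_real (t\<^sup>2) * ip f g = ip (T f) (T g)" using singular_space_ip[OF T f fg(2)] by simp
  also have "\<dots> = cnj (ip (T g) (T f))" by (rule ip_commute[OF m[OF fg(2)] m[OF fg(1)]])
  also have "\<dots> = of_real (u\<^sup>2) * ip f g"
    using singular_space_ip[OF T g fg(1)] ip_commute[OF fg] by simp
  finally have "of_real (t\<^sup>2 - u\<^sup>2) * ip f g = 0" by (simp add: algebra_simps)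
  moreover have "t\<^sup>2 \<noteq> u\<^sup>2" using tu by (simp add: power2_eq_iff)
  ultimately show ?thesis by (metis eq_iff_diff_eq_0 mult_eq_0_iff of_real_eq_0_iff)
qed

lemma singular_space_sum:
  assumes T: "bounded_operator T"
  shows "(\<And>i. i \<in> I \<Longrightarrow> F i \<in> singular_space T t) \<Longrightarrow>
    (\<Sum>i\<in>I. fscale (c i) (F i)) \<in> singular_space T t"
proof (induction I rule: infinite_finite_induct)
  have z: "0 \<in> singular_space T t"
  proof -
    have B: "bounded_operator (hilbert_adjoint H ip T \<circ> T)"
      by (intro bounded_operator_comp bounded_operator_adjoint T)
    have "(hilbert_adjoint H ip T \<circ> T) (fscale 0 0) = fscale 0 ((hilbert_adjoint H ip T \<circ> T) 0)"
      by (rule bounded_operator_scale[OF B]) simp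
    moreover have "fscale c (0 :: 'a \<Rightarrow> complex) = 0" "fscale 0 f = 0" for c and f :: "'a \<Rightarrow> complex"
      by (auto simp: fscale_def fun_eq_iff)
    ultimately show ?thesis by (simp add: singular_space_def)
  qed
  {
    case (infinite A)
    show ?case unfolding sum.infinite[OF infinite(1)] by (rule z)
  next
    case empty
    show ?case unfolding sum.empty by (rule z)
  }
  case (insert x A)
  let ?S = "hilbert_adjoint H ip T \<circ> T"
  let ?s = "\<Sum>i\<in>A. fscale (c i) (F i)"
  have B: "bounded_operator ?S"
    by (intro bounded_operator_comp bounded_operator_adjoint T)
  have mem: "F x \<in> singular_space T t" "?s \<in> singular_space T t"
    using insert by auto
  then have H: "F x \<in> H" "?s \<in> H" by (auto simp: singular_space_def)
  have "?S (fscale (c x) (F x) + ?s) = fscale (c x) (?S (F x)) + ?S ?s"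
    using H by (simp only: bounded_operator_add[OF B] bounded_operator_scale[OF B] scale_mem)
  also have "\<dots> = fscale (complex_of_real (t\<^sup>2)) (fscale (c x) (F x) + ?s)"
    using mem by (simp add: singular_space_def fscale_def algebra_simps fun_eq_iff)
  finally have "fscale (c x) (F x) + ?s \<in> singular_space T t"
    using H by (simp add: singular_space_def)
  then show ?case by (simp only: sum.insert[OF insert.hyps])
qed

text \<open>
  Given more than \<open>M\<close> vectors, some combination \<open>f \<noteq> 0\<close> of them is annihilated by the \<open>M\<close>
  functionals, so that \<open>\<parallel>T f\<parallel> \<le> \<delta> \<parallel>f\<parallel>\<close>. On the other hand the components of \<open>f\<close> in the different
  spaces are orthogonal and so are their images, whence \<open>\<parallel>T f\<parallel> \<ge> e \<parallel>f\<parallel>\<close>, and \<open>e > \<delta>\<close>.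
\<close>

lemma independent_singular_vectors_le:
  assumes T: "bounded_operator T" and appr: "approximable T M \<delta>" and e: "e > \<delta>" "e > 0"
    and \<Theta>: "finite \<Theta>" "\<And>t. t \<in> \<Theta> \<Longrightarrow> e \<le> t"
    and B: "\<And>t. t \<in> \<Theta> \<Longrightarrow> finite (B t)" "\<And>t. t \<in> \<Theta> \<Longrightarrow> B t \<subseteq> singular_space T t"
      "\<And>t. t \<in> \<Theta> \<Longrightarrow> fun_space.independent (B t)"
  shows "(\<Sum>t\<in>\<Theta>. card (B t)) \<le> M"
proof (rule ccontr)
  assume "\<not> ?thesis"
  then have card: "card (Sigma \<Theta> B) > M" using \<Theta>(1) B(1) by simp
  have fin: "finite (Sigma \<Theta> B)" using \<Theta>(1) B(1) by blast
  obtain K l where l: "\<And>j. j < M \<Longrightarrow> bounded_functional (l j)"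
    and est: "\<And>f. f \<in> H \<Longrightarrow> nrm (T f) \<le> K * (\<Sum>j<M. cmod (l j f)) + \<delta> * nrm f"
    using appr unfolding approximable_def by blast
  obtain c where c: "\<exists>x\<in>Sigma \<Theta> B. c x \<noteq> 0"
    "\<And>j. j < M \<Longrightarrow> (\<Sum>x\<in>Sigma \<Theta> B. l j (snd x) * c x) = 0"
    using exists_nontrivial_solution[OF fin card, of "\<lambda>j x. l j (snd x)"] by blast
  define f where "f t = (\<Sum>b\<in>B t. fscale (c (t, b)) b)" for t
  have f_mem: "f t \<in> singular_space T t" if "t \<in> \<Theta>" for t
    unfolding f_def by (rule singular_space_sum[OF T]) (use B(2)[OF that] in auto)
  then have fH: "f t \<in> H" if "t \<in> \<Theta>" for t using that by (auto simp: singular_space_def)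
  have BH: "b \<in> H" if "t \<in> \<Theta>" "b \<in> B t" for t b using B(2) that by (auto simp: singular_space_def)
  have sH: "sum f \<Theta> \<in> H" using fH by (rule sum_mem)
  have "l j (sum f \<Theta>) = 0" if j: "j < M" for j
  proof -
    have "sum f \<Theta> = (\<Sum>x\<in>Sigma \<Theta> B. fscale (c x) (snd x))"
      unfolding f_def using \<Theta>(1) B(1) by (subst sum.Sigma) (auto simp: case_prod_beta)
    then have "l j (sum f \<Theta>) = (\<Sum>x\<in>Sigma \<Theta> B. c x * l j (snd x))"
      using BH by (simp only:) (rule bounded_functional_sum[OF l[OF j]], auto)
    then show ?thesis using c(2)[OF j] by (simp add: mult.commute)
  qed
  then have le: "nrm (T (sum f \<Theta>)) \<le> \<delta> * nrm (sum f \<Theta>)" using est[OF sH] by simp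
  have orth: "ip (f t) (f u) = (if t = u then complex_of_real ((nrm (f t))\<^sup>2) else 0)"
    if "t \<in> \<Theta>" "u \<in> \<Theta>" for t u
    using singular_space_orthogonal[OF T f_mem[OF that(1)] f_mem[OF that(2)]] \<Theta>(2)[OF that(1)]
      \<Theta>(2)[OF that(2)] e ip_self[OF fH[OF that(1)]] by auto
  have ip_f: "ip (f t) (sum f \<Theta>) = complex_of_real ((nrm (f t))\<^sup>2)" if "t \<in> \<Theta>" for t
    using \<Theta>(1) that fH by (simp add: ip_sum_right orth)
  have nrm2: "(nrm (sum f \<Theta>))\<^sup>2 = (\<Sum>t\<in>\<Theta>. (nrm (f t))\<^sup>2)"
  proof -
    have "complex_of_real ((nrm (sum f \<Theta>))\<^sup>2) = complex_of_real (\<Sum>t\<in>\<Theta>. (nrm (f t))\<^sup>2)"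
      using ip_f fH sH by (simp add: ip_self[symmetric] ip_sum_left del: of_real_power)
    then show ?thesis by (simp only: of_real_eq_iff)
  qed
  have T_sum: "ip (T (f t)) (T (sum f \<Theta>)) = of_real (t\<^sup>2 * (nrm (f t))\<^sup>2)" if "t \<in> \<Theta>" for t
    using singular_space_ip[OF T f_mem[OF that] sH] ip_f[OF that] by simp
  have TsH: "T (sum f \<Theta>) \<in> H" by (rule bounded_operator_mem[OF T sH])
  have Tsum: "T (sum f J) = (\<Sum>t\<in>J. T (f t))" if "J \<subseteq> \<Theta>" for J
    using finite_subset[OF that \<Theta>(1)] that
  proof (induction J rule: finite_induct)
    case empty
    have "T (fscale 0 0) = fscale 0 (T 0)" by (rule bounded_operator_scale[OF T]) simp
    then show ?case by (simp add: fscale_def zero_fun_def)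
  next
    case (insert t J)
    have "f t \<in> H" "sum f J \<in> H" using insert.prems fH by (auto intro!: sum_mem)
    then have "T (f t + sum f J) = T (f t) + T (sum f J)" by (rule bounded_operator_add[OF T])
    then show ?case using insert by (simp only: sum.insert[OF insert.hyps]) simp
  qed
  have "(nrm (T (sum f \<Theta>)))\<^sup>2 = (\<Sum>t\<in>\<Theta>. t\<^sup>2 * (nrm (f t))\<^sup>2)"
  proof -
    have "complex_of_real ((nrm (T (sum f \<Theta>)))\<^sup>2) = ip (\<Sum>t\<in>\<Theta>. T (f t)) (T (sum f \<Theta>))"
      using ip_self[OF TsH] Tsum[of \<Theta>] by simp
    also have "\<dots> = (\<Sum>t\<in>\<Theta>. ip (T (f t)) (T (sum f \<Theta>)))"
      using fH TsH by (intro ip_sum_left) (auto intro: bounded_operator_mem[OF T])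
    also have "\<dots> = complex_of_real (\<Sum>t\<in>\<Theta>. t\<^sup>2 * (nrm (f t))\<^sup>2)"
      by (simp add: T_sum del: of_real_mult)
    finally show ?thesis by (simp only: of_real_eq_iff)
  qed
  also have "\<dots> \<ge> (\<Sum>t\<in>\<Theta>. e\<^sup>2 * (nrm (f t))\<^sup>2)"
    using \<Theta>(2) e(2) by (intro sum_mono mult_right_mono power_mono) auto
  also have "(\<Sum>t\<in>\<Theta>. e\<^sup>2 * (nrm (f t))\<^sup>2) = (e * nrm (sum f \<Theta>))\<^sup>2"
    by (simp add: nrm2 power_mult_distrib sum_distrib_left)
  finally have "e * nrm (sum f \<Theta>) \<le> nrm (T (sum f \<Theta>))"
    using nrm_nonneg[OF TsH] by (rule power2_le_imp_le)
  then have "(e - \<delta>) * nrm (sum f \<Theta>) \<le> 0" using le by (simp add: algebra_simps)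
  then have "nrm (sum f \<Theta>) = 0"
    using e(1) nrm_nonneg[OF sH] by (simp add: mult_le_0_iff)
  then have "(\<Sum>t\<in>\<Theta>. (nrm (f t))\<^sup>2) = 0" using nrm2 by simp
  then have f0: "f t = 0" if "t \<in> \<Theta>" for t
    using \<Theta>(1) that fH nrm_eq_0D by (simp add: sum_nonneg_eq_0_iff)
  obtain t b where tb: "t \<in> \<Theta>" "b \<in> B t" "c (t, b) \<noteq> 0" using c(1) by auto
  then show False
    using fun_space.independentD[OF B(3)[OF tb(1)] B(1)[OF tb(1)] order_refl, of "\<lambda>b. c (t, b)" b]
      f0[OF tb(1)] unfolding f_def by simp
qed

text \<open>
  At most \<open>2 N + 1\<close> singular values, counted with multiplicity, exceed \<open>C \<rho>\<^sup>N\<close>. This makes all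
  multiplicities finite, so the values can be enumerated, and it forces their geometric decay.
\<close>

theorem schatten_if_approximable:
  assumes T: "bounded_operator T" and \<rho>: "0 < \<rho>" "\<rho> < 1"
    and appr: "\<And>N. approximable T (2 * N + 1) (C * \<rho> ^ N)" and q: "q > 0"
  shows "T \<in> schatten_class q H ip"
proof -
  have lim: "(\<lambda>N. C * \<rho> ^ N) \<longlonglongrightarrow> 0"
    using \<rho> by (intro tendsto_mult_right_zero LIMSEQ_power_zero) auto
  have "compact_operator H ip T" by (rule compact_if_approximable[OF T appr lim])
  define d where "d t = fun_space.dim (singular_space T t)" for t
  have ex_basis: "\<exists>B. finite B \<and> B \<subseteq> singular_space T t \<and> fun_space.independent B \<and> card B = d t"
    if "t > 0" for t
  proof -
    obtain B where B: "B \<subseteq> singular_space T t" "fun_space.independent B" "card B = d t"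
      unfolding d_def by (rule fun_space.basis_exists)
    show ?thesis
    proof (cases "finite B")
      case True
      then show ?thesis using B by blast
    next
      case False
      then have "d t = 0" using B(3) by simp
      then show ?thesis using fun_space.independent_empty by (intro exI[of _ "{}"]) auto
    qed
  qed
  then obtain B where B: "\<And>t. t > 0 \<Longrightarrow> finite (B t)" "\<And>t. t > 0 \<Longrightarrow> B t \<subseteq> singular_space T t"
    "\<And>t. t > 0 \<Longrightarrow> fun_space.independent (B t)" "\<And>t. t > 0 \<Longrightarrow> card (B t) = d t"
    by metis
  have count: "sum d \<Theta> \<le> 2 * N + 1" if "finite \<Theta>" "\<And>t. t \<in> \<Theta> \<Longrightarrow> e \<le> t" "e > C * \<rho> ^ N" "e > 0"
    for \<Theta> e N
  proof -
    have pos: "t > 0" if "t \<in> \<Theta>" for t using \<open>\<And>t. t \<in> \<Theta> \<Longrightarrow> e \<le> t\<close>[OF that] \<open>e > 0\<close> by simp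
    have "(\<Sum>t\<in>\<Theta>. card (B t)) \<le> 2 * N + 1"
      by (rule independent_singular_vectors_le[OF T appr that(3,4,1,2)]) (use B pos in auto)
    then show ?thesis using B(4) pos by simp
  qed
  have fin: "finite {t. e \<le> t \<and> 0 < d t}" if "e > 0" for e
  proof (rule ccontr)
    assume inf: "infinite {t. e \<le> t \<and> 0 < d t}"
    obtain N where N: "C * \<rho> ^ N < e"
      using order_tendstoD(2)[OF lim \<open>e > 0\<close>] unfolding eventually_sequentially by auto
    obtain \<Theta> where \<Theta>: "\<Theta> \<subseteq> {t. e \<le> t \<and> 0 < d t}" "finite \<Theta>" "card \<Theta> = 2 * N + 2"
      using infinite_arbitrarily_large[OF inf] by blast
    have "card \<Theta> = (\<Sum>t\<in>\<Theta>. 1)" by simp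
    also have "\<dots> \<le> sum d \<Theta>" using \<Theta>(1) by (intro sum_mono) (auto simp: Suc_le_eq)
    also have "\<dots> \<le> 2 * N + 1" using \<Theta>(1) by (intro count[OF \<Theta>(2) _ N \<open>e > 0\<close>]) auto
    finally show False using \<Theta>(3) by simp
  qed
  obtain s where s: "decseq s" "\<And>n. 0 \<le> s n"
    "\<And>t. t > 0 \<Longrightarrow> finite {n. s n = t} \<and> card {n. s n = t} = d t"
    "\<And>n. s n > 0 \<Longrightarrow> n < sum d {t. s n \<le> t \<and> 0 < d t}"
    using decreasing_enumeration[OF fin] by blast
  have "singular_values H ip T s"
    unfolding singular_values_def using s(1-3) by (auto simp: d_def singular_space_def)
  moreover have "summable (\<lambda>n. s n powr q)"
  proof (rule summable_powr_of_geometric_bound[OF s(2) \<rho> q])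
    fix N n :: nat assume n: "2 * N + 1 \<le> n"
    show "s n \<le> max C 0 * \<rho> ^ N"
    proof (rule ccontr)
      assume "\<not> ?thesis"
      then have less: "s n > max C 0 * \<rho> ^ N" by simp
      moreover have "max C 0 * \<rho> ^ N \<ge> 0" "max C 0 * \<rho> ^ N \<ge> C * \<rho> ^ N"
        using \<rho> by (auto intro: mult_right_mono)
      ultimately have "s n > 0" "s n > C * \<rho> ^ N" by linarith+
      then have "sum d {t. s n \<le> t \<and> 0 < d t} \<le> 2 * N + 1"
        by (intro count[OF fin]) auto
      then show False using s(4)[OF \<open>s n > 0\<close>] n by simp
    qed
  qed
  ultimately show ?thesis
    using \<open>compact_operator H ip T\<close> unfolding schatten_class_def by blast
qed

end

section \<open>Change of variables for injective holomorphic maps\<close>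

text \<open>
  The change of variables theorem for Lebesgue measure speaks about \<open>real^2\<close>. The two maps
  identify that space with the complex plane.
\<close>

definition plane_of_vec :: "real^2 \<Rightarrow> complex" where
  "plane_of_vec x = Complex (x $ 1) (x $ 2)"

definition vec_of_plane :: "complex \<Rightarrow> real^2" where
  "vec_of_plane z = vector [Re z, Im z]"

lemma plane_of_vec_inverse [simp]:
  "plane_of_vec (vec_of_plane z) = z" "vec_of_plane (plane_of_vec x) = x"
  by (auto simp: plane_of_vec_def vec_of_plane_def vec_eq_iff forall_2)

lemma bounded_linear_plane_of_vec: "bounded_linear plane_of_vec"
  by (rule linear_conv_bounded_linear[THEN iffD1], rule linearI)
    (auto simp: plane_of_vec_def complex_eq_iff)

lemma bounded_linear_vec_of_plane: "bounded_linear vec_of_plane"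
  by (rule linear_conv_bounded_linear[THEN iffD1], rule linearI)
    (auto simp: vec_of_plane_def vec_eq_iff forall_2)

lemma measurable_plane_of_vec [measurable]: "plane_of_vec \<in> borel_measurable borel"
  using bounded_linear_plane_of_vec by (intro borel_measurable_continuous_onI linear_continuous_on)

lemma vimage_plane_of_vec: "plane_of_vec -` A = vec_of_plane ` A"
  by (auto simp: image_iff) (metis plane_of_vec_inverse(2))

lemma lborel_distr_plane_of_vec: "lborel = distr lborel borel plane_of_vec"
proof (rule lborel_eqI)
  fix l u :: complex
  assume le: "\<And>b. b \<in> Basis \<Longrightarrow> l \<bullet> b \<le> u \<bullet> b"
  have "plane_of_vec -` box l u = box (vec_of_plane l) (vec_of_plane u)"
    by (auto simp: plane_of_vec_def vec_of_plane_def mem_box_cart in_box_complex_iff forall_2)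
  then have "emeasure (distr lborel borel plane_of_vec) (box l u) =
      emeasure lborel (box (vec_of_plane l) (vec_of_plane u))"
    by (simp add: emeasure_distr)
  also have "\<dots> = (\<Prod>b\<in>Basis. (vec_of_plane u - vec_of_plane l) \<bullet> b)"
  proof (rule emeasure_lborel_box)
    have "Re l \<le> Re u" "Im l \<le> Im u" using le[of 1] le[of \<i>] by (auto simp: Basis_complex_def)
    then have "vec_of_plane l $ i \<le> vec_of_plane u $ i" for i
      using forall_2[of "\<lambda>i. vec_of_plane l $ i \<le> vec_of_plane u $ i"]
      by (auto simp: vec_of_plane_def)
    then show "vec_of_plane l \<bullet> b \<le> vec_of_plane u \<bullet> b" if "b \<in> Basis" for b
      using that by (auto simp: Basis_vec_def inner_axis)
  qed
  also have "(\<Prod>b\<in>Basis. (vec_of_plane u - vec_of_plane l) \<bullet> b) = (\<Prod>b\<in>Basis. (u - l) \<bullet> b)"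
  proof -
    have B: "(Basis :: (real^2) set) = {axis 1 1, axis 2 1}"
      by (auto simp: Basis_vec_def UNIV_2)
    have "axis 1 1 \<noteq> (axis 2 1 :: real^2)" by (simp add: axis_eq_axis)
    then show ?thesis
      unfolding B by (simp add: vec_of_plane_def Basis_complex_def inner_axis)
  qed
  finally show "emeasure (distr lborel borel plane_of_vec) (box l u) = (\<Prod>b\<in>Basis. (u - l) \<bullet> b)" .
qed simp

lemma emeasure_lborel_plane_of_vec:
  "A \<in> sets borel \<Longrightarrow> emeasure lborel (A :: complex set) = emeasure lborel (plane_of_vec -` A)"
  by (subst lborel_distr_plane_of_vec) (simp add: emeasure_distr)

lemma nn_integral_lborel_plane_of_vec:
  "f \<in> borel_measurable borel \<Longrightarrow>
    (\<integral>\<^sup>+z. f z \<partial>(lborel :: complex measure)) = (\<integral>\<^sup>+x. f (plane_of_vec x) \<partial>lborel)"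
  by (subst lborel_distr_plane_of_vec) (simp add: nn_integral_distr)

lemma det_complex_mult:
  "det (matrix (\<lambda>h. vec_of_plane (c * plane_of_vec h))) = (cmod c)\<^sup>2"
  by (simp add: det_2 matrix_def vec_of_plane_def plane_of_vec_def axis_def cmod_def power2_eq_square)

lemma borel_measurable_indicator_continuous_on:
  fixes f :: "complex \<Rightarrow> 'b::{real_normed_vector, second_countable_topology}"
  assumes "S \<in> sets borel" "continuous_on S f"
  shows "(\<lambda>x. indicator S x *\<^sub>R f x) \<in> borel_measurable borel"
  using assms by (intro borel_measurable_continuous_on_indicator)

text \<open>
  The real Jacobian determinant of multiplication by the complex number \<open>deriv g z\<close> is the square of
  its modulus.
\<close>

lemma emeasure_holomorphic_image:
  fixes g :: "complex \<Rightarrow> complex"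
  assumes S: "open S" and g: "g holomorphic_on S" and inj: "inj_on g S"
    and T: "T \<in> sets borel" "T \<subseteq> S" and gT: "g ` T \<in> sets borel"
  shows "emeasure lborel (g ` T) = (\<integral>\<^sup>+z. ennreal (indicator T z * (cmod (deriv g z))\<^sup>2) \<partial>lborel)"
proof -
  define X where "X = plane_of_vec -` T"
  define f where "f = (\<lambda>x. vec_of_plane (g (plane_of_vec x)))"
  define D where "D x = (cmod (deriv g (plane_of_vec x)))\<^sup>2" for x
  have X_borel: "X \<in> sets borel"
    unfolding X_def using T(1) measurable_sets[OF measurable_plane_of_vec] by simp
  then have X: "X \<in> sets lebesgue" by simp
  have der: "(f has_derivative (\<lambda>h. vec_of_plane (deriv g (plane_of_vec x) * plane_of_vec h)))
      (at x within X)" if "x \<in> X" for x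
  proof -
    have "plane_of_vec x \<in> S" using that T(2) by (auto simp: X_def)
    then have "(g has_derivative (*) (deriv g (plane_of_vec x))) (at (plane_of_vec x))"
      using holomorphic_derivI[OF g S] by (simp add: has_field_derivative_def)
    moreover have "(plane_of_vec has_derivative plane_of_vec) (at x)"
      by (rule bounded_linear_imp_has_derivative[OF bounded_linear_plane_of_vec])
    ultimately have "((\<lambda>x. g (plane_of_vec x)) has_derivative
        (\<lambda>h. deriv g (plane_of_vec x) * plane_of_vec h)) (at x)"
      using has_derivative_compose by blast
    from bounded_linear.has_derivative[OF bounded_linear_vec_of_plane this]
    show ?thesis unfolding f_def by (rule has_derivative_at_withinI)
  qed
  have inj_f: "inj_on f X"
  proof (rule inj_onI)
    fix x y assume xy: "x \<in> X" "y \<in> X" "f x = f y"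
    then have "g (plane_of_vec x) = g (plane_of_vec y)"
      unfolding f_def by (metis plane_of_vec_inverse(1))
    then have "plane_of_vec x = plane_of_vec y"
      using inj xy T(2) by (auto simp: X_def inj_on_def)
    then show "x = y" by (metis plane_of_vec_inverse(2))
  qed
  have fX: "f ` X = plane_of_vec -` (g ` T)"
    unfolding vimage_plane_of_vec X_def f_def by (auto simp: image_image)
  have fX_borel: "f ` X \<in> sets borel"
    unfolding fX using gT measurable_sets[OF measurable_plane_of_vec] by simp
  have key: "f ` X \<in> lmeasurable \<and> measure lebesgue (f ` X) = m \<longleftrightarrow> (D has_integral m) X" for m
    using has_measure_differentiable_image[OF X der inj_f, of m] by (simp add: det_complex_mult D_def[abs_def])
  have e: "emeasure lebesgue (f ` X) = emeasure lborel (g ` T)"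
    using fX_borel emeasure_lborel_plane_of_vec[OF gT] by (simp add: fX)
  define F where "F x = indicator X x * D x" for x
  have holD: "continuous_on S (\<lambda>z. (cmod (deriv g z))\<^sup>2)"
    using holomorphic_on_imp_continuous_on[OF holomorphic_deriv[OF g S]] by (intro continuous_intros)
  have Tm: "(\<lambda>z. indicator T z *\<^sub>R (cmod (deriv g z))\<^sup>2) \<in> borel_measurable borel"
    by (rule borel_measurable_indicator_continuous_on[OF T(1) continuous_on_subset[OF holD T(2)]])
  have F_eq: "F = (\<lambda>x. indicator T (plane_of_vec x) *\<^sub>R (cmod (deriv g (plane_of_vec x)))\<^sup>2)"
    by (auto simp: F_def X_def D_def indicator_def fun_eq_iff)
  have Fm: "F \<in> borel_measurable borel"
    unfolding F_eq by (rule measurable_compose[OF measurable_plane_of_vec Tm])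
  have F0: "0 \<le> F x" for x by (simp add: F_def D_def)
  have int_iff: "(D has_integral m) X \<longleftrightarrow> (F has_integral m) UNIV" for m
    unfolding has_integral_restrict_UNIV[of X D, symmetric]
    by (rule arg_cong[where f = "\<lambda>f. (f has_integral m) UNIV"]) (auto simp: F_def indicator_def fun_eq_iff)
  have rhs: "(\<integral>\<^sup>+z. ennreal (indicator T z * (cmod (deriv g z))\<^sup>2) \<partial>lborel) = (\<integral>\<^sup>+x. F x \<partial>lborel)"
    using Tm by (subst nn_integral_lborel_plane_of_vec) (auto simp: F_eq)
  show ?thesis
  proof (cases "(\<integral>\<^sup>+x. F x \<partial>lborel) = \<infinity>")
    case False
    then obtain m where m: "m \<ge> 0" "(\<integral>\<^sup>+x. F x \<partial>lborel) = ennreal m"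
      by (cases "\<integral>\<^sup>+x. F x \<partial>lborel") auto
    then have "(F has_integral m) UNIV" using Fm F0 by (intro nn_integral_has_integral)
    then have "f ` X \<in> lmeasurable \<and> measure lebesgue (f ` X) = m" using key int_iff by blast
    then have "emeasure lebesgue (f ` X) = ennreal m"
      by (simp add: emeasure_eq_measure2)
    then show ?thesis using e rhs m by simp
  next
    case True
    have "f ` X \<notin> lmeasurable"
    proof
      assume "f ` X \<in> lmeasurable"
      then have "(F has_integral measure lebesgue (f ` X)) UNIV" using key int_iff by blast
      then show False using True nn_integral_has_integral_lborel[OF Fm F0] by simp
    qed
    then have "emeasure lebesgue (f ` X) = \<infinity>"
      using fX_borel by (auto simp: fmeasurable_def less_top[symmetric])
    then show ?thesis using e rhs True by simp
  qed
qed

theorem nn_integral_holomorphic_substitution: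
  fixes g :: "complex \<Rightarrow> complex"
  assumes S: "open S" and g: "g holomorphic_on S" and inj: "inj_on g S"
    and H: "H \<in> borel_measurable borel"
  shows "(\<integral>\<^sup>+w. indicator (g ` S) w * H w \<partial>lborel) =
    (\<integral>\<^sup>+z. ennreal (indicator S z * (cmod (deriv g z))\<^sup>2) * H (g z) \<partial>lborel)"
proof -
  have gS: "open (g ` S)" using open_mapping_thm3[OF g S inj] .
  define G where "G z = (if z \<in> S then g z else 0)" for z
  have "(\<lambda>z. indicator S z *\<^sub>R g z) \<in> borel_measurable borel"
    using S g by (intro borel_measurable_indicator_continuous_on holomorphic_on_imp_continuous_on) auto
  then have Gm [measurable]: "G \<in> borel_measurable borel"
    by (rule back_subst[where P = "\<lambda>f. f \<in> borel_measurable borel"]) (auto simp: G_def indicator_def)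
  define J where "J z = ennreal (indicator S z * (cmod (deriv g z))\<^sup>2)" for z
  have "continuous_on S (\<lambda>z. (cmod (deriv g z))\<^sup>2)"
    using holomorphic_on_imp_continuous_on[OF holomorphic_deriv[OF g S]] by (intro continuous_intros)
  from borel_measurable_indicator_continuous_on[OF _ this]
  have Jm [measurable]: "J \<in> borel_measurable borel" using S by (simp add: J_def[abs_def])
  have gSm [measurable]: "g ` S \<in> sets borel" using gS by simp
  have "density lborel (indicator (g ` S)) = distr (density lborel J) borel G"
  proof (rule measure_eqI)
    fix B assume "B \<in> sets (density lborel (indicator (g ` S) :: complex \<Rightarrow> ennreal))"
    then have B [measurable]: "B \<in> sets borel" by simp
    define T where "T = S \<inter> G -` B"
    have T: "T \<in> sets borel" unfolding T_def using S measurable_sets[OF Gm B] by auto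
    have gT: "g ` T = g ` S \<inter> B" by (auto simp: T_def G_def)
    have "emeasure (density lborel (indicator (g ` S))) B = emeasure lborel (g ` S \<inter> B)"
      by (subst emeasure_density) (auto simp flip: indicator_inter_arith)
    also have "\<dots> = (\<integral>\<^sup>+z. ennreal (indicator T z * (cmod (deriv g z))\<^sup>2) \<partial>lborel)"
      unfolding gT[symmetric] by (rule emeasure_holomorphic_image[OF S g inj T])
        (auto simp: gT, auto simp: T_def)
    also have "\<dots> = (\<integral>\<^sup>+z. J z * indicator (G -` B) z \<partial>lborel)"
      by (intro nn_integral_cong) (auto simp: J_def T_def indicator_def)
    also have "\<dots> = emeasure (distr (density lborel J) borel G) B"
      using measurable_sets[OF Gm B] by (simp add: emeasure_distr emeasure_density)
    finally show "emeasure (density lborel (indicator (g ` S))) B =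
      emeasure (distr (density lborel J) borel G) B" .
  qed simp
  then have "(\<integral>\<^sup>+w. H w \<partial>density lborel (indicator (g ` S))) =
      (\<integral>\<^sup>+w. H w \<partial>distr (density lborel J) borel G)" by simp
  then have "(\<integral>\<^sup>+w. indicator (g ` S) w * H w \<partial>lborel) = (\<integral>\<^sup>+z. J z * H (G z) \<partial>lborel)"
    using H by (simp add: nn_integral_density nn_integral_distr)
  also have "\<dots> = (\<integral>\<^sup>+z. J z * H (g z) \<partial>lborel)"
    by (intro nn_integral_cong) (auto simp: J_def G_def)
  finally show ?thesis by (simp add: J_def)
qed

corollary nn_integral_rotate:
  assumes "cmod c = 1" and H: "H \<in> borel_measurable borel"
  shows "(\<integral>\<^sup>+z. H (c * z) \<partial>lborel) = (\<integral>\<^sup>+z. H z \<partial>lborel)"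
proof -
  have c: "c \<noteq> 0" using assms(1) by auto
  have "surj ((*) c)" using c by (intro surjI[of _ "\<lambda>z. z / c"]) simp
  moreover have "inj ((*) c)" using c by (intro injI) simp
  moreover have "deriv ((*) c) z = c" for z by (intro DERIV_imp_deriv) (auto intro!: derivative_eq_intros)
  ultimately show ?thesis
    using nn_integral_holomorphic_substitution[of UNIV "(*) c" H] H assms(1)
    by (simp add: holomorphic_intros)
qed

section \<open>Circular means and Littlewood subordination\<close>

definition circle_mean :: "(complex \<Rightarrow> real) \<Rightarrow> complex \<Rightarrow> real" where
  "circle_mean f z = integral {0..1} (\<lambda>t. f (cis (2 * pi * t) * z))"

lemma continuous_on_circle:
  assumes "continuous_on (ball 0 1) f" "cmod z < 1"
  shows "continuous_on S (\<lambda>t. f (cis (2 * pi * t) * z))"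
  by (rule continuous_on_compose2[OF assms(1)])
    (use assms(2) in \<open>auto intro!: continuous_intros simp: norm_mult\<close>)

text \<open>
  This is Cauchy's integral formula on the unit circle for the function \<open>u \<mapsto> F (u z)\<close>.
\<close>

lemma has_integral_circle_mean_value:
  assumes F: "F holomorphic_on ball 0 1" and z: "cmod z < 1"
  shows "((\<lambda>t. F (cis (2 * pi * t) * z)) has_integral F 0) {0..1}"
proof -
  have "(\<lambda>u. F (u * z)) holomorphic_on cball 0 1"
  proof (rule holomorphic_on_compose_gen[OF _ F, unfolded o_def])
    show "(\<lambda>u. u * z) ` cball 0 1 \<subseteq> ball 0 1"
      using z by (auto simp: norm_mult intro!: le_less_trans[OF mult_left_le_one_le])
  qed (auto intro!: holomorphic_intros)
  from Cauchy_integral_circlepath_simple[OF this, of 0]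
  have "((\<lambda>x. F (circlepath 0 1 x * z) / circlepath 0 1 x *
      vector_derivative (circlepath 0 1) (at x within {0..1})) has_integral 2 * of_real pi * \<i> * F 0) {0..1}"
    by (simp add: has_contour_integral_def)
  then have "((\<lambda>x. 2 * of_real pi * \<i> * F (cis (2 * pi * x) * z)) has_integral
      2 * of_real pi * \<i> * F 0) {0..1}"
  proof (rule has_integral_eq[rotated])
    fix x :: real assume x: "x \<in> {0..1}"
    have e: "exp (2 * of_real pi * \<i> * of_real x) = cis (2 * pi * x)"
      by (simp add: cis_conv_exp mult_ac)
    have c: "circlepath 0 1 x = cis (2 * pi * x)" unfolding circlepath using e by simp
    have d: "vector_derivative (circlepath 0 1) (at x within {0..1}) = 2 * of_real pi * \<i> * cis (2 * pi * x)"
      using x e by (subst vector_derivative_circlepath01) auto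
    show "F (circlepath 0 1 x * z) / circlepath 0 1 x *
        vector_derivative (circlepath 0 1) (at x within {0..1}) =
        2 * of_real pi * \<i> * F (cis (2 * pi * x) * z)"
      unfolding c d by simp
  qed
  then have "((\<lambda>x. 1 / (2 * of_real pi * \<i>) * (2 * of_real pi * \<i> * F (cis (2 * pi * x) * z)))
      has_integral 1 / (2 * of_real pi * \<i>) * (2 * of_real pi * \<i> * F 0)) {0..1}"
    by (rule has_integral_mult_right)
  then show ?thesis by simp
qed

text \<open>
  The mixed term is the real part of \<open>cnj a\<close> times the mean of \<open>u\<close>, which is \<open>u 0 = 0\<close>.
\<close>

lemma circle_mean_add_square:
  assumes u: "u holomorphic_on ball 0 1" "u 0 = 0" and z: "cmod z < 1"
  shows "circle_mean (\<lambda>w. (cmod (a + u w))\<^sup>2) z = (cmod a)\<^sup>2 + circle_mean (\<lambda>w. (cmod (u w))\<^sup>2) z"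
proof -
  have "((\<lambda>t. Re (cnj a * u (cis (2 * pi * t) * z))) has_integral Re (cnj a * u 0)) {0..1}"
    by (intro has_integral_Re has_integral_mult_right has_integral_circle_mean_value u z)
  then have "((\<lambda>t. 2 * Re (cnj a * u (cis (2 * pi * t) * z))) has_integral 2 * Re (cnj a * u 0)) {0..1}"
    by (rule has_integral_mult_right)
  moreover have "((\<lambda>t. (cmod (u (cis (2 * pi * t) * z)))\<^sup>2) has_integral
      circle_mean (\<lambda>w. (cmod (u w))\<^sup>2) z) {0..1}"
    unfolding circle_mean_def
    by (intro integrable_integral integrable_continuous_real
        continuous_on_circle[where f = "\<lambda>w. (cmod (u w))\<^sup>2"] continuous_intros
        holomorphic_on_imp_continuous_on u z)
  moreover have "((\<lambda>t. (cmod a)\<^sup>2) has_integral (cmod a)\<^sup>2) {0..1::real}"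
    using has_integral_const_real[of "(cmod a)\<^sup>2" 0 1] by simp
  ultimately have "((\<lambda>t. (cmod a)\<^sup>2 + (2 * Re (cnj a * u (cis (2 * pi * t) * z)) +
      (cmod (u (cis (2 * pi * t) * z)))\<^sup>2)) has_integral
      (cmod a)\<^sup>2 + (2 * Re (cnj a * u 0) + circle_mean (\<lambda>w. (cmod (u w))\<^sup>2) z)) {0..1}"
    by (intro has_integral_add)
  moreover have "(cmod (a + w))\<^sup>2 = (cmod a)\<^sup>2 + (2 * Re (cnj a * w) + (cmod w)\<^sup>2)" for w
    unfolding cmod_power2 by (simp add: power2_eq_square algebra_simps)
  ultimately show ?thesis
    unfolding circle_mean_def[of "\<lambda>w. (cmod (a + u w))\<^sup>2"] using u(2) by (auto intro: integral_unique)
qed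

lemma circle_mean_mono:
  assumes "continuous_on (ball 0 1) f" "continuous_on (ball 0 1) g" and z: "cmod z < 1"
    and "\<And>w. cmod w = cmod z \<Longrightarrow> f w \<le> g w"
  shows "circle_mean f z \<le> circle_mean g z"
  unfolding circle_mean_def
  by (intro integral_le integrable_continuous_real continuous_on_circle assms) (simp add: norm_mult)

lemma circle_mean_cmult: "circle_mean (\<lambda>w. c * f w) z = c * circle_mean f z"
  by (simp add: circle_mean_def)

lemma circle_mean_cong: "(\<And>w. cmod w = cmod z \<Longrightarrow> f w = g w) \<Longrightarrow> circle_mean f z = circle_mean g z"
  unfolding circle_mean_def by (intro integral_cong) (simp add: norm_mult)

text \<open>
  Write the polynomial as \<open>a + w Q(w)\<close>. The constant is orthogonal to the rest before and after
  substituting \<open>\<tau>\<close>, since \<open>\<tau> 0 = 0\<close>; the factor \<open>w\<close> has constant modulus \<open>cmod z\<close> on the circle,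
  while \<open>\<tau>\<close> is at most that large by the Schwarz lemma; and \<open>Q\<close> is covered by induction.
\<close>

lemma littlewood_poly:
  assumes \<tau>: "\<tau> holomorphic_on ball 0 1" "\<tau> 0 = 0" "\<And>w. cmod w < 1 \<Longrightarrow> cmod (\<tau> w) < 1"
    and z: "cmod z < 1"
  shows "circle_mean (\<lambda>w. (cmod (poly p (\<tau> w)))\<^sup>2) z \<le> circle_mean (\<lambda>w. (cmod (poly p w))\<^sup>2) z"
proof (induction p)
  case 0
  then show ?case by (simp add: circle_mean_def)
next
  case (pCons a p)
  have hol: "(\<lambda>w. poly p (\<tau> w)) holomorphic_on ball 0 1" "poly p holomorphic_on ball 0 1"
    by (auto intro!: holomorphic_intros \<tau>(1))
  note cont = holomorphic_on_imp_continuous_on[OF hol(1)] holomorphic_on_imp_continuous_on[OF hol(2)]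
    holomorphic_on_imp_continuous_on[OF \<tau>(1)]
  have "circle_mean (\<lambda>w. (cmod (poly (pCons a p) (\<tau> w)))\<^sup>2) z =
      (cmod a)\<^sup>2 + circle_mean (\<lambda>w. (cmod (\<tau> w * poly p (\<tau> w)))\<^sup>2) z"
    unfolding poly_pCons
    by (rule circle_mean_add_square) (auto intro!: holomorphic_intros hol \<tau>(1) simp: \<tau>(2) z)
  also have "circle_mean (\<lambda>w. (cmod (\<tau> w * poly p (\<tau> w)))\<^sup>2) z \<le>
      circle_mean (\<lambda>w. (cmod z)\<^sup>2 * (cmod (poly p (\<tau> w)))\<^sup>2) z"
  proof (rule circle_mean_mono)
    fix w assume w: "cmod w = cmod z"
    have "cmod (\<tau> w) \<le> cmod z"
      using Schwarz_Lemma(1)[OF \<tau>, of w] w z by simp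
    then show "(cmod (\<tau> w * poly p (\<tau> w)))\<^sup>2 \<le> (cmod z)\<^sup>2 * (cmod (poly p (\<tau> w)))\<^sup>2"
      by (simp add: norm_mult power_mult_distrib mult_right_mono power_mono)
  qed (auto intro!: continuous_intros cont z)
  also have "\<dots> \<le> (cmod z)\<^sup>2 * circle_mean (\<lambda>w. (cmod (poly p w))\<^sup>2) z"
    unfolding circle_mean_cmult by (intro mult_left_mono pCons.IH) simp
  also have "\<dots> = circle_mean (\<lambda>w. (cmod (w * poly p w))\<^sup>2) z"
    unfolding circle_mean_cmult[symmetric]
    by (rule circle_mean_cong) (simp add: norm_mult power_mult_distrib)
  also have "(cmod a)\<^sup>2 + \<dots> = circle_mean (\<lambda>w. (cmod (poly (pCons a p) w))\<^sup>2) z"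
    unfolding poly_pCons
    by (rule circle_mean_add_square[symmetric]) (auto intro!: holomorphic_intros hol z)
  finally show ?case by simp
qed

lemma circle_mean_tendsto:
  assumes f: "\<And>n. continuous_on (ball 0 1) (f n)" and z: "cmod z < 1"
    and lim: "\<And>w. cmod w = cmod z \<Longrightarrow> (\<lambda>n. f n w) \<longlonglongrightarrow> g w"
    and bound: "\<And>n w. cmod w = cmod z \<Longrightarrow> \<bar>f n w\<bar> \<le> B"
  shows "(\<lambda>n. circle_mean (f n) z) \<longlonglongrightarrow> circle_mean g z"
  unfolding circle_mean_def
proof (rule dominated_convergence(2)[where h = "\<lambda>_. B"])
  show "(\<lambda>t. f n (cis (2 * pi * t) * z)) integrable_on {0..1}" for n
    by (intro integrable_continuous_real continuous_on_circle f z)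
qed (use lim bound in \<open>auto simp: norm_mult\<close>)

text \<open>
  The Taylor polynomials converge boundedly on the disk of radius \<open>cmod z\<close>, which contains the circle
  and its image under \<open>\<tau>\<close>, so the inequality for polynomials passes to the limit.
\<close>

theorem littlewood_subordination:
  assumes H: "H holomorphic_on ball 0 1"
    and \<tau>: "\<tau> holomorphic_on ball 0 1" "\<tau> 0 = 0" "\<And>w. cmod w < 1 \<Longrightarrow> cmod (\<tau> w) < 1"
    and z: "cmod z < 1"
  shows "circle_mean (\<lambda>w. (cmod (H (\<tau> w)))\<^sup>2) z \<le> circle_mean (\<lambda>w. (cmod (H w))\<^sup>2) z"
proof -
  define a where "a n = (deriv ^^ n) H 0 / fact n" for n
  have sums: "(\<lambda>n. a n * w ^ n) sums H w" if "cmod w < 1" for w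
    using holomorphic_power_series[OF H, of w] that by (simp add: a_def)
  define B where "B = (\<Sum>n. cmod (a n * of_real (cmod z) ^ n))"
  define \<rho> where "\<rho> = (1 + cmod z) / 2"
  have \<rho>: "cmod z < \<rho>" "\<rho> < 1" "\<rho> > 0" using z by (auto simp: \<rho>_def add_pos_nonneg)
  have "summable (\<lambda>n. a n * of_real \<rho> ^ n)" using sums[of "of_real \<rho>"] \<rho> by (auto simp: sums_iff)
  then have summ: "summable (\<lambda>n. cmod (a n * of_real (cmod z) ^ n))"
    by (rule powser_insidea) (use \<rho> in auto)
  define p where "p N = (\<Sum>n<N. monom (a n) n)" for N
  have p: "poly (p N) w = (\<Sum>n<N. a n * w ^ n)" for N w by (simp add: p_def poly_sum poly_monom)
  have p_bound: "(cmod (poly (p N) w))\<^sup>2 \<le> B\<^sup>2" if "cmod w \<le> cmod z" for N w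
  proof -
    have "cmod (poly (p N) w) \<le> (\<Sum>n<N. cmod (a n * of_real (cmod z) ^ n))"
      unfolding p using that
      by (intro order_trans[OF norm_sum] sum_mono)
        (auto simp: norm_mult norm_power intro!: mult_left_mono power_mono)
    also have "\<dots> \<le> B" unfolding B_def by (intro sum_le_suminf summ) auto
    finally show ?thesis by (intro power_mono) auto
  qed
  have p_lim: "(\<lambda>N. (cmod (poly (p N) w))\<^sup>2) \<longlonglongrightarrow> (cmod (H w))\<^sup>2" if "cmod w \<le> cmod z" for w
    using sums[of w] that z unfolding p sums_def by (intro tendsto_intros) auto
  have \<tau>z: "cmod (\<tau> w) \<le> cmod z" if "cmod w = cmod z" for w
    using Schwarz_Lemma(1)[OF \<tau>, of w] that z by simp
  show ?thesis
  proof (rule LIMSEQ_le)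
    show "(\<lambda>N. circle_mean (\<lambda>w. (cmod (poly (p N) (\<tau> w)))\<^sup>2) z) \<longlonglongrightarrow> circle_mean (\<lambda>w. (cmod (H (\<tau> w)))\<^sup>2) z"
      by (rule circle_mean_tendsto[where B = "B\<^sup>2"])
        (use p_lim p_bound \<tau>z z holomorphic_on_imp_continuous_on[OF \<tau>(1)]
          in \<open>auto intro!: continuous_intros\<close>)
    show "(\<lambda>N. circle_mean (\<lambda>w. (cmod (poly (p N) w))\<^sup>2) z) \<longlonglongrightarrow> circle_mean (\<lambda>w. (cmod (H w))\<^sup>2) z"
      by (rule circle_mean_tendsto[where B = "B\<^sup>2"])
        (use p_lim p_bound z in \<open>auto intro!: continuous_intros\<close>)
    show "\<exists>N. \<forall>n\<ge>N. circle_mean (\<lambda>w. (cmod (poly (p n) (\<tau> w)))\<^sup>2) z \<le>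
        circle_mean (\<lambda>w. (cmod (poly (p n) w))\<^sup>2) z"
      using littlewood_poly[OF \<tau> z] by blast
  qed
qed

section \<open>The weighted area measure\<close>

text \<open>
  The density of the weighted area with respect to Lebesgue measure; the area measure contributes the
  factor \<open>1/pi\<close>.
\<close>

definition disk_weight :: "real \<Rightarrow> complex \<Rightarrow> real" where
  "disk_weight \<alpha> z = (1 + \<alpha>) / pi * (1 - (cmod z)\<^sup>2) powr \<alpha>"

lemma disk_weight_pos: "\<alpha> > -1 \<Longrightarrow> cmod z < 1 \<Longrightarrow> 0 < disk_weight \<alpha> z"
  unfolding disk_weight_def by (intro mult_pos_pos divide_pos_pos) (auto simp: abs_square_eq_1)

lemma unit_disk_borel [measurable]: "unit_disk \<in> sets borel"
  by simp

lemma disk_weight_rotate: "cmod c = 1 \<Longrightarrow> disk_weight \<alpha> (c * z) = disk_weight \<alpha> z"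
  by (simp add: disk_weight_def norm_mult)

lemma measurable_disk_weight [measurable]: "disk_weight \<alpha> \<in> borel_measurable borel"
  unfolding disk_weight_def[abs_def] by measurable

lemma space_weighted_disk_area [simp]: "space (weighted_disk_area \<alpha>) = ball 0 1"
  by (simp add: weighted_disk_area_def disk_area_def space_restrict_space)

lemma sets_weighted_disk_area:
  "sets (weighted_disk_area \<alpha>) = sets (restrict_space borel (ball 0 1))"
  by (simp add: weighted_disk_area_def disk_area_def sets_restrict_space)

lemma measurable_weighted_disk_area:
  "f \<in> borel_measurable (weighted_disk_area \<alpha>) \<longleftrightarrow> f \<in> borel_measurable (restrict_space borel (ball 0 1))"
  by (rule measurable_cong_sets[OF sets_weighted_disk_area refl, THEN arg_cong])

lemma borel_measurable_weighted_disk_area_continuous: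
  "continuous_on (ball 0 1) f \<Longrightarrow> f \<in> borel_measurable (weighted_disk_area \<alpha>)"
  unfolding measurable_weighted_disk_area by (rule borel_measurable_continuous_on_restrict)

lemma nn_integral_weighted_disk_area:
  assumes "\<alpha> > -1" and f: "f \<in> borel_measurable (weighted_disk_area \<alpha>)"
  shows "(\<integral>\<^sup>+z. f z \<partial>weighted_disk_area \<alpha>) =
    (\<integral>\<^sup>+z. indicator (ball 0 1) z * ennreal (disk_weight \<alpha> z) * f z \<partial>lborel)"
proof -
  let ?w = "\<lambda>z. ennreal ((1 + \<alpha>) * (1 - (cmod z)\<^sup>2) powr \<alpha>)"
  have sets: "sets disk_area = sets (restrict_space borel (ball 0 1))"
    by (simp add: disk_area_def sets_restrict_space)
  have sets': "sets (restrict_space lborel (ball 0 1)) = sets (restrict_space borel (ball 0 1 :: complex set))"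
    by (simp add: sets_restrict_space)
  have fm: "f \<in> borel_measurable (restrict_space borel (ball 0 1))"
    using f unfolding measurable_weighted_disk_area .
  have wm: "?w \<in> borel_measurable (restrict_space borel (ball 0 1))"
    by (intro measurable_restrict_space1) measurable
  have fwm: "(\<lambda>z. ?w z * f z) \<in> borel_measurable (restrict_space borel (ball 0 1))"
    using fm wm by (rule borel_measurable_times_ennreal[rotated])
  have "(\<integral>\<^sup>+z. f z \<partial>weighted_disk_area \<alpha>) = (\<integral>\<^sup>+z. ?w z * f z \<partial>disk_area)"
    unfolding weighted_disk_area_def
    by (rule nn_integral_density) (use fm wm in \<open>simp_all add: measurable_cong_sets[OF sets refl]\<close>)
  also have "\<dots> = (\<integral>\<^sup>+z. ennreal (1 / pi) * (?w z * f z) \<partial>restrict_space lborel (ball 0 1))"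
    unfolding disk_area_def
    by (rule nn_integral_density) (use fwm in \<open>simp_all add: measurable_cong_sets[OF sets' refl]\<close>)
  also have "\<dots> = (\<integral>\<^sup>+z. ennreal (1 / pi) * (?w z * f z) * indicator (ball 0 1) z \<partial>lborel)"
    by (rule nn_integral_restrict_space) simp
  also have "\<dots> = (\<integral>\<^sup>+z. indicator (ball 0 1) z * ennreal (disk_weight \<alpha> z) * f z \<partial>lborel)"
  proof (rule nn_integral_cong)
    fix z :: complex
    have "ennreal (disk_weight \<alpha> z) = ennreal (1 / pi) * ?w z"
      using assms(1) by (simp add: disk_weight_def ennreal_mult''[symmetric])
    then show "ennreal (1 / pi) * (?w z * f z) * indicator (ball 0 1) z =
        indicator (ball 0 1) z * ennreal (disk_weight \<alpha> z) * f z"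
      by (simp add: mult_ac)
  qed
  finally show ?thesis .
qed

lemma emeasure_plane_ball: "r \<ge> 0 \<Longrightarrow> emeasure lborel (ball (c::complex) r) = ennreal (pi * r\<^sup>2)"
  by (simp add: emeasure_ball unit_ball_vol_2)

lemma emeasure_boundary_annulus:
  assumes "0 \<le> u" "u \<le> 1"
  shows "emeasure lborel {z::complex. cmod z < 1 \<and> 1 - (cmod z)\<^sup>2 \<le> u} = ennreal (pi * u)"
proof -
  have "{z::complex. cmod z < 1 \<and> 1 - (cmod z)\<^sup>2 \<le> u} = ball 0 1 - ball 0 (sqrt (1 - u))"
  proof -
    have "cmod z < sqrt (1 - u) \<longleftrightarrow> (cmod z)\<^sup>2 < 1 - u" for z
      by (metis abs_norm_cancel real_sqrt_abs real_sqrt_less_iff)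
    then show ?thesis by (auto simp: not_less)
  qed
  moreover have "emeasure lborel (ball 0 1 - ball (0::complex) (sqrt (1 - u))) =
      emeasure lborel (ball (0::complex) 1) - emeasure lborel (ball (0::complex) (sqrt (1 - u)))"
    using assms by (intro emeasure_Diff subset_ball) (auto simp: emeasure_plane_ball)
  ultimately show ?thesis
    using assms by (simp add: emeasure_plane_ball ennreal_minus algebra_simps)
qed

text \<open>
  Only \<open>\<alpha> < 0\<close> is delicate. The set where \<open>1 - (cmod z)\<^sup>2 \<le> (1/2)\<^sup>k\<close> has area \<open>pi (1/2)\<^sup>k\<close>, and
  between two consecutive such sets the weight is of order \<open>(1/2) powr (k \<alpha>)\<close>; the resulting
  geometric series has ratio \<open>(1/2) powr (1 + \<alpha>) < 1\<close>.
\<close>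

lemma emeasure_weighted_disk_area_finite:
  assumes \<alpha>: "\<alpha> > -1"
  shows "emeasure (weighted_disk_area \<alpha>) (ball 0 1) < \<infinity>"
proof -
  define B where "B k = {z::complex. cmod z < 1 \<and> 1 - (cmod z)\<^sup>2 \<le> (1/2) ^ k}" for k :: nat
  have Bm [measurable]: "B k \<in> sets borel" for k unfolding B_def by measurable
  have "emeasure (weighted_disk_area \<alpha>) (ball 0 1) = (\<integral>\<^sup>+z. 1 \<partial>weighted_disk_area \<alpha>)"
    by simp
  also have "\<dots> = (\<integral>\<^sup>+z. indicator (ball 0 1) z * ennreal (disk_weight \<alpha> z) \<partial>lborel)"
    using nn_integral_weighted_disk_area[OF \<alpha>, of "\<lambda>_. 1"] by simp
  also have "\<dots> < \<infinity>"
  proof (cases "\<alpha> \<ge> 0")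
    case True
    have "disk_weight \<alpha> z \<le> (1 + \<alpha>) / pi" if "cmod z < 1" for z
    proof -
      have "(1 - (cmod z)\<^sup>2) powr \<alpha> \<le> 1 powr \<alpha>"
        using that True by (intro powr_mono2) (auto simp: abs_square_less_1 less_imp_le)
      then have "(1 + \<alpha>) / pi * (1 - (cmod z)\<^sup>2) powr \<alpha> \<le> (1 + \<alpha>) / pi * 1"
        using \<alpha> by (intro mult_left_mono) auto
      then show ?thesis by (simp add: disk_weight_def)
    qed
    then have "(\<integral>\<^sup>+z. indicator (ball 0 1) z * ennreal (disk_weight \<alpha> z) \<partial>lborel) \<le>
        (\<integral>\<^sup>+z. ennreal ((1 + \<alpha>) / pi) * indicator (ball 0 1) (z::complex) \<partial>lborel)"
      by (intro nn_integral_mono) (auto simp: indicator_def intro!: ennreal_leI)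
    also have "\<dots> < \<infinity>"
      by (simp add: nn_integral_cmult_indicator emeasure_plane_ball ennreal_mult_less_top)
    finally show ?thesis .
  next
    case False
    define c where "c k = (1 + \<alpha>) / pi * ((1/2) ^ Suc k) powr \<alpha>" for k :: nat
    have c0: "c k \<ge> 0" for k using \<alpha> by (simp add: c_def)
    have le: "indicator (ball 0 1) z * ennreal (disk_weight \<alpha> z) \<le> (\<Sum>k. ennreal (c k) * indicator (B k) z)"
      for z :: complex
    proof (cases "cmod z < 1")
      case True
      define u where "u = 1 - (cmod z)\<^sup>2"
      have u: "0 < u" "u \<le> 1" using True by (auto simp: u_def abs_square_less_1)
      have ex: "\<exists>k. (1/2) ^ Suc k < u"
      proof -
        obtain n where "(1/2) ^ n < u" using real_arch_pow_inv[OF u(1), of "1/2"] by auto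
        moreover have "(1/2) ^ Suc n \<le> (1/2 :: real) ^ n" by simp
        ultimately show ?thesis by (meson le_less_trans)
      qed
      define k where "k = (LEAST k. (1/2) ^ Suc k < u)"
      have k1: "(1/2) ^ Suc k < u" unfolding k_def by (rule LeastI_ex[OF ex])
      have k2: "u \<le> (1/2) ^ k"
      proof (cases k)
        case (Suc j)
        then have "\<not> (1/2) ^ Suc j < u" unfolding k_def using not_less_Least[of j] by (metis lessI)
        then show ?thesis using Suc by simp
      qed (use u in simp)
      have "u powr \<alpha> \<le> ((1/2) ^ Suc k) powr \<alpha>"
        using False k1 by (intro powr_mono2') auto
      then have "disk_weight \<alpha> z \<le> c k"
        using \<alpha> unfolding c_def disk_weight_def u_def by (intro mult_left_mono) auto
      then have "indicator (ball 0 1) z * ennreal (disk_weight \<alpha> z) \<le> ennreal (c k) * indicator (B k) z"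
        using True k2 by (auto simp: B_def u_def intro!: ennreal_leI)
      also have "\<dots> = (\<Sum>j\<in>{k}. ennreal (c j) * indicator (B j) z)"
        by (subst sum.insert) (simp_all only: finite.emptyI sum.empty add_0_right empty_iff not_False_eq_True)
      also have "\<dots> \<le> (\<Sum>k. ennreal (c k) * indicator (B k) z)"
        by (rule sum_le_suminf) auto
      finally show ?thesis .
    qed simp
    have c_eq: "c k * (pi * (1/2) ^ k) = (1 + \<alpha>) * (1/2) powr \<alpha> * ((1/2) powr (1 + \<alpha>)) ^ k" for k
    proof -
      have "((1/2::real) ^ Suc k) powr \<alpha> = (1/2) powr \<alpha> * ((1/2) powr \<alpha>) ^ k"
        by (subst powr_of_power) simp_all
      moreover have "((1/2::real) powr (1 + \<alpha>)) ^ k = (1/2) ^ k * ((1/2) powr \<alpha>) ^ k"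
        unfolding powr_add power_mult_distrib by simp
      ultimately show ?thesis unfolding c_def by simp
    qed
    have "(\<integral>\<^sup>+z. indicator (ball 0 1) z * ennreal (disk_weight \<alpha> z) \<partial>lborel) \<le>
        (\<integral>\<^sup>+z. (\<Sum>k. ennreal (c k) * indicator (B k) z) \<partial>lborel)"
      by (intro nn_integral_mono le)
    also have "\<dots> = (\<Sum>k. \<integral>\<^sup>+z. ennreal (c k) * indicator (B k) z \<partial>lborel)"
      by (intro nn_integral_suminf) measurable
    also have "\<dots> = (\<Sum>k. ennreal (c k * (pi * (1/2) ^ k)))"
      using emeasure_boundary_annulus[of "(1/2) ^ _"] c0
      by (intro suminf_cong) (simp add: nn_integral_cmult_indicator B_def[symmetric] ennreal_mult power_le_one)
    also have "\<dots> < \<infinity>"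
    proof -
      have "(1/2::real) powr (1 + \<alpha>) < 1" using \<alpha> by (simp add: powr01_less_one)
      then have "summable (\<lambda>k. c k * (pi * (1/2) ^ k))"
        unfolding c_eq by (intro summable_mult summable_geometric) simp
      then show ?thesis
        using c0 by (subst suminf_ennreal2) (auto simp: less_top[symmetric])
    qed
    finally show ?thesis .
  qed
  finally show ?thesis .
qed

lemma emeasure_weighted_disk_area_pos:
  assumes \<alpha>: "\<alpha> > -1"
  shows "emeasure (weighted_disk_area \<alpha>) (ball 0 1) > 0"
proof -
  have eq: "emeasure (weighted_disk_area \<alpha>) (ball 0 1) =
      (\<integral>\<^sup>+z. indicator (ball 0 1) z * ennreal (disk_weight \<alpha> z) \<partial>lborel)"
    using nn_integral_weighted_disk_area[OF \<alpha>, of "\<lambda>_. 1"] by simp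
  show ?thesis
  proof (rule ccontr)
    assume "\<not> ?thesis"
    then have "(\<integral>\<^sup>+z. indicator (ball 0 1) z * ennreal (disk_weight \<alpha> z) \<partial>lborel) = 0"
      using eq by simp
    then have "AE z in lborel. indicator (ball 0 1) z * ennreal (disk_weight \<alpha> z) = 0"
      by (subst (asm) nn_integral_0_iff_AE) auto
    then have "AE z in lborel. z \<notin> ball (0::complex) 1"
      by eventually_elim (use disk_weight_pos[OF \<alpha>] in \<open>force simp: indicator_def split: if_splits\<close>)
    then have "emeasure lborel (ball (0::complex) 1) = 0"
      by (subst (asm) AE_iff_measurable[of "ball 0 1"]) auto
    then show False by (simp add: emeasure_plane_ball)
  qed
qed

lemma finite_measure_weighted_disk_area:
  "\<alpha> > -1 \<Longrightarrow> finite_measure (weighted_disk_area \<alpha>)"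
  using emeasure_weighted_disk_area_finite[of \<alpha>] by (intro finite_measureI) auto

section \<open>Composition on the weighted Bergman space\<close>

text \<open>
  Lebesgue measure and the weight are invariant under rotations, so the integral does not change when
  the integrand is averaged over all rotations; Tonelli's theorem moves the average inside.
\<close>

lemma nn_integral_circle_mean:
  assumes \<alpha>: "\<alpha> > -1" and f: "continuous_on (ball 0 1) f" "\<And>z. f z \<ge> 0"
  shows "(\<integral>\<^sup>+z. ennreal (f z) \<partial>weighted_disk_area \<alpha>) =
    (\<integral>\<^sup>+z. indicator (ball 0 1) z * ennreal (disk_weight \<alpha> z) * ennreal (circle_mean f z) \<partial>lborel)"
proof -
  define F where "F z = indicator (ball 0 1) z * ennreal (disk_weight \<alpha> z) * ennreal (indicator (ball 0 1) z * f z)" for z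
  have fm: "(\<lambda>z. indicator (ball 0 1) z * f z) \<in> borel_measurable borel"
    using borel_measurable_indicator_continuous_on[OF _ f(1)] by simp
  have Fm [measurable]: "F \<in> borel_measurable borel"
    unfolding F_def[abs_def] using fm by measurable
  have cis [measurable]: "(\<lambda>t::real. cis (2 * pi * t)) \<in> borel_measurable borel"
    by (intro borel_measurable_continuous_onI continuous_intros)
  have "(\<integral>\<^sup>+z. ennreal (f z) \<partial>weighted_disk_area \<alpha>) = (\<integral>\<^sup>+z. F z \<partial>lborel)"
    using f(1) unfolding F_def
    by (subst nn_integral_weighted_disk_area[OF \<alpha>])
      (auto intro!: borel_measurable_weighted_disk_area_continuous nn_integral_cong
        measurable_compose[OF _ measurable_ennreal] simp: indicator_def)
  also have "\<dots> = (\<integral>\<^sup>+t. indicator {0..1} (t::real) * (\<integral>\<^sup>+z. F z \<partial>lborel) \<partial>lborel)"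
    by (subst nn_integral_multc) auto
  also have "\<dots> = (\<integral>\<^sup>+t. (\<integral>\<^sup>+z. indicator {0..1} t * F (cis (2 * pi * t) * z) \<partial>lborel) \<partial>lborel)"
  proof (rule nn_integral_cong)
    fix t :: real
    have "(\<integral>\<^sup>+z. F z \<partial>lborel) = (\<integral>\<^sup>+z. F (cis (2 * pi * t) * z) \<partial>lborel)"
      by (rule nn_integral_rotate[symmetric]) auto
    then show "indicator {0..1} t * (\<integral>\<^sup>+z. F z \<partial>lborel) =
        (\<integral>\<^sup>+z. indicator {0..1} t * F (cis (2 * pi * t) * z) \<partial>lborel)"
      by (subst nn_integral_cmult) auto
  qed
  also have "\<dots> = (\<integral>\<^sup>+z. (\<integral>\<^sup>+t. indicator {0..1} t * F (cis (2 * pi * t) * z) \<partial>lborel) \<partial>lborel)"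
    by (rule lborel_pair.Fubini'[symmetric]) measurable
  also have "\<dots> = (\<integral>\<^sup>+z. indicator (ball 0 1) z * ennreal (disk_weight \<alpha> z) * ennreal (circle_mean f z) \<partial>lborel)"
  proof (rule nn_integral_cong)
    fix z :: complex
    show "(\<integral>\<^sup>+t. indicator {0..1} t * F (cis (2 * pi * t) * z) \<partial>lborel) =
        indicator (ball 0 1) z * ennreal (disk_weight \<alpha> z) * ennreal (circle_mean f z)"
    proof (cases "cmod z < 1")
      case True
      have "((\<lambda>t. f (cis (2 * pi * t) * z)) has_integral circle_mean f z) {0..1}"
        unfolding circle_mean_def
        by (intro integrable_integral integrable_continuous_real continuous_on_circle f True)
      then have I: "(\<integral>\<^sup>+t. ennreal (indicator {0..1} t * f (cis (2 * pi * t) * z)) \<partial>lborel) = ennreal (circle_mean f z)"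
        using f(2) by (intro nn_integral_has_integral_lebesgue) auto
      have "(\<lambda>t. indicator {0..1} t *\<^sub>R f (cis (2 * pi * t) * z)) \<in> borel_measurable borel"
        by (intro borel_measurable_continuous_on_indicator continuous_on_circle f True) auto
      then have m: "(\<lambda>t. ennreal (indicator {0..1} t * f (cis (2 * pi * t) * z))) \<in> borel_measurable lborel"
        by simp
      have "(\<integral>\<^sup>+t. indicator {0..1} t * F (cis (2 * pi * t) * z) \<partial>lborel) =
          (\<integral>\<^sup>+t. ennreal (disk_weight \<alpha> z) * ennreal (indicator {0..1} t * f (cis (2 * pi * t) * z)) \<partial>lborel)"
        using True by (intro nn_integral_cong) (auto simp: F_def indicator_def norm_mult disk_weight_rotate)
      also have "\<dots> = ennreal (disk_weight \<alpha> z) * ennreal (circle_mean f z)"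
        using m I by (subst nn_integral_cmult) auto
      finally show ?thesis using True by simp
    next
      case False
      then show ?thesis by (simp add: F_def norm_mult)
    qed
  qed
  finally show ?thesis .
qed

lemma nn_integral_littlewood:
  assumes \<alpha>: "\<alpha> > -1" and H: "H holomorphic_on ball 0 1"
    and \<tau>: "\<tau> holomorphic_on ball 0 1" "\<tau> 0 = 0" "\<And>w. cmod w < 1 \<Longrightarrow> cmod (\<tau> w) < 1"
  shows "(\<integral>\<^sup>+z. ennreal ((cmod (H (\<tau> z)))\<^sup>2) \<partial>weighted_disk_area \<alpha>) \<le>
    (\<integral>\<^sup>+z. ennreal ((cmod (H z))\<^sup>2) \<partial>weighted_disk_area \<alpha>)"
proof -
  have c1: "continuous_on (ball 0 1) (\<lambda>z. (cmod (H (\<tau> z)))\<^sup>2)"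
    by (intro continuous_intros continuous_on_compose2[OF holomorphic_on_imp_continuous_on[OF H]]
        holomorphic_on_imp_continuous_on \<tau>(1)) (use \<tau>(3) in auto)
  have c2: "continuous_on (ball 0 1) (\<lambda>z. (cmod (H z))\<^sup>2)"
    by (intro continuous_intros holomorphic_on_imp_continuous_on H)
  show ?thesis
    unfolding nn_integral_circle_mean[OF \<alpha> c1 zero_le_power2] nn_integral_circle_mean[OF \<alpha> c2 zero_le_power2]
    using littlewood_subordination[OF H \<tau>]
    by (intro nn_integral_mono) (auto simp: indicator_def intro!: mult_left_mono ennreal_leI)
qed

lemma moebius_facts:
  assumes a: "cmod a < 1" and z: "cmod z < 1"
  shows "1 - (cmod (Moebius_function 0 a z))\<^sup>2 = (1 - (cmod a)\<^sup>2) / (cmod (1 - cnj a * z))\<^sup>2 * (1 - (cmod z)\<^sup>2)"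
    and "deriv (Moebius_function 0 a) z = (1 - of_real ((cmod a)\<^sup>2)) / (1 - cnj a * z)\<^sup>2"
    and "1 - cmod a \<le> cmod (1 - cnj a * z)"
proof -
  have "cmod (cnj a * z) \<le> cmod a" using z by (simp add: norm_mult mult_left_le)
  moreover have "1 - cmod (cnj a * z) \<le> cmod (1 - cnj a * z)"
    using norm_triangle_ineq2[of 1 "cnj a * z"] by simp
  ultimately show ge: "1 - cmod a \<le> cmod (1 - cnj a * z)" by linarith
  then have nz: "1 - cnj a * z \<noteq> 0" using a by auto
  have "(cmod (1 - cnj a * z))\<^sup>2 - (cmod (z - a))\<^sup>2 = (1 - (cmod a)\<^sup>2) * (1 - (cmod z)\<^sup>2)"
    unfolding cmod_power2 by (simp add: power2_eq_square algebra_simps)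
  then show "1 - (cmod (Moebius_function 0 a z))\<^sup>2 = (1 - (cmod a)\<^sup>2) / (cmod (1 - cnj a * z))\<^sup>2 * (1 - (cmod z)\<^sup>2)"
    using nz by (simp add: Moebius_function_simple norm_divide power_divide field_simps)
  have "((\<lambda>z. (z - a) / (1 - cnj a * z)) has_field_derivative
      (1 - of_real ((cmod a)\<^sup>2)) / (1 - cnj a * z)\<^sup>2) (at z)"
    unfolding complex_norm_square
    using nz by (auto intro!: derivative_eq_intros simp: power2_eq_square algebra_simps)
  then show "deriv (Moebius_function 0 a) z = (1 - of_real ((cmod a)\<^sup>2)) / (1 - cnj a * z)\<^sup>2"
    unfolding Moebius_function_simple[abs_def] by (rule DERIV_imp_deriv)
qed

definition moebius_bound :: "real \<Rightarrow> real \<Rightarrow> real" where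
  "moebius_bound \<alpha> r = ((1 + r) / (1 - r)) powr (2 + \<alpha>)"

lemma moebius_bound_pos: "0 \<le> r \<Longrightarrow> r < 1 \<Longrightarrow> moebius_bound \<alpha> r > 0"
  by (simp add: moebius_bound_def add_pos_nonneg)

lemma moebius_bound_mono:
  assumes "\<alpha> > -1" "0 \<le> r" "r \<le> s" "s < 1"
  shows "moebius_bound \<alpha> r \<le> moebius_bound \<alpha> s"
  unfolding moebius_bound_def using assms by (intro powr_mono2 frac_le) auto

text \<open>
  Substituting the inverse Moebius map multiplies the weighted area at \<open>z\<close> by \<open>k powr (2 + \<alpha>)\<close>, where
  \<open>k\<close> is the modulus of its derivative: the Jacobian gives \<open>k\<^sup>2\<close> and the weight gives \<open>k powr \<alpha>\<close>,
  because \<open>1 - (cmod z)\<^sup>2\<close> is multiplied by \<open>k\<close> as well. Finally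
  \<open>k \<le> (1 + cmod a) / (1 - cmod a)\<close>.
\<close>

lemma nn_integral_moebius:
  assumes \<alpha>: "\<alpha> > -1" and a: "cmod a < 1" and h: "continuous_on (ball 0 1) h" "\<And>z. h z \<ge> 0"
  shows "(\<integral>\<^sup>+z. ennreal (h (Moebius_function 0 (- a) z)) \<partial>weighted_disk_area \<alpha>) \<le>
    ennreal (moebius_bound \<alpha> (cmod a)) * (\<integral>\<^sup>+z. ennreal (h z) \<partial>weighted_disk_area \<alpha>)"
proof -
  define g where "g = Moebius_function 0 a"
  define s where "s = Moebius_function 0 (- a)"
  have sg: "s (g z) = z" if "cmod z < 1" for z
    unfolding s_def g_def using Moebius_function_compose[of "- a" a z] a that by simp
  have gs: "g (s z) = z" if "cmod z < 1" for z
    unfolding s_def g_def using Moebius_function_compose[of a "- a" z] a that by simp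
  have g1: "cmod (g z) < 1" and s1: "cmod (s z) < 1" if "cmod z < 1" for z
    unfolding s_def g_def by (rule Moebius_function_norm_lt_1; use a that in simp)+
  have image: "g ` ball 0 1 = ball 0 1"
  proof (intro equalityI subsetI)
    fix z assume "z \<in> ball (0::complex) 1"
    then have "z = g (s z)" "s z \<in> ball 0 1" using gs[of z] s1[of z] by auto
    then show "z \<in> g ` ball 0 1" by (rule image_eqI)
  qed (use g1 in auto)
  have inj: "inj_on g (ball 0 1)" by (rule inj_on_inverseI[of _ s]) (simp add: sg)
  have hol: "g holomorphic_on ball 0 1" "s holomorphic_on ball 0 1"
    unfolding g_def s_def by (rule Moebius_function_holomorphic; use a in simp)+
  have hs: "continuous_on (ball 0 1) (\<lambda>z. h (s z))"
    by (rule continuous_on_compose2[OF h(1) holomorphic_on_imp_continuous_on[OF hol(2)]]) (use s1 in auto)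
  define K where "K = (\<lambda>z. ennreal (disk_weight \<alpha> z) * ennreal (indicator (ball 0 1) z *\<^sub>R h (s z)))"
  have Km: "K \<in> borel_measurable borel"
    unfolding K_def using borel_measurable_indicator_continuous_on[OF _ hs] by measurable
  have hm: "(\<lambda>z. indicator (ball 0 1) z *\<^sub>R h z) \<in> borel_measurable borel"
    using borel_measurable_indicator_continuous_on[OF _ h(1)] by simp
  have m: "(\<lambda>z. ennreal (f z)) \<in> borel_measurable (weighted_disk_area \<alpha>)"
    if "continuous_on (ball 0 1) f" for f
    using borel_measurable_weighted_disk_area_continuous[OF that] by measurable
  have "(\<integral>\<^sup>+z. ennreal (h (s z)) \<partial>weighted_disk_area \<alpha>) = (\<integral>\<^sup>+z. indicator (ball 0 1) z * K z \<partial>lborel)"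
    unfolding nn_integral_weighted_disk_area[OF \<alpha> m[OF hs]]
    by (intro nn_integral_cong) (auto simp: K_def indicator_def)
  also have "\<dots> = (\<integral>\<^sup>+z. ennreal (indicator (ball 0 1) z * (cmod (deriv g z))\<^sup>2) * K (g z) \<partial>lborel)"
    using nn_integral_holomorphic_substitution[OF open_ball hol(1) inj Km] unfolding image .
  also have "\<dots> \<le> (\<integral>\<^sup>+z. ennreal (moebius_bound \<alpha> (cmod a)) *
      (indicator (ball 0 1) z * ennreal (disk_weight \<alpha> z) * ennreal (indicator (ball 0 1) z *\<^sub>R h z)) \<partial>lborel)"
  proof (rule nn_integral_mono)
    fix z :: complex
    show "ennreal (indicator (ball 0 1) z * (cmod (deriv g z))\<^sup>2) * K (g z) \<le>
      ennreal (moebius_bound \<alpha> (cmod a)) *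
      (indicator (ball 0 1) z * ennreal (disk_weight \<alpha> z) * ennreal (indicator (ball 0 1) z *\<^sub>R h z))"
    proof (cases "cmod z < 1")
      case True
      define k where "k = (1 - (cmod a)\<^sup>2) / (cmod (1 - cnj a * z))\<^sup>2"
      note mf = moebius_facts[OF a True]
      have a2: "(cmod a)\<^sup>2 < 1" using a by (simp add: abs_square_less_1)
      have c: "0 < cmod (1 - cnj a * z)" using mf(3) a by linarith
      have k0: "k > 0" unfolding k_def using a2 c by simp
      have "k \<le> (1 - (cmod a)\<^sup>2) / (1 - cmod a)\<^sup>2"
        unfolding k_def using mf(3) a a2 by (intro divide_left_mono power_mono mult_pos_pos zero_less_power) auto
      also have "\<dots> = (1 + cmod a) / (1 - cmod a)"
        using a by (simp add: power2_eq_square divide_simps) (simp add: algebra_simps)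
      finally have k_le: "k powr (2 + \<alpha>) \<le> moebius_bound \<alpha> (cmod a)"
        unfolding moebius_bound_def using \<alpha> k0 by (intro powr_mono2) auto
      have der: "cmod (deriv g z) = k"
        unfolding g_def mf(2) k_def norm_divide norm_power
        using a2 by (metis abs_of_pos diff_gt_0_iff_gt norm_of_real of_real_1 of_real_diff)
      have "disk_weight \<alpha> (g z) = (1 + \<alpha>) / pi * (k * (1 - (cmod z)\<^sup>2)) powr \<alpha>"
        unfolding disk_weight_def g_def mf(1) k_def ..
      also have "\<dots> = k powr \<alpha> * disk_weight \<alpha> z"
        using k0 True by (simp add: disk_weight_def powr_mult abs_square_less_1)
      finally have w: "(cmod (deriv g z))\<^sup>2 * disk_weight \<alpha> (g z) = k powr (2 + \<alpha>) * disk_weight \<alpha> z"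
        using k0 by (simp add: der powr_add)
      have "ennreal (indicator (ball 0 1) z * (cmod (deriv g z))\<^sup>2) * K (g z) =
          ennreal ((cmod (deriv g z))\<^sup>2 * disk_weight \<alpha> (g z) * h z)"
        using True g1[OF True] sg[OF True] h(2) disk_weight_pos[OF \<alpha> g1[OF True]]
        by (simp add: K_def ennreal_mult' ennreal_mult'' mult_ac)
      also have "\<dots> \<le> ennreal (moebius_bound \<alpha> (cmod a) * disk_weight \<alpha> z * h z)"
        unfolding w using k_le h(2) disk_weight_pos[OF \<alpha> True]
        by (intro ennreal_leI mult_right_mono) auto
      also have "\<dots> = ennreal (moebius_bound \<alpha> (cmod a)) *
        (indicator (ball 0 1) z * ennreal (disk_weight \<alpha> z) * ennreal (indicator (ball 0 1) z *\<^sub>R h z))"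
        using True h(2) disk_weight_pos[OF \<alpha> True] moebius_bound_pos[of "cmod a" \<alpha>] a
        by (simp add: ennreal_mult' ennreal_mult'' mult_ac)
      finally show ?thesis .
    qed simp
  qed
  also have "\<dots> = ennreal (moebius_bound \<alpha> (cmod a)) * (\<integral>\<^sup>+z. indicator (ball 0 1) z *
      ennreal (disk_weight \<alpha> z) * ennreal (indicator (ball 0 1) z *\<^sub>R h z) \<partial>lborel)"
  proof (rule nn_integral_cmult)
    have "(\<lambda>z. ennreal (indicator (ball 0 1) z *\<^sub>R h z)) \<in> borel_measurable lborel"
      using measurable_compose[OF hm measurable_ennreal]
      unfolding measurable_cong_sets[OF sets_lborel refl] .
    from borel_measurable_times_ennreal[OF _ this,
        of "\<lambda>z. indicator (ball 0 1) z * ennreal (disk_weight \<alpha> z)"]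
    show "(\<lambda>z. indicator (ball 0 1) z * ennreal (disk_weight \<alpha> z) *
        ennreal (indicator (ball 0 1) z *\<^sub>R h z)) \<in> borel_measurable lborel"
      by (rule meta_mp) measurable
  qed
  also have "(\<integral>\<^sup>+z. indicator (ball 0 1) z * ennreal (disk_weight \<alpha> z) *
      ennreal (indicator (ball 0 1) z *\<^sub>R h z) \<partial>lborel) = (\<integral>\<^sup>+z. ennreal (h z) \<partial>weighted_disk_area \<alpha>)"
    unfolding nn_integral_weighted_disk_area[OF \<alpha> m[OF h(1)]]
    by (intro nn_integral_cong) (auto simp: indicator_def)
  finally show ?thesis by (simp add: s_def)
qed

text \<open>
  With \<open>a = \<phi> 0\<close>, the map \<open>\<phi>\<close> is a self-map fixing the origin, to which Littlewood's inequality
  applies, followed by the Moebius map taking the origin to \<open>a\<close>. The estimate holds for every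
  holomorphic self-map; for a constant one it bounds point evaluations.
\<close>

theorem nn_integral_composition:
  assumes \<alpha>: "\<alpha> > -1" and H: "H holomorphic_on ball 0 1"
    and \<phi>: "\<phi> holomorphic_on ball 0 1" "\<And>w. cmod w < 1 \<Longrightarrow> cmod (\<phi> w) < 1"
  shows "(\<integral>\<^sup>+z. ennreal ((cmod (H (\<phi> z)))\<^sup>2) \<partial>weighted_disk_area \<alpha>) \<le>
    ennreal (moebius_bound \<alpha> (cmod (\<phi> 0))) * (\<integral>\<^sup>+z. ennreal ((cmod (H z))\<^sup>2) \<partial>weighted_disk_area \<alpha>)"
proof -
  define a where "a = \<phi> 0"
  have a: "cmod a < 1" using \<phi>(2)[of 0] by (simp add: a_def)
  define g where "g = Moebius_function 0 a"
  define s where "s = Moebius_function 0 (- a)"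
  define \<tau> where "\<tau> z = g (\<phi> z)" for z
  have s1: "cmod (s z) < 1" and g1: "cmod (g z) < 1" if "cmod z < 1" for z
    unfolding s_def g_def by (rule Moebius_function_norm_lt_1; use a that in simp)+
  have hol: "g holomorphic_on ball 0 1" "s holomorphic_on ball 0 1"
    unfolding g_def s_def by (rule Moebius_function_holomorphic; use a in simp)+
  have \<tau>: "\<tau> holomorphic_on ball 0 1"
    unfolding \<tau>_def by (rule holomorphic_on_compose_gen[OF \<phi>(1) hol(1), unfolded o_def]) (use \<phi>(2) in auto)
  have \<tau>0: "\<tau> 0 = 0" by (simp add: \<tau>_def g_def a_def Moebius_function_eq_zero)
  have \<tau>1: "cmod (\<tau> w) < 1" if "cmod w < 1" for w
    unfolding \<tau>_def using g1 \<phi>(2) that by blast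
  have Hs: "(\<lambda>z. H (s z)) holomorphic_on ball 0 1"
    by (rule holomorphic_on_compose_gen[OF hol(2) H, unfolded o_def]) (use s1 in auto)
  have "(\<integral>\<^sup>+z. ennreal ((cmod (H (\<phi> z)))\<^sup>2) \<partial>weighted_disk_area \<alpha>) =
      (\<integral>\<^sup>+z. ennreal ((cmod (H (s (\<tau> z))))\<^sup>2) \<partial>weighted_disk_area \<alpha>)"
  proof (rule nn_integral_cong)
    fix z assume "z \<in> space (weighted_disk_area \<alpha>)"
    then have "s (\<tau> z) = \<phi> z"
      unfolding s_def \<tau>_def g_def using Moebius_function_compose[of "- a" a "\<phi> z"] a \<phi>(2) by simp
    then show "ennreal ((cmod (H (\<phi> z)))\<^sup>2) = ennreal ((cmod (H (s (\<tau> z))))\<^sup>2)" by simp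
  qed
  also have "\<dots> \<le> (\<integral>\<^sup>+z. ennreal ((cmod (H (s z)))\<^sup>2) \<partial>weighted_disk_area \<alpha>)"
    by (rule nn_integral_littlewood[OF \<alpha> Hs \<tau> \<tau>0 \<tau>1])
  also have "\<dots> \<le> ennreal (moebius_bound \<alpha> (cmod a)) * (\<integral>\<^sup>+z. ennreal ((cmod (H z))\<^sup>2) \<partial>weighted_disk_area \<alpha>)"
    unfolding s_def
    by (rule nn_integral_moebius[OF \<alpha> a, of "\<lambda>z. (cmod (H z))\<^sup>2"])
      (auto intro!: continuous_intros holomorphic_on_imp_continuous_on H)
  finally show ?thesis by (simp add: a_def)
qed

section \<open>The weighted Dirichlet space as a Hilbert space\<close>

lemma borel_measurable_cnj [measurable]: "cnj \<in> borel_measurable borel"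
  by (intro borel_measurable_continuous_onI continuous_intros)

lemma integrable_mult_of_square_integrable:
  fixes u v :: "'a \<Rightarrow> complex"
  assumes "u \<in> borel_measurable M" "v \<in> borel_measurable M"
    and "integrable M (\<lambda>x. (cmod (u x))\<^sup>2)" "integrable M (\<lambda>x. (cmod (v x))\<^sup>2)"
  shows "integrable M (\<lambda>x. u x * cnj (v x))"
proof (rule Bochner_Integration.integrable_bound)
  show "integrable M (\<lambda>x. (cmod (u x))\<^sup>2 + (cmod (v x))\<^sup>2)"
    using assms(3,4) by (rule Bochner_Integration.integrable_add)
  show "AE x in M. cmod (u x * cnj (v x)) \<le> norm ((cmod (u x))\<^sup>2 + (cmod (v x))\<^sup>2)"
  proof (rule AE_I2)
    fix x
    have "2 * cmod (u x) * cmod (v x) \<le> (cmod (u x))\<^sup>2 + (cmod (v x))\<^sup>2"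
      by (rule sum_squares_bound)
    moreover have "0 \<le> cmod (u x) * cmod (v x)" by simp
    ultimately have "cmod (u x) * cmod (v x) \<le> (cmod (u x))\<^sup>2 + (cmod (v x))\<^sup>2" by linarith
    then show "cmod (u x * cnj (v x)) \<le> norm ((cmod (u x))\<^sup>2 + (cmod (v x))\<^sup>2)"
      by (simp add: norm_mult)
  qed
  show "(\<lambda>x. u x * cnj (v x)) \<in> borel_measurable M"
    using assms(1,2) by measurable
qed

lemma square_integrable_add:
  fixes u v :: "'a \<Rightarrow> complex"
  assumes "u \<in> borel_measurable M" "v \<in> borel_measurable M"
    and "integrable M (\<lambda>x. (cmod (u x))\<^sup>2)" "integrable M (\<lambda>x. (cmod (v x))\<^sup>2)"
  shows "integrable M (\<lambda>x. (cmod (u x + v x))\<^sup>2)"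
proof (rule Bochner_Integration.integrable_bound)
  show "integrable M (\<lambda>x. 2 * (cmod (u x))\<^sup>2 + 2 * (cmod (v x))\<^sup>2)"
    using assms(3,4) by (intro Bochner_Integration.integrable_add integrable_mult_right)
  show "AE x in M. norm ((cmod (u x + v x))\<^sup>2) \<le> norm (2 * (cmod (u x))\<^sup>2 + 2 * (cmod (v x))\<^sup>2)"
  proof (rule AE_I2)
    fix x
    have "(cmod (u x + v x))\<^sup>2 \<le> (cmod (u x) + cmod (v x))\<^sup>2"
      by (intro power_mono norm_triangle_ineq) auto
    also have "\<dots> \<le> 2 * (cmod (u x))\<^sup>2 + 2 * (cmod (v x))\<^sup>2"
      using sum_squares_bound[of "cmod (u x)" "cmod (v x)"] by (simp add: power2_sum)
    finally show "norm ((cmod (u x + v x))\<^sup>2) \<le> norm (2 * (cmod (u x))\<^sup>2 + 2 * (cmod (v x))\<^sup>2)"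
      by simp
  qed
  show "(\<lambda>x. (cmod (u x + v x))\<^sup>2) \<in> borel_measurable M"
    using assms(1,2) by measurable
qed

text \<open>
  The quadratic polynomial \<open>t \<mapsto> \<integral> (cmod u - t cmod v)\<^sup>2\<close> is nonnegative.
\<close>

lemma integral_cauchy_schwarz:
  fixes u v :: "'a \<Rightarrow> complex"
  assumes m: "u \<in> borel_measurable M" "v \<in> borel_measurable M"
    and i: "integrable M (\<lambda>x. (cmod (u x))\<^sup>2)" "integrable M (\<lambda>x. (cmod (v x))\<^sup>2)"
  shows "(\<integral>x. cmod (u x) * cmod (v x) \<partial>M) \<le>
    sqrt (\<integral>x. (cmod (u x))\<^sup>2 \<partial>M) * sqrt (\<integral>x. (cmod (v x))\<^sup>2 \<partial>M)"
proof -
  define A where "A = (\<integral>x. (cmod (u x))\<^sup>2 \<partial>M)"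
  define B where "B = (\<integral>x. (cmod (v x))\<^sup>2 \<partial>M)"
  define C where "C = (\<integral>x. cmod (u x) * cmod (v x) \<partial>M)"
  have "integrable M (\<lambda>x. cmod (u x * cnj (v x)))"
    using integrable_mult_of_square_integrable[OF m i] by (rule integrable_norm)
  then have iC: "integrable M (\<lambda>x. cmod (u x) * cmod (v x))" by (simp add: norm_mult)
  have quad: "0 \<le> A - 2 * t * C + t\<^sup>2 * B" for t
  proof -
    have "0 \<le> (\<integral>x. (cmod (u x) - t * cmod (v x))\<^sup>2 \<partial>M)" by (rule integral_nonneg_AE) simp
    also have "\<dots> = (\<integral>x. (cmod (u x))\<^sup>2 - 2 * t * (cmod (u x) * cmod (v x)) + t\<^sup>2 * (cmod (v x))\<^sup>2 \<partial>M)"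
      by (intro Bochner_Integration.integral_cong) (auto simp: power2_eq_square algebra_simps)
    also have "\<dots> = A - 2 * t * C + t\<^sup>2 * B"
      unfolding A_def B_def C_def using i iC by simp
    finally show ?thesis .
  qed
  have A0: "A \<ge> 0" and B0: "B \<ge> 0" unfolding A_def B_def by (auto intro!: integral_nonneg_AE)
  have "C\<^sup>2 \<le> A * B"
  proof (cases "B = 0")
    case True
    have "C = 0"
    proof (rule ccontr)
      assume "C \<noteq> 0"
      then show False using quad[of "(A + 1) / (2 * C)"] True by simp
    qed
    then show ?thesis using True by simp
  next
    case False
    then have "B > 0" using B0 by simp
    have "0 \<le> A - 2 * (C / B) * C + (C / B)\<^sup>2 * B" by (rule quad)
    also have "\<dots> = A - C\<^sup>2 / B" using False by (simp add: power2_eq_square)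
    finally show ?thesis using \<open>B > 0\<close> by (simp add: field_simps)
  qed
  then have "C \<le> sqrt (A * B)" by (rule real_le_rsqrt)
  then show ?thesis by (simp add: A_def B_def C_def real_sqrt_mult)
qed

lemma dirichlet_spaceD:
  assumes "f \<in> dirichlet_space \<alpha>"
  shows "f holomorphic_on ball 0 1" "\<And>z. cmod z \<ge> 1 \<Longrightarrow> f z = 0"
    "integrable (weighted_disk_area \<alpha>) (\<lambda>z. (cmod (deriv f z))\<^sup>2)"
  using assms by (auto simp: dirichlet_space_def)

lemma continuous_on_deriv_disk:
  "f holomorphic_on ball 0 1 \<Longrightarrow> continuous_on (ball 0 1) (deriv f)"
  by (intro holomorphic_on_imp_continuous_on holomorphic_deriv) auto

lemma measurable_deriv_disk:
  "f holomorphic_on ball 0 1 \<Longrightarrow> deriv f \<in> borel_measurable (weighted_disk_area \<alpha>)"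
  by (intro borel_measurable_weighted_disk_area_continuous continuous_on_deriv_disk)

lemma square_integrable_disk_iff:
  fixes u :: "complex \<Rightarrow> complex"
  assumes "u \<in> borel_measurable (weighted_disk_area \<alpha>)"
  shows "integrable (weighted_disk_area \<alpha>) (\<lambda>z. (cmod (u z))\<^sup>2) \<longleftrightarrow>
    (\<integral>\<^sup>+z. ennreal ((cmod (u z))\<^sup>2) \<partial>weighted_disk_area \<alpha>) < \<infinity>"
  using assms by (subst integrable_iff_bounded) auto

lemma deriv_add_disk:
  assumes "f holomorphic_on ball 0 1" "g holomorphic_on ball 0 1" "cmod z < 1"
  shows "deriv (f + g) z = deriv f z + deriv g z"
  unfolding plus_fun_def using assms
  by (intro deriv_add holomorphic_on_imp_differentiable_at[of _ "ball 0 1"]) auto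

lemma deriv_diff_disk:
  assumes "f holomorphic_on ball 0 1" "g holomorphic_on ball 0 1" "cmod z < 1"
  shows "deriv (f - g) z = deriv f z - deriv g z"
  unfolding fun_diff_def using assms
  by (intro deriv_diff holomorphic_on_imp_differentiable_at[of _ "ball 0 1"]) auto

lemma deriv_fscale_disk:
  assumes "f holomorphic_on ball 0 1" "cmod z < 1"
  shows "deriv (fscale c f) z = c * deriv f z"
  unfolding fscale_def using assms
  by (intro deriv_cmult holomorphic_on_imp_differentiable_at[of _ "ball 0 1"]) auto

lemma deriv_disk_eqI:
  assumes "(h has_field_derivative D) (at z)" "cmod z < 1" "\<And>w. cmod w < 1 \<Longrightarrow> f w = h w"
  shows "deriv f z = D"
proof (rule DERIV_imp_deriv)
  show "(f has_field_derivative D) (at z)"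
    by (rule has_field_derivative_transform_within_open[OF assms(1) open_ball[of 0 1]])
      (use assms(2,3) in auto)
qed

lemma integrable_weighted_disk_area_cong:
  "(\<And>z. cmod z < 1 \<Longrightarrow> f z = g z) \<Longrightarrow>
    integrable (weighted_disk_area \<alpha>) f \<longleftrightarrow> integrable (weighted_disk_area \<alpha>) g"
  by (rule Bochner_Integration.integrable_cong) auto

lemma integral_weighted_disk_area_cong:
  "(\<And>z. cmod z < 1 \<Longrightarrow> f z = g z) \<Longrightarrow>
    integral\<^sup>L (weighted_disk_area \<alpha>) f = integral\<^sup>L (weighted_disk_area \<alpha>) g"
  by (rule Bochner_Integration.integral_cong) auto

lemma dirichlet_space_add:
  assumes f: "f \<in> dirichlet_space \<alpha>" and g: "g \<in> dirichlet_space \<alpha>"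
  shows "f + g \<in> dirichlet_space \<alpha>"
proof -
  note F = dirichlet_spaceD[OF f] and G = dirichlet_spaceD[OF g]
  have "integrable (weighted_disk_area \<alpha>) (\<lambda>z. (cmod (deriv f z + deriv g z))\<^sup>2)"
    by (intro square_integrable_add measurable_deriv_disk F G)
  then have "integrable (weighted_disk_area \<alpha>) (\<lambda>z. (cmod (deriv (f + g) z))\<^sup>2)"
    by (subst integrable_weighted_disk_area_cong) (auto simp: deriv_add_disk F(1) G(1))
  moreover have "(f + g) holomorphic_on ball 0 1"
    unfolding plus_fun_def by (intro holomorphic_intros F G)
  ultimately show ?thesis using F(2) G(2) by (auto simp: dirichlet_space_def)
qed

lemma dirichlet_space_fscale:
  assumes f: "f \<in> dirichlet_space \<alpha>"
  shows "fscale c f \<in> dirichlet_space \<alpha>"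
proof -
  note F = dirichlet_spaceD[OF f]
  have "integrable (weighted_disk_area \<alpha>) (\<lambda>z. (cmod c)\<^sup>2 * (cmod (deriv f z))\<^sup>2)"
    by (intro integrable_mult_right F)
  then have "integrable (weighted_disk_area \<alpha>) (\<lambda>z. (cmod (deriv (fscale c f) z))\<^sup>2)"
    by (subst integrable_weighted_disk_area_cong)
      (auto simp: deriv_fscale_disk F(1) norm_mult power_mult_distrib)
  moreover have "fscale c f holomorphic_on ball 0 1"
    unfolding fscale_def by (intro holomorphic_intros F)
  ultimately show ?thesis using F(2) by (auto simp: dirichlet_space_def fscale_def)
qed

lemma dirichlet_space_zero: "0 \<in> dirichlet_space \<alpha>"
  by (simp add: dirichlet_space_def zero_fun_def)

lemma dirichlet_ip_integrable:
  assumes f: "f \<in> dirichlet_space \<alpha>" and g: "g \<in> dirichlet_space \<alpha>"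
  shows "integrable (weighted_disk_area \<alpha>) (\<lambda>z. deriv f z * cnj (deriv g z))"
  by (intro integrable_mult_of_square_integrable measurable_deriv_disk dirichlet_spaceD[OF f] dirichlet_spaceD[OF g])

lemma dirichlet_ip_self:
  "dirichlet_ip \<alpha> f f = complex_of_real ((cmod (f 0))\<^sup>2 + (\<integral>z. (cmod (deriv f z))\<^sup>2 \<partial>weighted_disk_area \<alpha>))"
proof -
  have "(\<integral>z. deriv f z * cnj (deriv f z) \<partial>weighted_disk_area \<alpha>) =
      (\<integral>z. complex_of_real ((cmod (deriv f z))\<^sup>2) \<partial>weighted_disk_area \<alpha>)"
    by (simp only: complex_norm_square)
  also have "\<dots> = complex_of_real (\<integral>z. (cmod (deriv f z))\<^sup>2 \<partial>weighted_disk_area \<alpha>)"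
    by (rule integral_complex_of_real)
  finally show ?thesis
    unfolding dirichlet_ip_def of_real_add complex_norm_square by simp
qed

lemma dirichlet_norm_square:
  "(ip_norm (dirichlet_ip \<alpha>) f)\<^sup>2 = (cmod (f 0))\<^sup>2 + (\<integral>z. (cmod (deriv f z))\<^sup>2 \<partial>weighted_disk_area \<alpha>)"
  unfolding ip_norm_def dirichlet_ip_self Re_complex_of_real
  by (rule real_sqrt_pow2) (auto intro!: add_nonneg_nonneg integral_nonneg_AE)

lemma dirichlet_norm_nonneg: "0 \<le> ip_norm (dirichlet_ip \<alpha>) f"
  unfolding ip_norm_def dirichlet_ip_self Re_complex_of_real
  by (auto intro!: add_nonneg_nonneg integral_nonneg_AE)

lemma value_0_le_dirichlet_norm: "cmod (f 0) \<le> ip_norm (dirichlet_ip \<alpha>) f"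
proof (rule power2_le_imp_le[OF _ dirichlet_norm_nonneg])
  show "(cmod (f 0))\<^sup>2 \<le> (ip_norm (dirichlet_ip \<alpha>) f)\<^sup>2"
    unfolding dirichlet_norm_square by (auto intro!: integral_nonneg_AE)
qed

lemma dirichlet_norm_square_nn:
  assumes "f \<in> dirichlet_space \<alpha>"
  shows "(\<integral>\<^sup>+z. ennreal ((cmod (deriv f z))\<^sup>2) \<partial>weighted_disk_area \<alpha>) =
    ennreal (\<integral>z. (cmod (deriv f z))\<^sup>2 \<partial>weighted_disk_area \<alpha>)"
  by (rule nn_integral_eq_integral) (use dirichlet_spaceD(3)[OF assms] in auto)

lemma dirichlet_energy_le:
  "(\<integral>z. (cmod (deriv f z))\<^sup>2 \<partial>weighted_disk_area \<alpha>) \<le> (ip_norm (dirichlet_ip \<alpha>) f)\<^sup>2"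
  by (simp add: dirichlet_norm_square)

text \<open>
  A bound for the norm of the functionals \<open>f \<mapsto> deriv f w\<close> with \<open>cmod w \<le> R\<close>.
\<close>

definition eval_bound :: "real \<Rightarrow> real \<Rightarrow> real" where
  "eval_bound \<alpha> R = sqrt (moebius_bound \<alpha> R / measure (weighted_disk_area \<alpha>) (ball 0 1))"

lemma measure_weighted_disk_area_pos:
  "\<alpha> > -1 \<Longrightarrow> measure (weighted_disk_area \<alpha>) (ball 0 1) > 0"
  using emeasure_weighted_disk_area_pos[of \<alpha>] finite_measure.emeasure_eq_measure[OF finite_measure_weighted_disk_area]
  by simp

lemma eval_bound_nonneg: "0 \<le> R \<Longrightarrow> R < 1 \<Longrightarrow> eval_bound \<alpha> R \<ge> 0"
  unfolding eval_bound_def by (intro real_sqrt_ge_zero divide_nonneg_nonneg) (auto simp: moebius_bound_def)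

text \<open>
  Composing \<open>deriv f\<close> with the constant map \<open>w\<close> turns its energy into the squared value at \<open>w\<close> times
  the total mass, and composition is bounded on the weighted Bergman space.
\<close>

lemma deriv_le_dirichlet_norm:
  assumes \<alpha>: "\<alpha> > -1" and f: "f \<in> dirichlet_space \<alpha>" and w: "cmod w \<le> R" "R < 1"
  shows "cmod (deriv f w) \<le> eval_bound \<alpha> R * ip_norm (dirichlet_ip \<alpha>) f"
proof -
  let ?M = "weighted_disk_area \<alpha>"
  interpret finite_measure ?M by (rule finite_measure_weighted_disk_area[OF \<alpha>])
  define A where "A = measure ?M (ball 0 1)"
  have A: "A > 0" unfolding A_def by (rule measure_weighted_disk_area_pos[OF \<alpha>])
  define E where "E = (\<integral>z. (cmod (deriv f z))\<^sup>2 \<partial>?M)"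
  have E: "0 \<le> E" "E \<le> (ip_norm (dirichlet_ip \<alpha>) f)\<^sup>2"
    unfolding E_def by (auto intro!: integral_nonneg_AE dirichlet_energy_le)
  have hol: "deriv f holomorphic_on ball 0 1"
    using dirichlet_spaceD(1)[OF f] by (rule holomorphic_deriv) auto
  have R: "0 \<le> R" by (rule order_trans[OF norm_ge_zero w(1)])
  have mb: "moebius_bound \<alpha> (cmod w) \<le> moebius_bound \<alpha> R" "moebius_bound \<alpha> R \<ge> 0"
    using moebius_bound_mono[OF \<alpha> norm_ge_zero w] by (auto simp: moebius_bound_def)
  have "(\<integral>\<^sup>+z. ennreal ((cmod (deriv f w))\<^sup>2) \<partial>?M) \<le> ennreal (moebius_bound \<alpha> (cmod w)) * ennreal E"
    using nn_integral_composition[OF \<alpha> hol, of "\<lambda>_. w"] w dirichlet_norm_square_nn[OF f]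
    by (simp add: E_def)
  then have "ennreal ((cmod (deriv f w))\<^sup>2 * A) \<le> ennreal (moebius_bound \<alpha> (cmod w) * E)"
    using A by (simp add: emeasure_eq_measure A_def ennreal_mult'' ennreal_mult' E(1))
  then have "(cmod (deriv f w))\<^sup>2 * A \<le> moebius_bound \<alpha> (cmod w) * E"
    using E(1) by (subst (asm) ennreal_le_iff) (auto simp: moebius_bound_def)
  also have "\<dots> \<le> moebius_bound \<alpha> R * (ip_norm (dirichlet_ip \<alpha>) f)\<^sup>2"
    using mb E by (intro mult_mono) auto
  finally have "(cmod (deriv f w))\<^sup>2 \<le> moebius_bound \<alpha> R / A * (ip_norm (dirichlet_ip \<alpha>) f)\<^sup>2"
    using A by (simp add: field_simps)
  also have "\<dots> = (eval_bound \<alpha> R * ip_norm (dirichlet_ip \<alpha>) f)\<^sup>2"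
    using A mb(2) by (simp add: eval_bound_def A_def power_mult_distrib)
  finally show ?thesis
    by (rule power2_le_imp_le) (intro mult_nonneg_nonneg eval_bound_nonneg[OF R w(2)] dirichlet_norm_nonneg)
qed

lemma value_le_dirichlet_norm:
  assumes \<alpha>: "\<alpha> > -1" and f: "f \<in> dirichlet_space \<alpha>" and w: "cmod w \<le> R" "R < 1"
  shows "cmod (f w) \<le> (1 + eval_bound \<alpha> R) * ip_norm (dirichlet_ip \<alpha>) f"
proof -
  let ?N = "ip_norm (dirichlet_ip \<alpha>) f"
  have R: "0 \<le> R" by (rule order_trans[OF norm_ge_zero w(1)])
  have "norm (f w - f 0) \<le> eval_bound \<alpha> R * ?N * norm (w - 0)"
  proof (rule field_differentiable_bound[where S = "cball 0 R" and f' = "deriv f"])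
    show "(f has_field_derivative deriv f z) (at z within cball 0 R)" if "z \<in> cball 0 R" for z
      using holomorphic_derivI[OF dirichlet_spaceD(1)[OF f] open_ball, of z "cball 0 R"] that w(2)
      by (auto intro: has_field_derivative_at_within)
    show "norm (deriv f z) \<le> eval_bound \<alpha> R * ?N" if "z \<in> cball 0 R" for z
      using deriv_le_dirichlet_norm[OF \<alpha> f _ w(2), of z] that by simp
  qed (use w R in auto)
  also have "\<dots> \<le> eval_bound \<alpha> R * ?N * 1"
    using w eval_bound_nonneg[OF R w(2)] dirichlet_norm_nonneg by (intro mult_left_mono) auto
  finally have "cmod (f w - f 0) \<le> eval_bound \<alpha> R * ?N" by simp
  moreover have "cmod (f w) \<le> cmod (f 0) + cmod (f w - f 0)"
    using norm_triangle_ineq[of "f 0" "f w - f 0"] by simp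
  moreover have "cmod (f 0) \<le> ?N" by (rule value_0_le_dirichlet_norm)
  ultimately show ?thesis by (simp add: algebra_simps)
qed

text \<open>
  By the bounds for point evaluations a Cauchy sequence converges locally uniformly together with its
  derivatives. Fatou's lemma shows that the limit belongs to the space and is the limit in norm.
\<close>

lemma dirichlet_space_complete:
  assumes \<alpha>: "\<alpha> > -1" and F: "\<And>n. F n \<in> dirichlet_space \<alpha>"
    and cauchy: "\<And>e. e > 0 \<Longrightarrow> \<exists>N. \<forall>m\<ge>N. \<forall>n\<ge>N. ip_norm (dirichlet_ip \<alpha>) (F m - F n) < e"
  shows "\<exists>g\<in>dirichlet_space \<alpha>. (\<lambda>n::nat. ip_norm (dirichlet_ip \<alpha>) (F n - g)) \<longlonglongrightarrow> 0"
proof -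
  let ?M = "weighted_disk_area \<alpha>"
  let ?nrm = "ip_norm (dirichlet_ip \<alpha>)"
  have diff: "f - g \<in> dirichlet_space \<alpha>" if "f \<in> dirichlet_space \<alpha>" "g \<in> dirichlet_space \<alpha>" for f g
  proof -
    have "f - g = f + fscale (-1) g" by (auto simp: fscale_def fun_eq_iff)
    then show ?thesis using that dirichlet_space_add dirichlet_space_fscale by metis
  qed
  have unif: "\<exists>N. \<forall>m\<ge>N. \<forall>n\<ge>N. \<forall>w. cmod w \<le> R \<longrightarrow> cmod (F m w - F n w) < e"
    if "e > 0" "R < 1" "0 \<le> R" for e R
  proof -
    define C where "C = 1 + eval_bound \<alpha> R"
    have C: "C > 0" using eval_bound_nonneg[of R \<alpha>] that by (simp add: C_def)
    obtain N where N: "\<forall>m\<ge>N. \<forall>n\<ge>N. ?nrm (F m - F n) < e / C"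
      using cauchy[OF divide_pos_pos[OF \<open>e > 0\<close> C]] by blast
    have "cmod (F m w - F n w) < e" if "m \<ge> N" "n \<ge> N" "cmod w \<le> R" for m n w
    proof -
      have "cmod ((F m - F n) w) \<le> C * ?nrm (F m - F n)"
        unfolding C_def by (rule value_le_dirichlet_norm[OF \<alpha> diff[OF F F] that(3) \<open>R < 1\<close>])
      also have "\<dots> < C * (e / C)" using N that C by (intro mult_strict_left_mono) auto
      finally show ?thesis using C by simp
    qed
    then show ?thesis by blast
  qed
  have "Cauchy (\<lambda>n. F n w)" if "cmod w < 1" for w
  proof (rule CauchyI)
    fix e :: real assume "e > 0"
    from unif[OF this \<open>cmod w < 1\<close> norm_ge_zero]
    obtain N where "\<forall>m\<ge>N. \<forall>n\<ge>N. \<forall>u. cmod u \<le> cmod w \<longrightarrow> cmod (F m u - F n u) < e"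
      by blast
    then show "\<exists>N. \<forall>m\<ge>N. \<forall>n\<ge>N. norm (F m w - F n w) < e" by blast
  qed
  then have conv: "convergent (\<lambda>n. F n w)" if "cmod w < 1" for w
    using that Cauchy_convergent_iff by blast
  define g where "g w = (if cmod w < 1 then lim (\<lambda>n. F n w) else 0)" for w
  have lim: "(\<lambda>n. F n w) \<longlonglongrightarrow> g w" if "cmod w < 1" for w
    using conv[OF that] that by (simp add: g_def convergent_LIMSEQ_iff)
  have ulim: "\<exists>d. 0 < d \<and> cball x d \<subseteq> ball 0 1 \<and> uniform_limit (cball x d) F g sequentially"
    if x: "x \<in> ball 0 1" for x
  proof -
    define d where "d = (1 - cmod x) / 2"
    define R where "R = (1 + cmod x) / 2"
    have d: "d > 0" and R: "0 \<le> R" "R < 1" using x by (auto simp: d_def R_def)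
    have in_R: "cmod w \<le> R" if "w \<in> cball x d" for w
    proof -
      have "cmod w \<le> cmod x + cmod (w - x)" using norm_triangle_ineq[of x "w - x"] by simp
      then show ?thesis using that by (simp add: d_def R_def dist_norm norm_minus_commute field_simps)
    qed
    have "uniform_limit (cball x d) F g sequentially"
    proof (rule uniform_limitI)
      fix e :: real assume e: "e > 0"
      obtain N where N: "\<forall>m\<ge>N. \<forall>n\<ge>N. \<forall>w. cmod w \<le> R \<longrightarrow> cmod (F m w - F n w) < e / 2"
        using unif[OF half_gt_zero[OF e] R(2) R(1)] by blast
      have "dist (F n w) (g w) < e" if "n \<ge> N" "w \<in> cball x d" for n w
      proof -
        have w: "cmod w \<le> R" using in_R that by blast
        have "(\<lambda>m. cmod (F m w - F n w)) \<longlonglongrightarrow> cmod (g w - F n w)"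
          using w R by (intro tendsto_intros lim) auto
        then have "cmod (g w - F n w) \<le> e / 2"
        proof (rule LIMSEQ_le_const2)
          show "\<exists>N. \<forall>m\<ge>N. cmod (F m w - F n w) \<le> e / 2"
            using N \<open>n \<ge> N\<close> w by (meson less_imp_le)
        qed
        then show ?thesis using e by (simp add: dist_norm norm_minus_commute)
      qed
      then show "\<forall>\<^sub>F n in sequentially. \<forall>w\<in>cball x d. dist (F n w) (g w) < e"
        unfolding eventually_sequentially by blast
    qed
    moreover have "cball x d \<subseteq> ball 0 1" using in_R R by fastforce
    ultimately show ?thesis using d by blast
  qed
  have g_hol: "g holomorphic_on ball 0 1"
    by (rule holomorphic_uniform_sequence[OF open_ball dirichlet_spaceD(1)[OF F] ulim])
  have hfd: "(F n has_field_derivative deriv (F n) x) (at x)" if "x \<in> ball 0 1" for n x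
    by (rule holomorphic_derivI[OF dirichlet_spaceD(1)[OF F] open_ball that])
  obtain g' where g': "\<forall>x\<in>ball 0 1.
      (g has_field_derivative g' x) (at x) \<and> (\<lambda>n. deriv (F n) x) \<longlonglongrightarrow> g' x"
    using has_complex_derivative_uniform_sequence[OF open_ball hfd ulim] by blast
  have dlim: "(\<lambda>n. deriv (F n) x) \<longlonglongrightarrow> deriv g x" if "cmod x < 1" for x
  proof -
    have "(g has_field_derivative g' x) (at x)" "(\<lambda>n. deriv (F n) x) \<longlonglongrightarrow> g' x"
      using bspec[OF g', of x] that by auto
    then show ?thesis by (simp add: DERIV_imp_deriv)
  qed
  have est: "(\<integral>\<^sup>+z. ennreal ((cmod (deriv (g - F n) z))\<^sup>2) \<partial>?M) \<le> ennreal (e\<^sup>2)"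
    if "e > 0" and N: "\<forall>m\<ge>N. \<forall>n\<ge>N. ?nrm (F m - F n) < e" and n: "n \<ge> N" for e N n
  proof -
    have "(\<integral>\<^sup>+z. ennreal ((cmod (deriv (g - F n) z))\<^sup>2) \<partial>?M) =
        (\<integral>\<^sup>+z. liminf (\<lambda>m. ennreal ((cmod (deriv (F m - F n) z))\<^sup>2)) \<partial>?M)"
    proof (rule nn_integral_cong)
      fix z assume "z \<in> space ?M"
      then have z: "cmod z < 1" by simp
      have "(\<lambda>m. (cmod (deriv (F m) z - deriv (F n) z))\<^sup>2) \<longlonglongrightarrow> (cmod (deriv g z - deriv (F n) z))\<^sup>2"
        by (intro tendsto_intros dlim z)
      then have "(\<lambda>m. ennreal ((cmod (deriv (F m - F n) z))\<^sup>2)) \<longlonglongrightarrow> ennreal ((cmod (deriv (g - F n) z))\<^sup>2)"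
        using z by (simp add: deriv_diff_disk dirichlet_spaceD(1)[OF F] g_hol)
      then show "ennreal ((cmod (deriv (g - F n) z))\<^sup>2) = liminf (\<lambda>m. ennreal ((cmod (deriv (F m - F n) z))\<^sup>2))"
        by (intro lim_imp_Liminf[symmetric]) auto
    qed
    also have "\<dots> \<le> liminf (\<lambda>m. \<integral>\<^sup>+z. ennreal ((cmod (deriv (F m - F n) z))\<^sup>2) \<partial>?M)"
      using measurable_deriv_disk[OF dirichlet_spaceD(1)[OF diff[OF F F]]]
      by (intro nn_integral_liminf) measurable
    also have "\<dots> \<le> liminf (\<lambda>m. ennreal (e\<^sup>2))"
    proof (rule Liminf_mono)
      have "(\<integral>\<^sup>+z. ennreal ((cmod (deriv (F m - F n) z))\<^sup>2) \<partial>?M) \<le> ennreal (e\<^sup>2)" if "m \<ge> N" for m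
        unfolding dirichlet_norm_square_nn[OF diff[OF F F]]
      proof (rule ennreal_leI)
        have "(\<integral>z. (cmod (deriv (F m - F n) z))\<^sup>2 \<partial>?M) \<le> (?nrm (F m - F n))\<^sup>2"
          by (rule dirichlet_energy_le)
        also have "\<dots> \<le> e\<^sup>2"
          using N that n dirichlet_norm_nonneg by (intro power_mono) (auto intro: less_imp_le)
        finally show "(\<integral>z. (cmod (deriv (F m - F n) z))\<^sup>2 \<partial>?M) \<le> e\<^sup>2" .
      qed
      then show "\<forall>\<^sub>F m in sequentially. (\<integral>\<^sup>+z. ennreal ((cmod (deriv (F m - F n) z))\<^sup>2) \<partial>?M) \<le> ennreal (e\<^sup>2)"
        unfolding eventually_sequentially by blast
    qed
    also have "\<dots> = ennreal (e\<^sup>2)" by (simp add: Liminf_const)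
    finally show ?thesis .
  qed
  have gF_hol: "(g - F n) holomorphic_on ball 0 1" for n
    unfolding fun_diff_def by (intro holomorphic_intros g_hol dirichlet_spaceD(1)[OF F])
  have gF: "g - F n \<in> dirichlet_space \<alpha>"
    if "e > 0" and N: "\<forall>m\<ge>N. \<forall>n\<ge>N. ?nrm (F m - F n) < e" and n: "n \<ge> N" for e N n
  proof -
    have "integrable ?M (\<lambda>z. (cmod (deriv (g - F n) z))\<^sup>2)"
      using est[OF that] by (subst square_integrable_disk_iff[OF measurable_deriv_disk[OF gF_hol]])
        (auto intro: le_less_trans)
    then show ?thesis
      using gF_hol dirichlet_spaceD(2)[OF F] by (auto simp: dirichlet_space_def g_def)
  qed
  have g_mem: "g \<in> dirichlet_space \<alpha>"
  proof -
    obtain N where N: "\<forall>m\<ge>N. \<forall>n\<ge>N. ?nrm (F m - F n) < 1" using cauchy[OF zero_less_one] by blast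
    have "(g - F N) + F N \<in> dirichlet_space \<alpha>"
      by (rule dirichlet_space_add[OF gF[OF zero_less_one N order_refl] F])
    then show ?thesis by simp
  qed
  have "(\<lambda>n. (?nrm (F n - g))\<^sup>2) \<longlonglongrightarrow> 0"
  proof (rule tendstoI)
    fix e :: real assume e: "e > 0"
    define d where "d = sqrt (e / 2)"
    have d: "d > 0" "d\<^sup>2 = e / 2" using e by (auto simp: d_def)
    obtain N where N: "\<forall>m\<ge>N. \<forall>n\<ge>N. ?nrm (F m - F n) < d" using cauchy[OF d(1)] by blast
    have "\<forall>\<^sub>F n in sequentially. (cmod (F n 0 - g 0))\<^sup>2 < e / 2"
    proof -
      have "(\<lambda>n. (cmod (F n 0 - g 0))\<^sup>2) \<longlonglongrightarrow> (cmod (g 0 - g 0))\<^sup>2"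
        by (intro tendsto_intros lim) auto
      then have "(\<lambda>n. (cmod (F n 0 - g 0))\<^sup>2) \<longlonglongrightarrow> 0" by (simp only: diff_self norm_zero power_zero_numeral)
      from order_tendstoD(2)[OF this, of "e / 2"] show ?thesis using e by simp
    qed
    then show "\<forall>\<^sub>F n in sequentially. dist ((?nrm (F n - g))\<^sup>2) 0 < e"
      using eventually_ge_at_top[of N]
    proof eventually_elim
      case (elim n)
      have "(\<integral>z. (cmod (deriv (g - F n) z))\<^sup>2 \<partial>?M) \<le> d\<^sup>2"
        using est[OF d(1) N elim(2)] dirichlet_norm_square_nn[OF gF[OF d(1) N elim(2)]]
        by (simp add: ennreal_le_iff)
      moreover have "(\<integral>z. (cmod (deriv (g - F n) z))\<^sup>2 \<partial>?M) = (\<integral>z. (cmod (deriv (F n - g) z))\<^sup>2 \<partial>?M)"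
        by (rule integral_weighted_disk_area_cong)
          (simp add: deriv_diff_disk g_hol dirichlet_spaceD(1)[OF F] norm_minus_commute)
      ultimately show ?case using elim(1) d(2) by (simp add: dirichlet_norm_square)
    qed
  qed
  then have "(\<lambda>n. sqrt ((?nrm (F n - g))\<^sup>2)) \<longlonglongrightarrow> sqrt 0" by (rule tendsto_real_sqrt)
  then have "(\<lambda>n. ?nrm (F n - g)) \<longlonglongrightarrow> 0" by (simp add: dirichlet_norm_nonneg)
  then show ?thesis using g_mem by blast
qed

theorem dirichlet_hilbert_space:
  assumes \<alpha>: "\<alpha> > -1"
  shows "function_hilbert_space (dirichlet_space \<alpha>) (dirichlet_ip \<alpha>)"
proof
  show "0 \<in> dirichlet_space \<alpha>" by (rule dirichlet_space_zero)
next
  fix f g assume f: "f \<in> dirichlet_space \<alpha>" and g: "g \<in> dirichlet_space \<alpha>"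
  show "f + g \<in> dirichlet_space \<alpha>" by (rule dirichlet_space_add[OF f g])
  have "(\<integral>z. deriv g z * cnj (deriv f z) \<partial>weighted_disk_area \<alpha>) =
      (\<integral>z. cnj (deriv f z * cnj (deriv g z)) \<partial>weighted_disk_area \<alpha>)"
    by (simp add: mult.commute)
  also have "\<dots> = cnj (\<integral>z. deriv f z * cnj (deriv g z) \<partial>weighted_disk_area \<alpha>)"
    by (rule Bochner_Integration.integral_cnj)
  finally show "dirichlet_ip \<alpha> g f = cnj (dirichlet_ip \<alpha> f g)"
    by (simp add: dirichlet_ip_def)
next
  fix f c assume f: "f \<in> dirichlet_space \<alpha>"
  show "fscale c f \<in> dirichlet_space \<alpha>" by (rule dirichlet_space_fscale[OF f])
  show "0 \<le> Re (dirichlet_ip \<alpha> f f)"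
    unfolding dirichlet_ip_self by (auto intro!: add_nonneg_nonneg integral_nonneg_AE)
next
  fix f g h assume f: "f \<in> dirichlet_space \<alpha>" and g: "g \<in> dirichlet_space \<alpha>" and h: "h \<in> dirichlet_space \<alpha>"
  have "(\<integral>z. deriv (f + g) z * cnj (deriv h z) \<partial>weighted_disk_area \<alpha>) =
      (\<integral>z. deriv f z * cnj (deriv h z) + deriv g z * cnj (deriv h z) \<partial>weighted_disk_area \<alpha>)"
    by (rule integral_weighted_disk_area_cong)
      (simp add: deriv_add_disk dirichlet_spaceD(1)[OF f] dirichlet_spaceD(1)[OF g] algebra_simps)
  then show "dirichlet_ip \<alpha> (f + g) h = dirichlet_ip \<alpha> f h + dirichlet_ip \<alpha> g h"
    using dirichlet_ip_integrable[OF f h] dirichlet_ip_integrable[OF g h]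
    by (simp add: dirichlet_ip_def algebra_simps)
next
  fix f h c assume f: "f \<in> dirichlet_space \<alpha>" and h: "h \<in> dirichlet_space \<alpha>"
  have "(\<integral>z. deriv (fscale c f) z * cnj (deriv h z) \<partial>weighted_disk_area \<alpha>) =
      (\<integral>z. c * (deriv f z * cnj (deriv h z)) \<partial>weighted_disk_area \<alpha>)"
    by (rule integral_weighted_disk_area_cong)
      (simp add: deriv_fscale_disk dirichlet_spaceD(1)[OF f])
  then show "dirichlet_ip \<alpha> (fscale c f) h = c * dirichlet_ip \<alpha> f h"
    by (simp add: dirichlet_ip_def fscale_def algebra_simps)
next
  fix f assume f: "f \<in> dirichlet_space \<alpha>" and 0: "dirichlet_ip \<alpha> f f = 0"
  then have "ip_norm (dirichlet_ip \<alpha>) f = 0" by (simp add: ip_norm_def)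
  then have "f z = 0" if "cmod z < 1" for z
    using value_le_dirichlet_norm[OF \<alpha> f order_refl that] by simp
  then show "f = 0" using dirichlet_spaceD(2)[OF f] by (auto simp: fun_eq_iff not_less[symmetric])
next
  fix F :: "nat \<Rightarrow> complex \<Rightarrow> complex"
  assume "\<And>n. F n \<in> dirichlet_space \<alpha>"
    "\<And>e. e > 0 \<Longrightarrow> \<exists>N. \<forall>m\<ge>N. \<forall>n\<ge>N. ip_norm (dirichlet_ip \<alpha>) (F m - F n) < e"
  then show "\<exists>g\<in>dirichlet_space \<alpha>. (\<lambda>n. ip_norm (dirichlet_ip \<alpha>) (F n - g)) \<longlonglongrightarrow> 0"
    by (rule dirichlet_space_complete[OF \<alpha>])
qed

section \<open>Linear fractional self-maps and their composition operators\<close>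

text \<open>
  By continuity \<open>cmod (a z + b) \<le> cmod (c z + d)\<close> on the closed disk. A zero of the denominator on
  the circle would therefore be a zero of the numerator too, against \<open>a d - b c \<noteq> 0\<close>.
\<close>

lemma linear_fractional_self_mapE:
  assumes "linear_fractional_self_map \<phi>"
  obtains a b c d where "a * d - b * c \<noteq> 0" "\<phi> = (\<lambda>z. (a * z + b) / (c * z + d))"
    "\<And>z. cmod z \<le> 1 \<Longrightarrow> c * z + d \<noteq> 0" "\<And>z. cmod z < 1 \<Longrightarrow> cmod (\<phi> z) < 1"
    "\<And>z. cmod z \<le> 1 \<Longrightarrow> cmod (\<phi> z) \<le> 1"
proof -
  obtain a b c d where *: "a * d - b * c \<noteq> 0" "\<forall>z\<in>unit_disk. c * z + d \<noteq> 0"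
    "\<phi> = (\<lambda>z. (a * z + b) / (c * z + d))" "\<phi> ` unit_disk \<subseteq> unit_disk"
    using assms unfolding linear_fractional_self_map_def by blast
  have lt: "cmod (\<phi> z) < 1" if "cmod z < 1" for z
    using *(4) that by (auto simp: image_subset_iff)
  have le: "cmod (a * z + b) \<le> cmod (c * z + d)" if "cmod z \<le> 1" for z
  proof -
    define S where "S = {z. cmod (a * z + b) \<le> cmod (c * z + d)}"
    have "closed S" unfolding S_def by (intro closed_Collect_le continuous_intros)
    moreover have "ball 0 1 \<subseteq> S"
    proof
      fix z :: complex assume "z \<in> ball 0 1"
      then have "cmod ((a * z + b) / (c * z + d)) < 1" "cmod (c * z + d) > 0"
        using lt[of z] *(2,3) by auto
      then show "z \<in> S" by (simp add: S_def norm_divide divide_less_eq split: if_splits)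
    qed
    ultimately have "closure (ball 0 1) \<subseteq> S" by (rule closure_minimal[rotated])
    then show ?thesis using that by (auto simp: S_def closure_ball)
  qed
  have nz: "c * z + d \<noteq> 0" if "cmod z \<le> 1" for z
  proof
    assume z: "c * z + d = 0"
    then have "a * z + b = 0" using le[OF that] by simp
    then have "b = - (a * z)" "d = - (c * z)" using z by (simp_all add: eq_neg_iff_add_eq_0 add.commute)
    then show False using *(1) by simp
  qed
  have "cmod (\<phi> z) \<le> 1" if "cmod z \<le> 1" for z
    using le[OF that] nz[OF that] by (simp add: *(3) norm_divide divide_le_eq)
  then show thesis using that *(1,3) nz lt by blast
qed

lemma linear_fractional_less_1:
  "linear_fractional_self_map \<phi> \<Longrightarrow> cmod z < 1 \<Longrightarrow> cmod (\<phi> z) < 1"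
  by (erule linear_fractional_self_mapE) blast

lemma linear_fractional_le_1:
  "linear_fractional_self_map \<phi> \<Longrightarrow> cmod z \<le> 1 \<Longrightarrow> cmod (\<phi> z) \<le> 1"
  by (erule linear_fractional_self_mapE) blast

lemma linear_fractional_continuous:
  assumes "linear_fractional_self_map \<phi>"
  shows "continuous_on (cball 0 1) \<phi>"
  by (rule linear_fractional_self_mapE[OF assms]) (auto intro!: continuous_intros)

lemma linear_fractional_holomorphic:
  assumes "linear_fractional_self_map \<phi>"
  shows "\<phi> holomorphic_on ball 0 1"
  by (rule linear_fractional_self_mapE[OF assms]) (auto intro!: holomorphic_intros)

lemma linear_fractional_deriv_bound:
  assumes "linear_fractional_self_map \<phi>"
  shows "\<exists>K\<ge>0. \<forall>z. cmod z < 1 \<longrightarrow> cmod (deriv \<phi> z) \<le> K"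
proof -
  obtain a b c d where *: "\<phi> = (\<lambda>z. (a * z + b) / (c * z + d))"
    "\<And>z. cmod z \<le> 1 \<Longrightarrow> c * z + d \<noteq> 0"
    by (rule linear_fractional_self_mapE[OF assms]) blast
  have "compact ((\<lambda>z. (a * d - b * c) / (c * z + d)\<^sup>2) ` cball 0 1)"
    by (intro compact_continuous_image continuous_intros) (auto simp: *(2))
  from compact_imp_bounded[OF this] obtain K
    where K': "\<forall>x\<in>(\<lambda>z. (a * d - b * c) / (c * z + d)\<^sup>2) ` cball 0 1. cmod x \<le> K"
    unfolding bounded_iff by blast
  have K: "cmod ((a * d - b * c) / (c * z + d)\<^sup>2) \<le> K" if "cmod z \<le> 1" for z
    by (rule bspec[OF K' imageI]) (use that in simp)
  have der: "deriv \<phi> z = (a * d - b * c) / (c * z + d)\<^sup>2" if "cmod z < 1" for z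
  proof -
    have "c * z + d \<noteq> 0" using *(2) that by simp
    then have "((\<lambda>z. (a * z + b) / (c * z + d)) has_field_derivative (a * d - b * c) / (c * z + d)\<^sup>2) (at z)"
      by (auto intro!: derivative_eq_intros simp: power2_eq_square algebra_simps)
    then show ?thesis unfolding *(1) by (rule DERIV_imp_deriv)
  qed
  have "K \<ge> 0" using K[of 0] norm_ge_zero order_trans by (metis norm_zero zero_le_one)
  then show ?thesis using K der by (metis less_imp_le)
qed

lemma comp_op_holomorphic:
  assumes \<phi>: "linear_fractional_self_map \<phi>" and f: "f holomorphic_on ball 0 1"
  shows "comp_op \<phi> f holomorphic_on ball 0 1"
proof -
  have "(\<lambda>z. f (\<phi> z)) holomorphic_on ball 0 1"
    by (rule holomorphic_on_compose_gen[OF linear_fractional_holomorphic[OF \<phi>] f, unfolded o_def])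
      (use linear_fractional_less_1[OF \<phi>] in auto)
  then show ?thesis by (rule holomorphic_transform) (simp add: comp_op_def)
qed

lemma deriv_comp_op:
  assumes \<phi>: "linear_fractional_self_map \<phi>" and f: "f holomorphic_on ball 0 1" and z: "cmod z < 1"
  shows "deriv (comp_op \<phi> f) z = deriv f (\<phi> z) * deriv \<phi> z"
proof -
  have "(\<phi> has_field_derivative deriv \<phi> z) (at z)"
    using holomorphic_derivI[OF linear_fractional_holomorphic[OF \<phi>] open_ball] z by simp
  moreover have "(f has_field_derivative deriv f (\<phi> z)) (at (\<phi> z))"
    using holomorphic_derivI[OF f open_ball] linear_fractional_less_1[OF \<phi> z] by simp
  ultimately have "((\<lambda>z. f (\<phi> z)) has_field_derivative deriv f (\<phi> z) * deriv \<phi> z) (at z)"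
    using DERIV_chain2 by blast
  then show ?thesis
    by (rule deriv_disk_eqI) (use z in \<open>auto simp: comp_op_def\<close>)
qed

text \<open>
  The derivative of the composed function is \<open>(f' \<circ> \<phi>) \<phi>'\<close>, and \<open>\<phi>'\<close> is bounded. The integral is
  stated apart from the norm because the operator estimates below use it for \<open>L\<^sup>1\<close> bounds of this
  derivative.
\<close>

lemma comp_op_energy:
  assumes \<alpha>: "\<alpha> > -1" and \<phi>: "linear_fractional_self_map \<phi>"
  obtains C where "C \<ge> 0" "\<And>f. f \<in> dirichlet_space \<alpha> \<Longrightarrow> comp_op \<phi> f \<in> dirichlet_space \<alpha>"
    "\<And>f. f \<in> dirichlet_space \<alpha> \<Longrightarrow>
      (\<integral>z. (cmod (deriv (comp_op \<phi> f) z))\<^sup>2 \<partial>weighted_disk_area \<alpha>) \<le> (C * ip_norm (dirichlet_ip \<alpha>) f)\<^sup>2"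
proof -
  let ?M = "weighted_disk_area \<alpha>"
  obtain K where K: "K \<ge> 0" "\<And>z. cmod z < 1 \<Longrightarrow> cmod (deriv \<phi> z) \<le> K"
    using linear_fractional_deriv_bound[OF \<phi>] by blast
  define m where "m = moebius_bound \<alpha> (cmod (\<phi> 0))"
  have m0: "m \<ge> 0" by (simp add: m_def moebius_bound_def)
  have est: "(\<integral>\<^sup>+z. ennreal ((cmod (deriv (comp_op \<phi> f) z))\<^sup>2) \<partial>?M) \<le>
      ennreal (K\<^sup>2 * m * (\<integral>z. (cmod (deriv f z))\<^sup>2 \<partial>?M))" if f: "f \<in> dirichlet_space \<alpha>" for f
  proof -
    note F = dirichlet_spaceD[OF f]
    have hol: "deriv f holomorphic_on ball 0 1" using F(1) by (rule holomorphic_deriv) auto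
    have cont: "continuous_on (ball 0 1) (\<lambda>z. (cmod (deriv f (\<phi> z)))\<^sup>2)"
      by (intro continuous_intros continuous_on_compose2[OF continuous_on_deriv_disk[OF F(1)]]
          holomorphic_on_imp_continuous_on linear_fractional_holomorphic[OF \<phi>])
        (use linear_fractional_less_1[OF \<phi>] in auto)
    have "(\<integral>\<^sup>+z. ennreal ((cmod (deriv (comp_op \<phi> f) z))\<^sup>2) \<partial>?M) \<le>
        (\<integral>\<^sup>+z. ennreal (K\<^sup>2) * ennreal ((cmod (deriv f (\<phi> z)))\<^sup>2) \<partial>?M)"
    proof (rule nn_integral_mono)
      fix z assume "z \<in> space ?M"
      then have z: "cmod z < 1" by simp
      have "(cmod (deriv f (\<phi> z) * deriv \<phi> z))\<^sup>2 \<le> K\<^sup>2 * (cmod (deriv f (\<phi> z)))\<^sup>2"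
        using K z by (simp add: norm_mult power_mult_distrib mult.commute mult_right_mono power_mono)
      then show "ennreal ((cmod (deriv (comp_op \<phi> f) z))\<^sup>2) \<le> ennreal (K\<^sup>2) * ennreal ((cmod (deriv f (\<phi> z)))\<^sup>2)"
        using deriv_comp_op[OF \<phi> F(1) z] by (simp add: ennreal_mult[symmetric] ennreal_leI)
    qed
    also have "\<dots> = ennreal (K\<^sup>2) * (\<integral>\<^sup>+z. ennreal ((cmod (deriv f (\<phi> z)))\<^sup>2) \<partial>?M)"
      using borel_measurable_weighted_disk_area_continuous[OF cont]
      by (intro nn_integral_cmult) (rule measurable_compose[OF _ measurable_ennreal])
    also have "\<dots> \<le> ennreal (K\<^sup>2) * (ennreal m * (\<integral>\<^sup>+z. ennreal ((cmod (deriv f z))\<^sup>2) \<partial>?M))"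
      unfolding m_def
      by (intro mult_left_mono nn_integral_composition[OF \<alpha> hol] linear_fractional_holomorphic[OF \<phi>]
          linear_fractional_less_1[OF \<phi>]) auto
    also have "\<dots> = ennreal (K\<^sup>2 * m * (\<integral>z. (cmod (deriv f z))\<^sup>2 \<partial>?M))"
      using m0 by (simp add: dirichlet_norm_square_nn[OF f] ennreal_mult' mult.assoc)
    finally show ?thesis .
  qed
  have mem: "comp_op \<phi> f \<in> dirichlet_space \<alpha>" if f: "f \<in> dirichlet_space \<alpha>" for f
  proof -
    have hol: "comp_op \<phi> f holomorphic_on ball 0 1"
      by (rule comp_op_holomorphic[OF \<phi> dirichlet_spaceD(1)[OF f]])
    have "integrable ?M (\<lambda>z. (cmod (deriv (comp_op \<phi> f) z))\<^sup>2)"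
      using est[OF f] by (subst square_integrable_disk_iff[OF measurable_deriv_disk[OF hol]])
        (auto intro: le_less_trans)
    then show ?thesis using hol by (simp add: dirichlet_space_def comp_op_def)
  qed
  show thesis
  proof (rule that)
    show "K * sqrt m \<ge> 0" using K(1) m0 by simp
    show "comp_op \<phi> f \<in> dirichlet_space \<alpha>" if "f \<in> dirichlet_space \<alpha>" for f by (rule mem[OF that])
    fix f assume f: "f \<in> dirichlet_space \<alpha>"
    have "(\<integral>z. (cmod (deriv (comp_op \<phi> f) z))\<^sup>2 \<partial>?M) \<le> K\<^sup>2 * m * (\<integral>z. (cmod (deriv f z))\<^sup>2 \<partial>?M)"
      using est[OF f] m0 unfolding dirichlet_norm_square_nn[OF mem[OF f]]
      by (subst (asm) ennreal_le_iff) (auto intro!: mult_nonneg_nonneg integral_nonneg_AE)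
    also have "\<dots> \<le> K\<^sup>2 * m * (ip_norm (dirichlet_ip \<alpha>) f)\<^sup>2"
      using m0 by (intro mult_left_mono dirichlet_energy_le) auto
    finally show "(\<integral>z. (cmod (deriv (comp_op \<phi> f) z))\<^sup>2 \<partial>?M) \<le> (K * sqrt m * ip_norm (dirichlet_ip \<alpha>) f)\<^sup>2"
      using m0 by (simp add: power_mult_distrib)
  qed
qed

lemma comp_op_bounded:
  assumes \<alpha>: "\<alpha> > -1" and \<phi>: "linear_fractional_self_map \<phi>"
  shows "function_hilbert_space.bounded_operator (dirichlet_space \<alpha>) (dirichlet_ip \<alpha>) (comp_op \<phi>)"
proof -
  interpret function_hilbert_space "dirichlet_space \<alpha>" "dirichlet_ip \<alpha>"
    by (rule dirichlet_hilbert_space[OF \<alpha>])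
  obtain C where C: "C \<ge> 0" "\<And>f. f \<in> dirichlet_space \<alpha> \<Longrightarrow> comp_op \<phi> f \<in> dirichlet_space \<alpha>"
    "\<And>f. f \<in> dirichlet_space \<alpha> \<Longrightarrow>
      (\<integral>z. (cmod (deriv (comp_op \<phi> f) z))\<^sup>2 \<partial>weighted_disk_area \<alpha>) \<le> (C * nrm f)\<^sup>2"
    using comp_op_energy[OF \<alpha> \<phi>] by blast
  define e where "e = 1 + eval_bound \<alpha> (cmod (\<phi> 0))"
  have \<phi>0: "cmod (\<phi> 0) < 1" using linear_fractional_less_1[OF \<phi>, of 0] by simp
  have e: "e \<ge> 0" using eval_bound_nonneg[OF norm_ge_zero \<phi>0, of \<alpha>] by (simp add: e_def)
  show ?thesis
  proof (rule bounded_operatorI)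
    show "linear_operator (dirichlet_space \<alpha>) (comp_op \<phi>)"
      unfolding linear_operator_def using C(2) by (auto simp: comp_op_def fscale_def fun_eq_iff)
    fix f assume f: "f \<in> dirichlet_space \<alpha>"
    have "comp_op \<phi> f 0 = f (\<phi> 0)" by (simp add: comp_op_def)
    then have "cmod (comp_op \<phi> f 0) \<le> e * nrm f"
      using value_le_dirichlet_norm[OF \<alpha> f order_refl \<phi>0] by (simp add: e_def)
    then have "(nrm (comp_op \<phi> f))\<^sup>2 \<le> (e * nrm f)\<^sup>2 + (C * nrm f)\<^sup>2"
      unfolding dirichlet_norm_square[of \<alpha> "comp_op \<phi> f"] using C(3)[OF f] by (intro add_mono power_mono) auto
    also have "\<dots> \<le> (e * nrm f + C * nrm f)\<^sup>2"
      using e C(1) nrm_nonneg[OF f] by (simp add: power2_sum)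
    finally show "nrm (comp_op \<phi> f) \<le> (e + C) * nrm f"
      using e C(1) nrm_nonneg[OF f] power2_le_imp_le[of "nrm (comp_op \<phi> f)" "e * nrm f + C * nrm f"]
      by (simp add: distrib_right)
  qed
qed

lemma adjoint_comp_bounded:
  assumes "\<alpha> > -1" "linear_fractional_self_map \<phi>" "linear_fractional_self_map \<psi>"
  shows "function_hilbert_space.bounded_operator (dirichlet_space \<alpha>) (dirichlet_ip \<alpha>)
    (hilbert_adjoint (dirichlet_space \<alpha>) (dirichlet_ip \<alpha>) (comp_op \<psi>) \<circ> comp_op \<phi>)"
proof -
  interpret function_hilbert_space "dirichlet_space \<alpha>" "dirichlet_ip \<alpha>"
    by (rule dirichlet_hilbert_space[OF assms(1)])
  show ?thesis
    by (intro bounded_operator_comp bounded_operator_adjoint comp_op_bounded[OF assms(1)] assms(2,3))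
qed

lemma adjoint_comp_ip:
  assumes \<alpha>: "\<alpha> > -1" and \<phi>: "linear_fractional_self_map \<phi>" and \<psi>: "linear_fractional_self_map \<psi>"
    and f: "f \<in> dirichlet_space \<alpha>" and g: "g \<in> dirichlet_space \<alpha>"
  shows "dirichlet_ip \<alpha>
      ((hilbert_adjoint (dirichlet_space \<alpha>) (dirichlet_ip \<alpha>) (comp_op \<psi>) \<circ> comp_op \<phi>) f) g =
    dirichlet_ip \<alpha> (comp_op \<phi> f) (comp_op \<psi> g)"
proof -
  interpret function_hilbert_space "dirichlet_space \<alpha>" "dirichlet_ip \<alpha>"
    by (rule dirichlet_hilbert_space[OF \<alpha>])
  define T where "T = hilbert_adjoint (dirichlet_space \<alpha>) (dirichlet_ip \<alpha>) (comp_op \<psi>) \<circ> comp_op \<phi>"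
  have T: "bounded_operator T" unfolding T_def by (rule adjoint_comp_bounded[OF \<alpha> \<phi> \<psi>])
  note \<phi>f = bounded_operator_mem[OF comp_op_bounded[OF \<alpha> \<phi>] f]
  note \<psi>g = bounded_operator_mem[OF comp_op_bounded[OF \<alpha> \<psi>] g]
  have "dirichlet_ip \<alpha> (comp_op \<psi> g) (comp_op \<phi> f) = dirichlet_ip \<alpha> g (T f)"
    unfolding T_def o_apply by (rule hilbert_adjoint(2)[OF comp_op_bounded[OF \<alpha> \<psi>] \<phi>f g])
  then have "dirichlet_ip \<alpha> (T f) g = dirichlet_ip \<alpha> (comp_op \<phi> f) (comp_op \<psi> g)"
    using ip_commute[OF g bounded_operator_mem[OF T f]] ip_commute[OF \<psi>g \<phi>f] by simp
  then show ?thesis by (simp add: T_def)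
qed

section \<open>Disjoint contact sets give geometric approximation\<close>

text \<open>
  These are the Taylor coefficients of the derivative of \<open>f\<close>.
\<close>

definition taylor_coeff :: "nat \<Rightarrow> (complex \<Rightarrow> complex) \<Rightarrow> complex" where
  "taylor_coeff k f = (deriv ^^ k) (deriv f) 0 / fact k"

lemma taylor_coeff_eq: "taylor_coeff k f = (deriv ^^ Suc k) f 0 / fact k"
  by (simp add: taylor_coeff_def funpow_Suc_right del: funpow.simps)

lemma taylor_coeff_bound:
  assumes \<alpha>: "\<alpha> > -1" and f: "f \<in> dirichlet_space \<alpha>" and R: "0 < R" "R < 1"
  shows "cmod (taylor_coeff k f) \<le> eval_bound \<alpha> R * ip_norm (dirichlet_ip \<alpha>) f / R ^ k"
proof -
  have hol: "deriv f holomorphic_on ball 0 1"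
    using dirichlet_spaceD(1)[OF f] by (rule holomorphic_deriv) auto
  have "cmod ((deriv ^^ k) (deriv f) 0) \<le> fact k * (eval_bound \<alpha> R * ip_norm (dirichlet_ip \<alpha>) f) / R ^ k"
  proof (rule Cauchy_inequality)
    show "deriv f holomorphic_on ball 0 R" by (rule holomorphic_on_subset[OF hol]) (use R in auto)
    show "continuous_on (cball 0 R) (deriv f)"
      by (rule continuous_on_subset[OF holomorphic_on_imp_continuous_on[OF hol]]) (use R in auto)
    show "cmod (deriv f x) \<le> eval_bound \<alpha> R * ip_norm (dirichlet_ip \<alpha>) f" if "cmod (0 - x) = R" for x
      using deriv_le_dirichlet_norm[OF \<alpha> f _ R(2), of x] that by simp
  qed (use R in auto)
  then have "cmod ((deriv ^^ k) (deriv f) 0) / fact k \<le>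
      fact k * (eval_bound \<alpha> R * ip_norm (dirichlet_ip \<alpha>) f) / R ^ k / fact k"
    by (rule divide_right_mono) simp
  then show ?thesis by (simp add: taylor_coeff_def norm_divide)
qed

lemma taylor_remainder_bound:
  assumes \<alpha>: "\<alpha> > -1" and f: "f \<in> dirichlet_space \<alpha>" and R: "0 < r" "r < R" "R < 1" and w: "cmod w \<le> r"
  shows "cmod (deriv f w - (\<Sum>k<N. taylor_coeff k f * w ^ k)) \<le>
    eval_bound \<alpha> R / (1 - r / R) * (r / R) ^ N * ip_norm (dirichlet_ip \<alpha>) f"
proof -
  define B where "B = eval_bound \<alpha> R * ip_norm (dirichlet_ip \<alpha>) f"
  define \<rho> where "\<rho> = r / R"
  have \<rho>: "0 < \<rho>" "\<rho> < 1" using R by (auto simp: \<rho>_def)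
  have hol: "deriv f holomorphic_on ball 0 1"
    using dirichlet_spaceD(1)[OF f] by (rule holomorphic_deriv) auto
  have sums: "(\<lambda>k. taylor_coeff k f * w ^ k) sums deriv f w"
    using holomorphic_power_series[OF hol, of w] w R by (simp add: taylor_coeff_def)
  have bound: "cmod (taylor_coeff k f * w ^ k) \<le> B * \<rho> ^ k" for k
  proof -
    have "cmod (taylor_coeff k f * w ^ k) \<le> (B / R ^ k) * r ^ k"
      unfolding norm_mult norm_power B_def using R w
      by (intro mult_mono taylor_coeff_bound[OF \<alpha> f] power_mono) (auto intro: order_trans[OF norm_ge_zero taylor_coeff_bound[OF \<alpha> f]])
    then show ?thesis by (simp add: \<rho>_def power_divide)
  qed
  have tail: "(\<lambda>k. taylor_coeff (k + N) f * w ^ (k + N)) sums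
      (deriv f w - (\<Sum>k<N. taylor_coeff k f * w ^ k))"
    by (rule sums_split_initial_segment[OF sums])
  have geom: "(\<lambda>k. B * \<rho> ^ N * \<rho> ^ k) sums (B * \<rho> ^ N * (1 / (1 - \<rho>)))"
    using \<rho> by (intro sums_mult geometric_sums) simp
  have "cmod (\<Sum>k. taylor_coeff (k + N) f * w ^ (k + N)) \<le> (\<Sum>k. B * \<rho> ^ N * \<rho> ^ k)"
  proof (rule norm_suminf_le[OF _ sums_summable[OF geom]])
    fix k
    have "B * \<rho> ^ N * \<rho> ^ k = B * \<rho> ^ (k + N)" by (simp add: power_add mult_ac)
    then show "cmod (taylor_coeff (k + N) f * w ^ (k + N)) \<le> B * \<rho> ^ N * \<rho> ^ k"
      using bound[of "k + N"] by (simp only:)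
  qed
  then show ?thesis
    using sums_unique[OF tail] sums_unique[OF geom] by (simp add: B_def \<rho>_def mult_ac)
qed

lemma integral_cmod_le:
  fixes u :: "complex \<Rightarrow> complex"
  assumes \<alpha>: "\<alpha> > -1" and u: "u \<in> borel_measurable (weighted_disk_area \<alpha>)"
    "integrable (weighted_disk_area \<alpha>) (\<lambda>z. (cmod (u z))\<^sup>2)"
    and bound: "(\<integral>z. (cmod (u z))\<^sup>2 \<partial>weighted_disk_area \<alpha>) \<le> B\<^sup>2" "B \<ge> 0"
  shows "integrable (weighted_disk_area \<alpha>) u"
    and "(\<integral>z. cmod (u z) \<partial>weighted_disk_area \<alpha>) \<le> sqrt (measure (weighted_disk_area \<alpha>) (ball 0 1)) * B"
proof -
  let ?M = "weighted_disk_area \<alpha>"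
  interpret finite_measure ?M by (rule finite_measure_weighted_disk_area[OF \<alpha>])
  have one: "integrable ?M (\<lambda>_. (cmod 1)\<^sup>2)" by simp
  show "integrable ?M u"
    using integrable_mult_of_square_integrable[OF u(1) _ u(2) one] by simp
  have "(\<integral>z. cmod (u z) * cmod 1 \<partial>?M) \<le> sqrt (\<integral>z. (cmod (u z))\<^sup>2 \<partial>?M) * sqrt (\<integral>z. (cmod 1)\<^sup>2 \<partial>?M)"
    by (rule integral_cauchy_schwarz[OF u(1) _ u(2) one]) simp
  also have "\<dots> \<le> B * sqrt (\<integral>z. (cmod 1)\<^sup>2 \<partial>?M)"
    using bound by (intro mult_right_mono real_le_lsqrt) auto
  finally show "(\<integral>z. cmod (u z) \<partial>?M) \<le> sqrt (measure ?M (ball 0 1)) * B"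
    by (simp add: mult.commute)
qed

text \<open>
  Where the symbol stays in the disk of radius \<open>r\<close>, the derivative of the composed function is a
  finite Taylor section up to a geometrically small error.
\<close>

lemma integral_taylor_section:
  assumes \<alpha>: "\<alpha> > -1" and \<psi>: "linear_fractional_self_map \<psi>" and g: "g \<in> dirichlet_space \<alpha>"
    and K: "\<And>z. cmod z < 1 \<Longrightarrow> cmod (deriv \<psi> z) \<le> K"
    and E: "E \<in> sets (weighted_disk_area \<alpha>)" "\<And>z. z \<in> E \<Longrightarrow> cmod (\<psi> z) \<le> r"
    and R: "0 < r" "r < R" "R < 1"
    and u: "integrable (weighted_disk_area \<alpha>) u"
  shows "cmod ((\<integral>z. indicator E z * (u z * cnj (deriv (comp_op \<psi> g) z)) \<partial>weighted_disk_area \<alpha>) -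
      (\<Sum>k<N. cnj (taylor_coeff k g) *
        (\<integral>z. indicator E z * (u z * cnj (\<psi> z ^ k * deriv \<psi> z)) \<partial>weighted_disk_area \<alpha>)))
    \<le> eval_bound \<alpha> R / (1 - r / R) * (r / R) ^ N * ip_norm (dirichlet_ip \<alpha>) g * K *
      (\<integral>z. cmod (u z) \<partial>weighted_disk_area \<alpha>)"
proof -
  let ?M = "weighted_disk_area \<alpha>"
  define D where "D = eval_bound \<alpha> R / (1 - r / R) * (r / R) ^ N * ip_norm (dirichlet_ip \<alpha>) g"
  note G = dirichlet_spaceD[OF g]
  have hol\<psi>: "\<psi> holomorphic_on ball 0 1" by (rule linear_fractional_holomorphic[OF \<psi>])
  have \<psi>m: "\<psi> \<in> borel_measurable ?M" "deriv \<psi> \<in> borel_measurable ?M"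
    by (auto intro!: borel_measurable_weighted_disk_area_continuous holomorphic_on_imp_continuous_on
        hol\<psi> continuous_on_deriv_disk)
  have um: "u \<in> borel_measurable ?M" using u by auto
  have Em: "(\<lambda>z. indicator E z :: complex) \<in> borel_measurable ?M" using E(1) by auto
  have K0: "K \<ge> 0" using K[of 0] norm_ge_zero[of "deriv \<psi> 0"] by (simp del: norm_ge_zero)
  have i1: "integrable ?M (\<lambda>z. indicator E z * (u z * cnj (\<psi> z ^ k * deriv \<psi> z)))" for k
  proof (rule Bochner_Integration.integrable_bound)
    show "integrable ?M (\<lambda>z. K * cmod (u z))" using u by (intro integrable_mult_right integrable_norm)
    show "(\<lambda>z. indicator E z * (u z * cnj (\<psi> z ^ k * deriv \<psi> z))) \<in> borel_measurable ?M"
      using Em um \<psi>m by measurable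
    show "AE z in ?M. norm (indicator E z * (u z * cnj (\<psi> z ^ k * deriv \<psi> z))) \<le> norm (K * cmod (u z))"
    proof (rule AE_I2)
      fix z assume "z \<in> space ?M"
      then have z: "cmod z < 1" by simp
      have "cmod (\<psi> z ^ k * deriv \<psi> z) \<le> 1 * K"
        unfolding norm_mult norm_power using linear_fractional_less_1[OF \<psi> z] K[OF z]
        by (intro mult_mono power_le_one) auto
      then have "cmod (u z) * cmod (\<psi> z ^ k * deriv \<psi> z) \<le> cmod (u z) * K"
        by (intro mult_left_mono) auto
      then show "norm (indicator E z * (u z * cnj (\<psi> z ^ k * deriv \<psi> z))) \<le> norm (K * cmod (u z))"
        using K0 by (cases "z \<in> E") (auto simp: norm_mult norm_power mult_ac)
    qed
  qed
  define q where "q z = deriv g (\<psi> z) - (\<Sum>k<N. taylor_coeff k g * \<psi> z ^ k)" for z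
  have split: "indicator E z * (u z * cnj (deriv (comp_op \<psi> g) z)) =
      indicator E z * (u z * cnj (q z * deriv \<psi> z)) +
      (\<Sum>k<N. cnj (taylor_coeff k g) * (indicator E z * (u z * cnj (\<psi> z ^ k * deriv \<psi> z))))"
    if "cmod z < 1" for z
  proof -
    have "deriv (comp_op \<psi> g) z = q z * deriv \<psi> z + (\<Sum>k<N. taylor_coeff k g * (\<psi> z ^ k * deriv \<psi> z))"
      using deriv_comp_op[OF \<psi> G(1) that] by (simp add: q_def algebra_simps sum_distrib_left)
    then show ?thesis
      by (simp add: cnj_sum algebra_simps sum_distrib_left)
  qed
  have qcont: "continuous_on (ball 0 1) q"
    unfolding q_def using linear_fractional_less_1[OF \<psi>]
    by (intro continuous_intros continuous_on_compose2[OF continuous_on_deriv_disk[OF G(1)]]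
        holomorphic_on_imp_continuous_on hol\<psi>) auto
  then have qm: "q \<in> borel_measurable ?M" by (rule borel_measurable_weighted_disk_area_continuous)
  have q_le: "norm (indicator E z * (u z * cnj (q z * deriv \<psi> z))) \<le> D * K * cmod (u z)" if z: "cmod z < 1" for z
  proof (cases "z \<in> E")
    case True
    have "cmod (q z) \<le> D"
      unfolding q_def D_def by (rule taylor_remainder_bound[OF \<alpha> g R E(2)[OF True]])
    then have "cmod (q z) * cmod (deriv \<psi> z) \<le> D * K"
      using K[OF z] by (intro mult_mono) (auto intro: order_trans[OF norm_ge_zero])
    then have "cmod (u z) * (cmod (q z) * cmod (deriv \<psi> z)) \<le> cmod (u z) * (D * K)"
      by (intro mult_left_mono) auto
    then show ?thesis using True by (simp add: norm_mult mult_ac)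
  next
    case False
    have "D \<ge> 0"
      unfolding D_def using R eval_bound_nonneg[of R \<alpha>] dirichlet_norm_nonneg
      by (intro mult_nonneg_nonneg divide_nonneg_nonneg zero_le_power) auto
    then show ?thesis using False K0 by simp
  qed
  have i3: "integrable ?M (\<lambda>z. D * K * cmod (u z))" using u by (intro integrable_mult_right integrable_norm)
  have i2: "integrable ?M (\<lambda>z. indicator E z * (u z * cnj (q z * deriv \<psi> z)))"
  proof (rule Bochner_Integration.integrable_bound[OF i3])
    show "(\<lambda>z. indicator E z * (u z * cnj (q z * deriv \<psi> z))) \<in> borel_measurable ?M"
      using Em um \<psi>m qm by measurable
    show "AE z in ?M. norm (indicator E z * (u z * cnj (q z * deriv \<psi> z))) \<le> norm (D * K * cmod (u z))"
      using order_trans[OF q_le abs_ge_self]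
      by (intro AE_I2) (simp only: real_norm_def space_weighted_disk_area mem_ball_0)
  qed
  have "(\<integral>z. indicator E z * (u z * cnj (deriv (comp_op \<psi> g) z)) \<partial>?M) =
      (\<integral>z. indicator E z * (u z * cnj (q z * deriv \<psi> z)) +
        (\<Sum>k<N. cnj (taylor_coeff k g) * (indicator E z * (u z * cnj (\<psi> z ^ k * deriv \<psi> z)))) \<partial>?M)"
    by (rule integral_weighted_disk_area_cong) (rule split)
  also have "\<dots> = (\<integral>z. indicator E z * (u z * cnj (q z * deriv \<psi> z)) \<partial>?M) +
      (\<Sum>k<N. cnj (taylor_coeff k g) * (\<integral>z. indicator E z * (u z * cnj (\<psi> z ^ k * deriv \<psi> z)) \<partial>?M))"
    using i1 i2 by (simp only: Bochner_Integration.integral_add Bochner_Integration.integrable_sum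
        integrable_mult_right Bochner_Integration.integral_sum integral_mult_right_zero)
  finally have "(\<integral>z. indicator E z * (u z * cnj (deriv (comp_op \<psi> g) z)) \<partial>?M) -
      (\<Sum>k<N. cnj (taylor_coeff k g) * (\<integral>z. indicator E z * (u z * cnj (\<psi> z ^ k * deriv \<psi> z)) \<partial>?M)) =
      (\<integral>z. indicator E z * (u z * cnj (q z * deriv \<psi> z)) \<partial>?M)" by simp
  moreover have "cmod (\<integral>z. indicator E z * (u z * cnj (q z * deriv \<psi> z)) \<partial>?M) \<le>
      (\<integral>z. D * K * cmod (u z) \<partial>?M)"
    by (rule Bochner_Integration.integral_norm_bound_integral[OF i2 i3]) (use q_le in auto)
  ultimately show ?thesis by (simp add: D_def)
qed


lemma sum_lessThan_add:
  fixes h :: "nat \<Rightarrow> 'b::comm_monoid_add"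
  shows "(\<Sum>j<m + n. h j) = (\<Sum>j<m. h j) + (\<Sum>j<n. h (m + j))"
  by (induction n) (auto simp: add_ac)

lemma taylor_coeff_bounded_functional:
  assumes \<alpha>: "\<alpha> > -1"
  shows "function_hilbert_space.bounded_functional (dirichlet_space \<alpha>) (dirichlet_ip \<alpha>) (taylor_coeff k)"
proof -
  interpret function_hilbert_space "dirichlet_space \<alpha>" "dirichlet_ip \<alpha>"
    by (rule dirichlet_hilbert_space[OF \<alpha>])
  show ?thesis
  proof (rule bounded_functionalI)
    fix f g assume "f \<in> dirichlet_space \<alpha>" "g \<in> dirichlet_space \<alpha>"
    then show "taylor_coeff k (f + g) = taylor_coeff k f + taylor_coeff k g"
      unfolding taylor_coeff_eq plus_fun_def
      by (subst higher_deriv_add[where S = "ball 0 1"]) (auto simp: dirichlet_spaceD add_divide_distrib)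
  next
    fix c f assume "f \<in> dirichlet_space \<alpha>"
    then show "taylor_coeff k (fscale c f) = c * taylor_coeff k f"
      unfolding taylor_coeff_eq fscale_def
      by (subst higher_deriv_cmult[where A = "ball 0 1"]) (auto simp: dirichlet_spaceD)
  next
    fix f assume "f \<in> dirichlet_space \<alpha>"
    then show "cmod (taylor_coeff k f) \<le> eval_bound \<alpha> (1/2) / (1/2) ^ k * nrm f"
      using taylor_coeff_bound[OF \<alpha>, of f "1/2" k] by simp
  qed
qed

lemma value_bounded_functional:
  assumes \<alpha>: "\<alpha> > -1" and w: "cmod w < 1"
  shows "function_hilbert_space.bounded_functional (dirichlet_space \<alpha>) (dirichlet_ip \<alpha>) (\<lambda>f. f w)"
proof -
  interpret function_hilbert_space "dirichlet_space \<alpha>" "dirichlet_ip \<alpha>"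
    by (rule dirichlet_hilbert_space[OF \<alpha>])
  show ?thesis
    by (rule bounded_functionalI[where K = "1 + eval_bound \<alpha> (cmod w)"])
      (use value_le_dirichlet_norm[OF \<alpha> _ order_refl w] in \<open>auto simp: fscale_def\<close>)
qed

text \<open>
  The inner product \<open>\<langle>T f, g\<rangle>\<close> is \<open>f (\<phi> 0) cnj (g (\<psi> 0)) + \<integral> u cnj v\<close> with the derivatives \<open>u\<close>, \<open>v\<close> of
  \<open>f \<circ> \<phi>\<close> and \<open>g \<circ> \<psi>\<close>. Where \<open>cmod \<psi> \<le> r\<close>, the function \<open>v\<close> is replaced by a Taylor section of
  length \<open>N\<close>; elsewhere \<open>cmod \<phi> \<le> r\<close> and \<open>u\<close> is replaced. The main terms see \<open>f\<close> only through
  \<open>f (\<phi> 0)\<close>, \<open>N\<close> moments of \<open>u\<close> and \<open>N\<close> Taylor coefficients, and the errors are \<open>O(\<rho>\<^sup>N)\<close>. The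
  choice \<open>g = T f\<close> yields the estimate of the norm.
\<close>

theorem adjoint_comp_approximable:
  assumes \<alpha>: "\<alpha> > -1" and \<phi>: "linear_fractional_self_map \<phi>" and \<psi>: "linear_fractional_self_map \<psi>"
    and r: "0 < r" "r < 1" "\<And>z. cmod z < 1 \<Longrightarrow> cmod (\<phi> z) \<le> r \<or> cmod (\<psi> z) \<le> r"
  shows "\<exists>C \<rho>. 0 < \<rho> \<and> \<rho> < 1 \<and>
    (\<forall>N. function_hilbert_space.approximable (dirichlet_space \<alpha>) (dirichlet_ip \<alpha>)
      (hilbert_adjoint (dirichlet_space \<alpha>) (dirichlet_ip \<alpha>) (comp_op \<psi>) \<circ> comp_op \<phi>) (2 * N + 1) (C * \<rho> ^ N))"
proof -
  let ?M = "weighted_disk_area \<alpha>"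
  let ?H = "dirichlet_space \<alpha>"
  interpret function_hilbert_space ?H "dirichlet_ip \<alpha>"
    by (rule dirichlet_hilbert_space[OF \<alpha>])
  define T where "T = hilbert_adjoint ?H (dirichlet_ip \<alpha>) (comp_op \<psi>) \<circ> comp_op \<phi>"
  have bounded: "bounded_operator (comp_op \<phi>)" "bounded_operator (comp_op \<psi>)"
    by (rule comp_op_bounded[OF \<alpha> \<phi>], rule comp_op_bounded[OF \<alpha> \<psi>])
  have T: "bounded_operator T"
    unfolding T_def by (rule adjoint_comp_bounded[OF \<alpha> \<phi> \<psi>])
  have T_ip: "dirichlet_ip \<alpha> (T f) g = dirichlet_ip \<alpha> (comp_op \<phi> f) (comp_op \<psi> g)"
    if "f \<in> ?H" "g \<in> ?H" for f g
    unfolding T_def by (rule adjoint_comp_ip[OF \<alpha> \<phi> \<psi> that])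
  obtain K\<phi> where K\<phi>: "K\<phi> \<ge> 0" "\<And>z. cmod z < 1 \<Longrightarrow> cmod (deriv \<phi> z) \<le> K\<phi>"
    using linear_fractional_deriv_bound[OF \<phi>] by blast
  obtain K\<psi> where K\<psi>: "K\<psi> \<ge> 0" "\<And>z. cmod z < 1 \<Longrightarrow> cmod (deriv \<psi> z) \<le> K\<psi>"
    using linear_fractional_deriv_bound[OF \<psi>] by blast
  obtain C\<phi> where C\<phi>: "C\<phi> \<ge> 0" "\<And>f. f \<in> ?H \<Longrightarrow> comp_op \<phi> f \<in> ?H"
    "\<And>f. f \<in> ?H \<Longrightarrow> (\<integral>z. (cmod (deriv (comp_op \<phi> f) z))\<^sup>2 \<partial>?M) \<le> (C\<phi> * nrm f)\<^sup>2"
    using comp_op_energy[OF \<alpha> \<phi>] by blast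
  obtain C\<psi> where C\<psi>: "C\<psi> \<ge> 0" "\<And>f. f \<in> ?H \<Longrightarrow> comp_op \<psi> f \<in> ?H"
    "\<And>f. f \<in> ?H \<Longrightarrow> (\<integral>z. (cmod (deriv (comp_op \<psi> f) z))\<^sup>2 \<partial>?M) \<le> (C\<psi> * nrm f)\<^sup>2"
    using comp_op_energy[OF \<alpha> \<psi>] by blast
  define A where "A = sqrt (measure ?M (ball 0 1))"
  have A: "A \<ge> 0" by (simp add: A_def)
  define R where "R = (1 + r) / 2"
  have R: "0 < r" "r < R" "R < 1" using r by (auto simp: R_def)
  define \<rho> where "\<rho> = r / R"
  have \<rho>: "0 < \<rho>" "\<rho> < 1" using R by (auto simp: \<rho>_def)
  define D where "D = eval_bound \<alpha> R / (1 - r / R)"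
  have ev: "eval_bound \<alpha> R \<ge> 0" using R eval_bound_nonneg[of R \<alpha>] by auto
  define u where "u f = deriv (comp_op \<phi> f)" for f
  define v where "v g = deriv (comp_op \<psi> g)" for g
  have um: "u f \<in> borel_measurable ?M" and ui: "integrable ?M (u f)"
    and u_le: "(\<integral>z. cmod (u f z) \<partial>?M) \<le> A * (C\<phi> * nrm f)" if f: "f \<in> ?H" for f
  proof -
    note F = dirichlet_spaceD[OF C\<phi>(2)[OF f]]
    show m: "u f \<in> borel_measurable ?M" unfolding u_def by (rule measurable_deriv_disk[OF F(1)])
    show "integrable ?M (u f)" "(\<integral>z. cmod (u f z) \<partial>?M) \<le> A * (C\<phi> * nrm f)"
      unfolding A_def
      by (rule integral_cmod_le[OF \<alpha> m F(3)[folded u_def] C\<phi>(3)[OF f, folded u_def]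
          mult_nonneg_nonneg[OF C\<phi>(1) nrm_nonneg[OF f]]])+
  qed
  have vm: "v g \<in> borel_measurable ?M" and vi: "integrable ?M (v g)"
    and v_le: "(\<integral>z. cmod (v g z) \<partial>?M) \<le> A * (C\<psi> * nrm g)" if g: "g \<in> ?H" for g
  proof -
    note G = dirichlet_spaceD[OF C\<psi>(2)[OF g]]
    show m: "v g \<in> borel_measurable ?M" unfolding v_def by (rule measurable_deriv_disk[OF G(1)])
    show "integrable ?M (v g)" "(\<integral>z. cmod (v g z) \<partial>?M) \<le> A * (C\<psi> * nrm g)"
      unfolding A_def
      by (rule integral_cmod_le[OF \<alpha> m G(3)[folded v_def] C\<psi>(3)[OF g, folded v_def]
          mult_nonneg_nonneg[OF C\<psi>(1) nrm_nonneg[OF g]]])+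
  qed
  have mem_le: "norm (\<theta> z ^ k * deriv \<theta> z) \<le> K"
    if "linear_fractional_self_map \<theta>" "\<And>z. cmod z < 1 \<Longrightarrow> cmod (deriv \<theta> z) \<le> K" "cmod z < 1" for \<theta> k z K
  proof -
    have "cmod (\<theta> z) ^ k * cmod (deriv \<theta> z) \<le> 1 * K"
      using linear_fractional_less_1[OF that(1,3)] that(2)[OF that(3)] by (intro mult_mono power_le_one) auto
    then show ?thesis by (simp add: norm_mult norm_power)
  qed
  have \<psi>m: "\<psi> \<in> borel_measurable ?M"
    by (intro borel_measurable_weighted_disk_area_continuous holomorphic_on_imp_continuous_on
        linear_fractional_holomorphic[OF \<psi>])
  \<comment> \<open>the part of the disk on which sections of \<open>g'\<close> are used; on its complement \<open>cmod \<phi> \<le> r\<close>\<close>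
  define E where "E = {z \<in> space ?M. cmod (\<psi> z) \<le> r}"
  define E' where "E' = space ?M - E"
  have E: "E \<in> sets ?M" unfolding E_def using \<psi>m by measurable
  have E': "E' \<in> sets ?M" unfolding E'_def by (rule sets.compl_sets[OF E])
  have E_le: "cmod (\<psi> z) \<le> r" if "z \<in> E" for z using that by (simp add: E_def)
  have E'_le: "cmod (\<phi> z) \<le> r" if "z \<in> E'" for z using that r(3)[of z] by (auto simp: E'_def E_def)
  define m where "m k f = (\<integral>z. indicator E z * (u f z * cnj (\<psi> z ^ k * deriv \<psi> z)) \<partial>?M)" for k f
  have weighted_integrable: "integrable ?M (\<lambda>z. indicator B z * (w z * cnj (\<theta> z ^ k * deriv \<theta> z)))"
    and weighted_le: "cmod (\<integral>z. indicator B z * (w z * cnj (\<theta> z ^ k * deriv \<theta> z)) \<partial>?M) \<le> K * (\<integral>z. cmod (w z) \<partial>?M)"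
    if w: "integrable ?M w" and B: "B \<in> sets ?M" and \<theta>: "linear_fractional_self_map \<theta>"
      and K: "\<And>z. cmod z < 1 \<Longrightarrow> cmod (deriv \<theta> z) \<le> K" for w B \<theta> k K
  proof -
    have \<theta>m: "\<theta> \<in> borel_measurable ?M" "deriv \<theta> \<in> borel_measurable ?M"
      by (auto intro!: borel_measurable_weighted_disk_area_continuous holomorphic_on_imp_continuous_on
          linear_fractional_holomorphic[OF \<theta>] continuous_on_deriv_disk)
    have wm: "w \<in> borel_measurable ?M" "(\<lambda>z. indicator B z :: complex) \<in> borel_measurable ?M" using w B by auto
    have le: "norm (indicator B z * (w z * cnj (\<theta> z ^ k * deriv \<theta> z))) \<le> K * cmod (w z)" if z: "cmod z < 1" for z
    proof -
      have "cmod (w z) * cmod (\<theta> z ^ k * deriv \<theta> z) \<le> cmod (w z) * K"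
        by (intro mult_left_mono mem_le[OF \<theta> K z]) auto
      then have 1: "cmod (w z) * cmod (\<theta> z ^ k * deriv \<theta> z) \<le> K * cmod (w z)"
        by (simp only: mult.commute)
      have 2: "0 \<le> K * cmod (w z)"
        by (rule order_trans[OF mult_nonneg_nonneg[OF norm_ge_zero norm_ge_zero] 1])
      show ?thesis
        unfolding norm_mult[of "indicator B z"] norm_mult[of "w z"] complex_mod_cnj
        using 1 2 by (cases "z \<in> B") simp_all
    qed
    have i3: "integrable ?M (\<lambda>z. K * cmod (w z))" using w by (intro integrable_mult_right integrable_norm)
    show i2: "integrable ?M (\<lambda>z. indicator B z * (w z * cnj (\<theta> z ^ k * deriv \<theta> z)))"
    proof (rule Bochner_Integration.integrable_bound[OF i3])
      show "(\<lambda>z. indicator B z * (w z * cnj (\<theta> z ^ k * deriv \<theta> z))) \<in> borel_measurable ?M"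
        using wm \<theta>m by measurable
      show "AE z in ?M. norm (indicator B z * (w z * cnj (\<theta> z ^ k * deriv \<theta> z))) \<le> norm (K * cmod (w z))"
        using order_trans[OF le abs_ge_self]
        by (intro AE_I2) (simp only: real_norm_def space_weighted_disk_area mem_ball_0)
    qed
    have "cmod (\<integral>z. indicator B z * (w z * cnj (\<theta> z ^ k * deriv \<theta> z)) \<partial>?M) \<le> (\<integral>z. K * cmod (w z) \<partial>?M)"
      by (rule Bochner_Integration.integral_norm_bound_integral[OF i2 i3]) (use le in auto)
    then show "cmod (\<integral>z. indicator B z * (w z * cnj (\<theta> z ^ k * deriv \<theta> z)) \<partial>?M) \<le> K * (\<integral>z. cmod (w z) \<partial>?M)"
      by simp
  qed
  have m_functional: "bounded_functional (m k)" for k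
  proof (rule bounded_functionalI)
    fix f g assume f: "f \<in> ?H" and g: "g \<in> ?H"
    note int = weighted_integrable[OF ui E \<psi> K\<psi>(2)]
    have "u (f + g) z = u f z + u g z" if "cmod z < 1" for z
      unfolding u_def bounded_operator_add[OF bounded(1) f g]
      by (rule deriv_add_disk) (use that dirichlet_spaceD(1)[OF C\<phi>(2)] f g in auto)
    then have "m k (f + g) = (\<integral>z. indicator E z * (u f z * cnj (\<psi> z ^ k * deriv \<psi> z)) +
        indicator E z * (u g z * cnj (\<psi> z ^ k * deriv \<psi> z)) \<partial>?M)"
      unfolding m_def by (intro integral_weighted_disk_area_cong) (simp add: algebra_simps)
    then show "m k (f + g) = m k f + m k g"
      unfolding m_def by (simp only: Bochner_Integration.integral_add[OF int[OF f] int[OF g]])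
  next
    fix c f assume f: "f \<in> ?H"
    have "u (fscale c f) z = c * u f z" if "cmod z < 1" for z
      unfolding u_def bounded_operator_scale[OF bounded(1) f]
      by (rule deriv_fscale_disk) (use that dirichlet_spaceD(1)[OF C\<phi>(2)] f in auto)
    then have "m k (fscale c f) = (\<integral>z. c * (indicator E z * (u f z * cnj (\<psi> z ^ k * deriv \<psi> z))) \<partial>?M)"
      unfolding m_def by (intro integral_weighted_disk_area_cong) (simp add: algebra_simps)
    then show "m k (fscale c f) = c * m k f"
      unfolding m_def by (simp only: integral_mult_right_zero)
  next
    fix f assume f: "f \<in> ?H"
    have "cmod (m k f) \<le> K\<psi> * (\<integral>z. cmod (u f z) \<partial>?M)"
      unfolding m_def by (rule weighted_le[OF ui[OF f] E \<psi> K\<psi>(2)])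
    also have "\<dots> \<le> K\<psi> * (A * (C\<phi> * nrm f))" by (intro mult_left_mono u_le f K\<psi>)
    finally show "cmod (m k f) \<le> K\<psi> * A * C\<phi> * nrm f" by (simp add: mult_ac)
  qed
  have \<phi>0: "cmod (\<phi> 0) < 1" and \<psi>0: "cmod (\<psi> 0) < 1"
    using linear_fractional_less_1[OF \<phi>, of 0] linear_fractional_less_1[OF \<psi>, of 0] by auto
  define e where "e = 1 + eval_bound \<alpha> (cmod (\<psi> 0))"
  have e: "e \<ge> 0" using eval_bound_nonneg[OF norm_ge_zero \<psi>0, of \<alpha>] by (simp add: e_def)
  define C where "C = D * K\<psi> * (A * C\<phi>) + D * K\<phi> * (A * C\<psi>)"
  have main: "cmod (dirichlet_ip \<alpha> (T f) g) \<le> (cmod (f (\<phi> 0)) * e +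
      (\<Sum>k<N. cmod (m k f)) * (eval_bound \<alpha> R / R ^ N) +
      (\<Sum>k<N. cmod (taylor_coeff k f)) * (K\<phi> * (A * C\<psi>)) + C * \<rho> ^ N * nrm f) * nrm g"
    if f: "f \<in> ?H" and g: "g \<in> ?H" for f g N
  proof -
    let ?I = "\<lambda>B h. (\<integral>z. indicator B z * h z \<partial>?M) :: complex"
    have uv: "integrable ?M (\<lambda>z. u f z * cnj (v g z))"
      unfolding u_def v_def by (rule dirichlet_ip_integrable[OF C\<phi>(2)[OF f] C\<psi>(2)[OF g]])
    have ind_int: "integrable ?M (\<lambda>z. indicator B z * (u f z * cnj (v g z)))" if "B \<in> sets ?M" for B
      using integrable_mult_indicator[OF that uv]
      by (rule Bochner_Integration.integrable_cong[OF refl, THEN iffD1, rotated]) (auto simp: indicator_def)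
    have "(\<integral>z. u f z * cnj (v g z) \<partial>?M) =
        (\<integral>z. indicator E z * (u f z * cnj (v g z)) + indicator E' z * (u f z * cnj (v g z)) \<partial>?M)"
      by (rule Bochner_Integration.integral_cong) (auto simp: E'_def indicator_def)
    also have "\<dots> = ?I E (\<lambda>z. u f z * cnj (v g z)) + ?I E' (\<lambda>z. u f z * cnj (v g z))"
      by (rule Bochner_Integration.integral_add[OF ind_int[OF E] ind_int[OF E']])
    finally have split: "(\<integral>z. u f z * cnj (v g z) \<partial>?M) =
        ?I E (\<lambda>z. u f z * cnj (v g z)) + ?I E' (\<lambda>z. u f z * cnj (v g z))" .
    have first: "cmod (?I E (\<lambda>z. u f z * cnj (v g z))) \<le>
        (\<Sum>k<N. cmod (m k f)) * (eval_bound \<alpha> R / R ^ N) * nrm g + D * \<rho> ^ N * nrm g * K\<psi> * (A * (C\<phi> * nrm f))"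
    proof -
      let ?S = "\<Sum>k<N. cnj (taylor_coeff k g) * m k f"
      have "cmod (?I E (\<lambda>z. u f z * cnj (v g z)) - ?S) \<le> D * \<rho> ^ N * nrm g * K\<psi> * (\<integral>z. cmod (u f z) \<partial>?M)"
        unfolding m_def v_def D_def \<rho>_def by (rule integral_taylor_section[OF \<alpha> \<psi> g K\<psi>(2) E E_le R ui[OF f]])
      also have "\<dots> \<le> D * \<rho> ^ N * nrm g * K\<psi> * (A * (C\<phi> * nrm f))"
        using ev R \<rho> K\<psi>(1) g u_le[OF f]
        by (intro mult_left_mono mult_nonneg_nonneg zero_le_power nrm_nonneg) (auto simp: D_def)
      finally have 1: "cmod (?I E (\<lambda>z. u f z * cnj (v g z)) - ?S) \<le> \<dots>" .
      have "cmod ?S \<le> (\<Sum>k<N. cmod (m k f) * (eval_bound \<alpha> R / R ^ N * nrm g))"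
      proof (rule order_trans[OF norm_sum], rule sum_mono)
        fix k assume "k \<in> {..<N}"
        then have k: "k \<le> N" by simp
        have "cmod (taylor_coeff k g) \<le> eval_bound \<alpha> R * nrm g / R ^ k"
          using R by (intro taylor_coeff_bound[OF \<alpha> g]) auto
        also have "\<dots> \<le> eval_bound \<alpha> R * nrm g / R ^ N"
          using R ev g k by (intro divide_left_mono power_decreasing mult_nonneg_nonneg mult_pos_pos nrm_nonneg) auto
        finally have "cmod (taylor_coeff k g) \<le> eval_bound \<alpha> R / R ^ N * nrm g" by simp
        from mult_left_mono[OF this norm_ge_zero[of "m k f"]]
        show "cmod (cnj (taylor_coeff k g) * m k f) \<le> cmod (m k f) * (eval_bound \<alpha> R / R ^ N * nrm g)"
          unfolding norm_mult[of "cnj _"] complex_mod_cnj by (simp only: mult.commute)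
      qed
      also have "\<dots> = (\<Sum>k<N. cmod (m k f)) * (eval_bound \<alpha> R / R ^ N) * nrm g"
        by (simp only: sum_distrib_right mult.assoc)
      finally show ?thesis
        using 1 norm_triangle_sub[of "?I E (\<lambda>z. u f z * cnj (v g z))" ?S] by linarith
    qed
    have second: "cmod (?I E' (\<lambda>z. u f z * cnj (v g z))) \<le>
        (\<Sum>k<N. cmod (taylor_coeff k f)) * (K\<phi> * (A * C\<psi>)) * nrm g + D * \<rho> ^ N * nrm f * K\<phi> * (A * (C\<psi> * nrm g))"
    proof -
      define m' where "m' k = ?I E' (\<lambda>z. v g z * cnj (\<phi> z ^ k * deriv \<phi> z))" for k
      let ?S = "\<Sum>k<N. cnj (taylor_coeff k f) * m' k"
      have "cmod (?I E' (\<lambda>z. v g z * cnj (u f z)) - ?S) \<le> D * \<rho> ^ N * nrm f * K\<phi> * (\<integral>z. cmod (v g z) \<partial>?M)"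
        unfolding m'_def u_def D_def \<rho>_def by (rule integral_taylor_section[OF \<alpha> \<phi> f K\<phi>(2) E' E'_le R vi[OF g]])
      also have "\<dots> \<le> D * \<rho> ^ N * nrm f * K\<phi> * (A * (C\<psi> * nrm g))"
        using ev R \<rho> K\<phi>(1) f v_le[OF g]
        by (intro mult_left_mono mult_nonneg_nonneg zero_le_power nrm_nonneg) (auto simp: D_def)
      finally have 1: "cmod (?I E' (\<lambda>z. v g z * cnj (u f z)) - ?S) \<le> \<dots>" .
      have "cmod ?S \<le> (\<Sum>k<N. cmod (taylor_coeff k f) * (K\<phi> * (A * C\<psi>) * nrm g))"
      proof (rule order_trans[OF norm_sum], rule sum_mono)
        fix k
        have "cmod (m' k) \<le> K\<phi> * (\<integral>z. cmod (v g z) \<partial>?M)"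
          unfolding m'_def by (rule weighted_le[OF vi[OF g] E' \<phi> K\<phi>(2)])
        also have "\<dots> \<le> K\<phi> * (A * (C\<psi> * nrm g))" by (intro mult_left_mono v_le g K\<phi>)
        finally have "cmod (m' k) \<le> K\<phi> * (A * C\<psi>) * nrm g" by (simp only: mult.assoc)
        from mult_left_mono[OF this norm_ge_zero[of "taylor_coeff k f"]]
        show "cmod (cnj (taylor_coeff k f) * m' k) \<le> cmod (taylor_coeff k f) * (K\<phi> * (A * C\<psi>) * nrm g)"
          unfolding norm_mult[of "cnj _"] complex_mod_cnj .
      qed
      also have "\<dots> = (\<Sum>k<N. cmod (taylor_coeff k f)) * (K\<phi> * (A * C\<psi>)) * nrm g"
        by (simp only: sum_distrib_right mult.assoc)
      finally have 2: "cmod (?I E' (\<lambda>z. v g z * cnj (u f z))) \<le>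
          (\<Sum>k<N. cmod (taylor_coeff k f)) * (K\<phi> * (A * C\<psi>)) * nrm g + D * \<rho> ^ N * nrm f * K\<phi> * (A * (C\<psi> * nrm g))"
        using 1 norm_triangle_sub[of "?I E' (\<lambda>z. v g z * cnj (u f z))" ?S] by linarith
      have "?I E' (\<lambda>z. u f z * cnj (v g z)) = (\<integral>z. cnj (indicator E' z * (v g z * cnj (u f z))) \<partial>?M)"
        by (rule Bochner_Integration.integral_cong) (auto simp: indicator_def)
      also have "\<dots> = cnj (?I E' (\<lambda>z. v g z * cnj (u f z)))"
        by (rule Bochner_Integration.integral_cnj)
      finally show ?thesis using 2 by simp
    qed
    have third: "cmod (f (\<phi> 0) * cnj (g (\<psi> 0))) \<le> cmod (f (\<phi> 0)) * e * nrm g"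
      using mult_left_mono[OF value_le_dirichlet_norm[OF \<alpha> g order_refl \<psi>0] norm_ge_zero[of "f (\<phi> 0)"]]
      unfolding norm_mult complex_mod_cnj e_def mult.assoc .
    have n3: "cmod (a + (b + c)) \<le> cmod a + (cmod b + cmod c)" for a b c :: complex
      by (intro order_trans[OF norm_triangle_ineq] add_left_mono norm_triangle_ineq)
    have "dirichlet_ip \<alpha> (T f) g = f (\<phi> 0) * cnj (g (\<psi> 0)) + (\<integral>z. u f z * cnj (v g z) \<partial>?M)"
      using T_ip[OF f g] dirichlet_ip_def[of \<alpha> "comp_op \<phi> f" "comp_op \<psi> g"]
      by (simp add: u_def v_def comp_op_def)
    then have "cmod (dirichlet_ip \<alpha> (T f) g) \<le> cmod (f (\<phi> 0) * cnj (g (\<psi> 0))) +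
        (cmod (?I E (\<lambda>z. u f z * cnj (v g z))) + cmod (?I E' (\<lambda>z. u f z * cnj (v g z))))"
      unfolding split using n3 by (simp only:)
    also have "\<dots> \<le> cmod (f (\<phi> 0)) * e * nrm g +
        (((\<Sum>k<N. cmod (m k f)) * (eval_bound \<alpha> R / R ^ N) * nrm g + D * \<rho> ^ N * nrm g * K\<psi> * (A * (C\<phi> * nrm f))) +
        ((\<Sum>k<N. cmod (taylor_coeff k f)) * (K\<phi> * (A * C\<psi>)) * nrm g + D * \<rho> ^ N * nrm f * K\<phi> * (A * (C\<psi> * nrm g))))"
      by (intro add_mono first second third)
    also have "\<dots> = (cmod (f (\<phi> 0)) * e +
      (\<Sum>k<N. cmod (m k f)) * (eval_bound \<alpha> R / R ^ N) +
      (\<Sum>k<N. cmod (taylor_coeff k f)) * (K\<phi> * (A * C\<psi>)) + C * \<rho> ^ N * nrm f) * nrm g"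
      by (simp only: C_def algebra_simps)
    finally show ?thesis .
  qed
  have "approximable T (2 * N + 1) (C * \<rho> ^ N)" for N
  proof -
    define l where "l j = (if j = 0 then (\<lambda>f. f (\<phi> 0)) else if j < 1 + N then m (j - 1) else taylor_coeff (j - (1 + N)))"
      for j
    define K where "K = e + eval_bound \<alpha> R / R ^ N + K\<phi> * (A * C\<psi>)"
    have K3: "0 \<le> eval_bound \<alpha> R / R ^ N" "0 \<le> K\<phi> * (A * C\<psi>)" using ev R K\<phi>(1) C\<psi>(1) A by auto
    then have K: "K \<ge> 0" "e \<le> K" "eval_bound \<alpha> R / R ^ N \<le> K" "K\<phi> * (A * C\<psi>) \<le> K"
      using e by (auto simp: K_def)
    have l_bounded: "bounded_functional (l j)" for j
      unfolding l_def using value_bounded_functional[OF \<alpha> \<phi>0] m_functional taylor_coeff_bounded_functional[OF \<alpha>]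
      by simp
    have "nrm (T f) \<le> K * (\<Sum>j<2 * N + 1. cmod (l j f)) + C * \<rho> ^ N * nrm f" if f: "f \<in> ?H" for f
    proof -
      have "2 * N + 1 = (1 + N) + N" by simp
      then have "(\<Sum>j<2 * N + 1. cmod (l j f)) =
          (\<Sum>j<1. cmod (l j f)) + (\<Sum>j<N. cmod (l (1 + j) f)) + (\<Sum>j<N. cmod (l (1 + N + j) f))"
        by (simp only: sum_lessThan_add)
      also have "\<dots> = cmod (f (\<phi> 0)) + (\<Sum>k<N. cmod (m k f)) + (\<Sum>k<N. cmod (taylor_coeff k f))"
        by (simp add: l_def)
      finally have "K * (\<Sum>j<2 * N + 1. cmod (l j f)) =
          cmod (f (\<phi> 0)) * K + (\<Sum>k<N. cmod (m k f)) * K + (\<Sum>k<N. cmod (taylor_coeff k f)) * K"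
        by (simp add: algebra_simps)
      moreover have "cmod (f (\<phi> 0)) * e + (\<Sum>k<N. cmod (m k f)) * (eval_bound \<alpha> R / R ^ N) +
          (\<Sum>k<N. cmod (taylor_coeff k f)) * (K\<phi> * (A * C\<psi>)) \<le>
          cmod (f (\<phi> 0)) * K + (\<Sum>k<N. cmod (m k f)) * K + (\<Sum>k<N. cmod (taylor_coeff k f)) * K"
        using K by (intro add_mono mult_left_mono sum_nonneg) auto
      ultimately have le: "cmod (f (\<phi> 0)) * e + (\<Sum>k<N. cmod (m k f)) * (eval_bound \<alpha> R / R ^ N) +
          (\<Sum>k<N. cmod (taylor_coeff k f)) * (K\<phi> * (A * C\<psi>)) + C * \<rho> ^ N * nrm f \<le>
          K * (\<Sum>j<2 * N + 1. cmod (l j f)) + C * \<rho> ^ N * nrm f" by linarith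
      have Tf: "T f \<in> ?H" by (rule bounded_operator_mem[OF T f])
      have "nrm (T f) * nrm (T f) = cmod (dirichlet_ip \<alpha> (T f) (T f))"
        unfolding ip_self[OF Tf] norm_of_real by (simp add: power2_eq_square)
      also have "\<dots> \<le> (K * (\<Sum>j<2 * N + 1. cmod (l j f)) + C * \<rho> ^ N * nrm f) * nrm (T f)"
        using main[OF f Tf, of N] mult_right_mono[OF le nrm_nonneg[OF Tf]] by (rule order_trans)
      finally have *: "nrm (T f) * nrm (T f) \<le> (K * (\<Sum>j<2 * N + 1. cmod (l j f)) + C * \<rho> ^ N * nrm f) * nrm (T f)" .
      show ?thesis
      proof (cases "nrm (T f) = 0")
        case False
        then have "nrm (T f) > 0" using nrm_nonneg[OF Tf] by simp
        with * show ?thesis by (rule mult_right_le_imp_le)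
      next
        case True
        have "D \<ge> 0" using ev R by (simp add: D_def)
        then have "C \<ge> 0" using K\<phi>(1) K\<psi>(1) A C\<phi>(1) C\<psi>(1) by (simp add: C_def)
        then show ?thesis using True K(1) \<rho> nrm_nonneg[OF f] by (auto intro!: add_nonneg_nonneg mult_nonneg_nonneg sum_nonneg)
      qed
    qed
    then show ?thesis unfolding approximable_def using K(1) l_bounded by blast
  qed
  then show ?thesis unfolding T_def using \<rho> by blast
qed

section \<open>Common contact points destroy compactness\<close>

text \<open>
  The squared norm of \<open>1 / (z - p)\<^sup>n\<close> in the weighted Bergman space.
\<close>

definition pole_energy :: "real \<Rightarrow> nat \<Rightarrow> complex \<Rightarrow> real" where
  "pole_energy \<alpha> n p = (\<integral>z. (cmod (1 / (z - p) ^ n))\<^sup>2 \<partial>weighted_disk_area \<alpha>)"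

lemma cmod_pole_square: "(cmod (1 / (z - p) ^ n))\<^sup>2 = 1 / cmod (z - p) ^ (2 * n)"
  by (simp only: norm_divide norm_power norm_one power_divide power_one power_mult[symmetric] mult.commute)

lemma pole_holomorphic:
  "cmod p > 1 \<Longrightarrow> (\<lambda>z. 1 / (z - p) ^ n) holomorphic_on ball 0 1"
  by (intro holomorphic_intros) auto

lemma pole_measurable:
  "cmod p > 1 \<Longrightarrow> (\<lambda>z. 1 / (z - p) ^ n) \<in> borel_measurable (weighted_disk_area \<alpha>)"
  by (intro borel_measurable_weighted_disk_area_continuous holomorphic_on_imp_continuous_on pole_holomorphic)

lemma bounded_integrable_disk:
  fixes u :: "complex \<Rightarrow> real"
  assumes "\<alpha> > -1" "u \<in> borel_measurable (weighted_disk_area \<alpha>)" "\<And>z. cmod z < 1 \<Longrightarrow> \<bar>u z\<bar> \<le> B"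
  shows "integrable (weighted_disk_area \<alpha>) u"
proof -
  interpret finite_measure "weighted_disk_area \<alpha>" by (rule finite_measure_weighted_disk_area[OF assms(1)])
  show ?thesis by (rule integrable_const_bound[of _ B]) (use assms(2,3) in auto)
qed

lemma pole_integrable:
  assumes \<alpha>: "\<alpha> > -1" and p: "cmod p > 1"
  shows "integrable (weighted_disk_area \<alpha>) (\<lambda>z. (cmod (1 / (z - p) ^ n))\<^sup>2)"
proof (rule bounded_integrable_disk[OF \<alpha>])
  show "(\<lambda>z. (cmod (1 / (z - p) ^ n))\<^sup>2) \<in> borel_measurable (weighted_disk_area \<alpha>)"
    using pole_measurable[OF p] by measurable
  fix z :: complex assume z: "cmod z < 1"
  have "cmod p - 1 \<le> cmod (z - p)"
    using norm_triangle_ineq2[of p z] z by (simp add: norm_minus_commute)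
  then have "1 / cmod (z - p) ^ n \<le> 1 / (cmod p - 1) ^ n"
    using p by (intro divide_left_mono power_mono mult_pos_pos zero_less_power) auto
  then have "(1 / cmod (z - p) ^ n)\<^sup>2 \<le> (1 / (cmod p - 1) ^ n)\<^sup>2" by (intro power_mono) auto
  then show "\<bar>(cmod (1 / (z - p) ^ n))\<^sup>2\<bar> \<le> (1 / (cmod p - 1) ^ n)\<^sup>2"
    by (simp add: norm_divide norm_power)
qed

lemma pole_energy_nn:
  "\<alpha> > -1 \<Longrightarrow> cmod p > 1 \<Longrightarrow>
    (\<integral>\<^sup>+z. ennreal ((cmod (1 / (z - p) ^ n))\<^sup>2) \<partial>weighted_disk_area \<alpha>) = ennreal (pole_energy \<alpha> n p)"
  unfolding pole_energy_def by (intro nn_integral_eq_integral pole_integrable) auto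

lemma pole_energy_nonneg: "pole_energy \<alpha> n p \<ge> 0"
  unfolding pole_energy_def by (rule integral_nonneg_AE) simp

text \<open>
  A rotation is a self-map of the disk fixing the origin, so composing with it does not increase the
  energy.
\<close>

lemma pole_energy_rotate:
  assumes \<alpha>: "\<alpha> > -1" and q: "cmod q > 1" "cmod q' = cmod q"
  shows "pole_energy \<alpha> n q' \<le> pole_energy \<alpha> n q"
proof -
  define c where "c = q / q'"
  have q': "q' \<noteq> 0" "cmod q' > 1" using q by auto
  have c: "cmod c = 1" using q q' by (auto simp: c_def norm_divide)
  have "c * q' = q" using q' by (simp add: c_def)
  then have "c * z - q = c * (z - q')" for z by (simp add: right_diff_distrib)
  then have eq: "cmod (1 / (c * z - q) ^ n) = cmod (1 / (z - q') ^ n)" for z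
    using c by (simp add: norm_divide norm_power norm_mult)
  have "(\<integral>\<^sup>+z. ennreal ((cmod (1 / (c * z - q) ^ n))\<^sup>2) \<partial>weighted_disk_area \<alpha>) \<le>
      ennreal (moebius_bound \<alpha> (cmod (c * 0))) * (\<integral>\<^sup>+z. ennreal ((cmod (1 / (z - q) ^ n))\<^sup>2) \<partial>weighted_disk_area \<alpha>)"
    by (rule nn_integral_composition[OF \<alpha> pole_holomorphic[OF q(1)]])
      (use c in \<open>auto intro!: holomorphic_intros simp: norm_mult\<close>)
  then have "ennreal (pole_energy \<alpha> n q') \<le> ennreal (pole_energy \<alpha> n q)"
    unfolding eq pole_energy_nn[OF \<alpha> q'(2)] pole_energy_nn[OF \<alpha> q(1)] by (simp add: moebius_bound_def)
  then show ?thesis by (simp add: ennreal_le_iff pole_energy_nonneg)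
qed

text \<open>
  After a rotation both poles lie on the ray through \<open>\<zeta>\<close>, and on the disk
  \<open>cmod (z - p) \<le> (1 + 1/\<kappa>) cmod (z - q)\<close>, since the distance of the poles is at most \<open>1/\<kappa>\<close> times
  that of \<open>q\<close> from the disk.
\<close>

lemma pole_energy_compare:
  assumes \<alpha>: "\<alpha> > -1" and \<zeta>: "cmod \<zeta> = 1" and e: "e > 0" and \<kappa>: "0 < \<kappa>" "\<kappa> \<le> 1"
    and q: "cmod q \<ge> 1 + \<kappa> * e"
  shows "pole_energy \<alpha> n q \<le> (1 + 1 / \<kappa>) ^ (2 * n) * pole_energy \<alpha> n (\<zeta> * of_real (1 + e))"
proof -
  define p where "p = \<zeta> * of_real (1 + e)"
  define q' where "q' = \<zeta> * of_real (cmod q)"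
  have pos: "\<kappa> * e > 0" using e \<kappa> by simp
  have p1: "cmod p > 1" unfolding p_def norm_mult norm_of_real using \<zeta> e by simp
  have q1: "cmod q > 1" using q pos by linarith
  have q': "cmod q' = cmod q" unfolding q'_def norm_mult norm_of_real using \<zeta> by simp
  then have q'1: "cmod q' > 1" using q1 by simp
  have le: "(cmod (1 / (z - q') ^ n))\<^sup>2 \<le> (1 + 1 / \<kappa>) ^ (2 * n) * (cmod (1 / (z - p) ^ n))\<^sup>2" if z: "cmod z < 1" for z
  proof -
    have zq: "cmod q - 1 \<le> cmod (z - q')"
      using norm_triangle_ineq2[of q' z] z q' by (simp add: norm_minus_commute)
    then have zq0: "cmod (z - q') > 0" using q1 by linarith
    have zp0: "cmod (z - p) > 0" using z p1 by auto
    have "q' - p = \<zeta> * of_real (cmod q - (1 + e))" by (simp add: q'_def p_def algebra_simps)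
    then have qp: "cmod (q' - p) = \<bar>cmod q - (1 + e)\<bar>"
      unfolding norm_mult norm_of_real using \<zeta> by (simp only: norm_mult norm_of_real mult_1)
    have k1: "e \<le> 1 / \<kappa> * (cmod q - 1)"
      using q \<kappa> by (simp add: field_simps)
    have k2: "cmod q - 1 \<le> 1 / \<kappa> * (cmod q - 1)"
      using mult_right_mono[of 1 "1 / \<kappa>" "cmod q - 1"] q1 \<kappa> by simp
    have "cmod (q' - p) \<le> 1 / \<kappa> * (cmod q - 1)"
      unfolding qp using k1 k2 e q1 by (simp add: abs_le_iff)
    also have "\<dots> \<le> 1 / \<kappa> * cmod (z - q')"
      using zq \<kappa> by (intro mult_left_mono) auto
    finally have "cmod (q' - p) \<le> 1 / \<kappa> * cmod (z - q')" .
    moreover have "cmod (z - p) \<le> cmod (z - q') + cmod (q' - p)"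
      using norm_triangle_ineq[of "z - q'" "q' - p"] by simp
    ultimately have zp: "cmod (z - p) \<le> (1 + 1 / \<kappa>) * cmod (z - q')" by (simp add: algebra_simps)
    then have "cmod (z - p) ^ (2 * n) \<le> ((1 + 1 / \<kappa>) * cmod (z - q')) ^ (2 * n)"
      by (intro power_mono) auto
    then have "1 / cmod (z - q') ^ (2 * n) \<le> (1 + 1 / \<kappa>) ^ (2 * n) / cmod (z - p) ^ (2 * n)"
    proof -
      have "1 / Y \<le> K / X" if "X > 0" "Y > 0" "X \<le> K * Y" for X Y K :: real
        using that by (simp add: field_simps)
      from this[of "cmod (z - p) ^ (2 * n)" "cmod (z - q') ^ (2 * n)" "(1 + 1 / \<kappa>) ^ (2 * n)"]
      show ?thesis
        using zp0 zq0 \<open>cmod (z - p) ^ (2 * n) \<le> ((1 + 1 / \<kappa>) * cmod (z - q')) ^ (2 * n)\<close>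
        unfolding power_mult_distrib by (meson zero_less_power)
    qed
    then show ?thesis
      unfolding cmod_pole_square by simp
  qed
  have "pole_energy \<alpha> n q \<le> pole_energy \<alpha> n q'"
    by (rule pole_energy_rotate[OF \<alpha> q'1]) (simp add: q')
  also have "\<dots> \<le> (\<integral>z. (1 + 1 / \<kappa>) ^ (2 * n) * (cmod (1 / (z - p) ^ n))\<^sup>2 \<partial>weighted_disk_area \<alpha>)"
    unfolding pole_energy_def
    by (intro integral_mono_AE pole_integrable[OF \<alpha> q'1] integrable_mult_right pole_integrable[OF \<alpha> p1] AE_I2)
      (use le in auto)
  also have "\<dots> = (1 + 1 / \<kappa>) ^ (2 * n) * pole_energy \<alpha> n p"
    by (simp add: pole_energy_def)
  finally show ?thesis by (simp add: p_def)
qed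

text \<open>
  Let \<open>k\<close> be a natural number with \<open>k \<ge> \<alpha>\<close>. On the disk of radius \<open>e/2\<close> about \<open>\<zeta> (1 - e)\<close>, whose
  area is of order \<open>e\<^sup>2\<close>, the weight is at least of order \<open>e\<^sup>k\<close> and the integrand at least of order
  \<open>1 / e\<^sup>2\<^sup>n\<close>. The choice \<open>n = k + 2\<close> gives an energy of order at least \<open>1 / e\<^sup>n\<close>.
\<close>

lemma pole_energy_lower:
  assumes \<alpha>: "\<alpha> > -1"
  shows "\<exists>n\<ge>2. \<exists>C>0. \<forall>\<zeta> e. cmod \<zeta> = 1 \<longrightarrow> 0 < e \<longrightarrow> e \<le> 1 \<longrightarrow>
    C / e \<le> pole_energy \<alpha> n (\<zeta> * of_real (1 + e))"
proof -
  define k where "k = nat \<lceil>max \<alpha> 0\<rceil>"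
  define n where "n = k + 2"
  define C where "C = (1 + \<alpha>) / 4 / (2 ^ k * 3 ^ (2 * n))"
  have C: "C > 0" using \<alpha> by (simp add: C_def)
  have k: "\<alpha> \<le> real k" unfolding k_def by linarith
  have "C / e \<le> pole_energy \<alpha> n (\<zeta> * of_real (1 + e))" if \<zeta>: "cmod \<zeta> = 1" and e: "0 < e" "e \<le> 1" for \<zeta> e
  proof -
    define p where "p = \<zeta> * of_real (1 + e)"
    define x where "x = \<zeta> * of_real (1 - e)"
    have p1: "cmod p > 1" unfolding p_def norm_mult norm_of_real using \<zeta> e by simp
    have x: "cmod x = 1 - e" unfolding x_def norm_mult norm_of_real using \<zeta> e by simp
    have "x - p = \<zeta> * of_real (- (2 * e))" by (simp add: x_def p_def algebra_simps)
    then have xp: "cmod (x - p) = 2 * e" using \<zeta> e by (simp only: norm_mult norm_of_real)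
    define L where "L = (1 + \<alpha>) / pi * (e / 2) ^ k / (3 * e) ^ (2 * n)"
    have L0: "L \<ge> 0" using \<alpha> e by (simp add: L_def)
    have ball: "cmod z < 1" and L: "L \<le> disk_weight \<alpha> z * (cmod (1 / (z - p) ^ n))\<^sup>2" if "z \<in> ball x (e / 2)" for z
    proof -
      have d: "cmod (z - x) < e / 2" using that by (simp add: dist_norm norm_minus_commute)
      have zle: "cmod z \<le> 1 - e / 2"
        using norm_triangle_ineq[of x "z - x"] x d by simp
      then show z1: "cmod z < 1" using e by linarith
      have "cmod (z - p) \<le> 3 * e"
        using norm_triangle_ineq[of "z - x" "x - p"] xp d e by simp
      moreover have zp0: "cmod (z - p) > 0" using z1 p1 by auto
      ultimately have 1: "1 / (3 * e) ^ (2 * n) \<le> 1 / cmod (z - p) ^ (2 * n)"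
        using e by (intro divide_left_mono power_mono mult_pos_pos zero_less_power) auto
      define y where "y = 1 - (cmod z)\<^sup>2"
      have "(cmod z)\<^sup>2 \<le> cmod z * 1" unfolding power2_eq_square using z1 by (intro mult_left_mono) auto
      then have y: "e / 2 \<le> y" "y \<le> 1" using zle by (auto simp: y_def)
      have "(e / 2) ^ k \<le> y ^ k" using y e by (intro power_mono) auto
      also have "y ^ k = y powr real k" using y e by (intro powr_realpow[symmetric]) auto
      also have "\<dots> \<le> y powr \<alpha>" using y e k by (intro powr_mono') auto
      finally have "(1 + \<alpha>) / pi * (e / 2) ^ k \<le> disk_weight \<alpha> z"
        unfolding disk_weight_def y_def using \<alpha> by (intro mult_left_mono) auto
      then have "(1 + \<alpha>) / pi * (e / 2) ^ k * (1 / (3 * e) ^ (2 * n)) \<le> disk_weight \<alpha> z * (1 / cmod (z - p) ^ (2 * n))"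
        using 1 \<alpha> e by (intro mult_mono) (auto intro!: mult_nonneg_nonneg less_imp_le[OF disk_weight_pos[OF \<alpha> z1]])
      then show "L \<le> disk_weight \<alpha> z * (cmod (1 / (z - p) ^ n))\<^sup>2"
        unfolding cmod_pole_square L_def by simp
    qed
    have "ennreal (L * (pi * (e / 2)\<^sup>2)) = (\<integral>\<^sup>+z. ennreal L * indicator (ball x (e / 2)) z \<partial>lborel)"
      using e L0 by (simp add: nn_integral_cmult_indicator emeasure_plane_ball ennreal_mult)
    also have "\<dots> \<le> (\<integral>\<^sup>+z. indicator (ball 0 1) z * ennreal (disk_weight \<alpha> z) * ennreal ((cmod (1 / (z - p) ^ n))\<^sup>2) \<partial>lborel)"
    proof (rule nn_integral_mono)
      fix z :: complex
      show "ennreal L * indicator (ball x (e / 2)) z \<le>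
        indicator (ball 0 1) z * ennreal (disk_weight \<alpha> z) * ennreal ((cmod (1 / (z - p) ^ n))\<^sup>2)"
      proof (cases "z \<in> ball x (e / 2)")
        case True
        have "ennreal L \<le> ennreal (disk_weight \<alpha> z * (cmod (1 / (z - p) ^ n))\<^sup>2)"
          using L[OF True] by (rule ennreal_leI)
        also have "\<dots> = ennreal (disk_weight \<alpha> z) * ennreal ((cmod (1 / (z - p) ^ n))\<^sup>2)"
          by (rule ennreal_mult) (use disk_weight_pos[OF \<alpha> ball[OF True]] in auto)
        finally show ?thesis using True ball[OF True] by simp
      qed simp
    qed
    also have "\<dots> = ennreal (pole_energy \<alpha> n p)"
      unfolding pole_energy_nn[OF \<alpha> p1, symmetric]
      by (rule nn_integral_weighted_disk_area[OF \<alpha>, symmetric])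
        (rule measurable_compose[OF _ measurable_ennreal], use pole_measurable[OF p1] in measurable)
    finally have le: "L * (pi * (e / 2)\<^sup>2) \<le> pole_energy \<alpha> n p"
      by (simp add: ennreal_le_iff pole_energy_nonneg)
    have "C / e \<le> C / e ^ n"
      using C e power_decreasing[of 1 n e] by (intro divide_left_mono) (auto simp: n_def)
    also have "\<dots> = L * (pi * (e / 2)\<^sup>2)"
    proof -
      have "2 * n = k + 2 + n" by (simp add: n_def)
      then have "e ^ (2 * n) = e ^ k * e ^ 2 * e ^ n" by (simp only: power_add)
      then have "e ^ k * e\<^sup>2 / e ^ (2 * n) = 1 / e ^ n" using e by simp
      moreover have "L * (pi * (e / 2)\<^sup>2) = C * (e ^ k * e\<^sup>2 / e ^ (2 * n))"
        unfolding L_def C_def power_mult_distrib power_divide by simp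
      ultimately show ?thesis by simp
    qed
    finally show ?thesis using le by (simp add: p_def)
  qed
  then show ?thesis using C by (intro exI[of _ n] conjI exI[of _ C]) (auto simp: n_def)
qed

text \<open>
  The Moebius map \<open>\<sigma>\<close> that takes \<open>0\<close> to \<open>a = \<phi> 0\<close> satisfies \<open>\<phi> = \<sigma> \<circ> \<tau>\<close> with \<open>cmod (\<tau> z) \<le> cmod z\<close>, and
  it multiplies \<open>1 - (cmod w)\<^sup>2\<close> by at least \<open>(1 - (cmod a)\<^sup>2) / 4\<close>.
\<close>

lemma schwarz_pick_defect:
  assumes \<phi>: "\<phi> holomorphic_on ball 0 1" "\<And>w. cmod w < 1 \<Longrightarrow> cmod (\<phi> w) < 1" and z: "cmod z < 1"
  shows "(1 - (cmod (\<phi> 0))\<^sup>2) / 4 * (1 - (cmod z)\<^sup>2) \<le> 1 - (cmod (\<phi> z))\<^sup>2"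
proof -
  define a where "a = \<phi> 0"
  have a: "cmod a < 1" using \<phi>(2)[of 0] by (simp add: a_def)
  define \<tau> where "\<tau> z = Moebius_function 0 a (\<phi> z)" for z
  have \<tau>: "\<tau> holomorphic_on ball 0 1"
    unfolding \<tau>_def
    by (rule holomorphic_on_compose_gen[OF \<phi>(1) Moebius_function_holomorphic[OF a], unfolded o_def])
      (use \<phi>(2) in auto)
  have \<tau>0: "\<tau> 0 = 0" by (simp add: \<tau>_def a_def Moebius_function_eq_zero)
  have \<tau>1: "cmod (\<tau> w) < 1" if "cmod w < 1" for w
    unfolding \<tau>_def by (rule Moebius_function_norm_lt_1[OF a \<phi>(2)[OF that]])
  have \<tau>z: "cmod (\<tau> z) \<le> cmod z" by (rule Schwarz_Lemma(1)[OF \<tau> \<tau>0 \<tau>1 z])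
  have "Moebius_function 0 (- a) (\<tau> z) = \<phi> z"
    unfolding \<tau>_def by (rule Moebius_function_compose) (use a \<phi>(2)[OF z] in auto)
  then have eq: "1 - (cmod (\<phi> z))\<^sup>2 =
      (1 - (cmod a)\<^sup>2) / (cmod (1 - cnj (- a) * \<tau> z))\<^sup>2 * (1 - (cmod (\<tau> z))\<^sup>2)"
    using moebius_facts(1)[of "- a" "\<tau> z"] a \<tau>1[OF z] by simp
  have a2: "(cmod a)\<^sup>2 < 1" using a by (simp add: abs_square_less_1)
  have "cmod (1 - cnj (- a) * \<tau> z) \<le> 2"
  proof -
    have "cmod (cnj (- a) * \<tau> z) \<le> 1" unfolding norm_mult using a \<tau>1[OF z] by (simp add: mult_le_one)
    then show ?thesis using norm_triangle_ineq4[of 1 "cnj (- a) * \<tau> z"] by simp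
  qed
  then have "(cmod (1 - cnj (- a) * \<tau> z))\<^sup>2 \<le> 2\<^sup>2" by (intro power_mono) auto
  moreover have "0 < cmod (1 - cnj (- a) * \<tau> z)"
  proof -
    have "1 - cmod (- a) \<le> cmod (1 - cnj (- a) * \<tau> z)"
      by (rule moebius_facts(3)) (use a \<tau>1[OF z] in auto)
    then show ?thesis using a unfolding norm_minus_cancel by linarith
  qed
  ultimately have "(1 - (cmod a)\<^sup>2) / 4 \<le> (1 - (cmod a)\<^sup>2) / (cmod (1 - cnj (- a) * \<tau> z))\<^sup>2"
    using a2 by (intro divide_left_mono) auto
  moreover have "1 - (cmod z)\<^sup>2 \<le> 1 - (cmod (\<tau> z))\<^sup>2" using \<tau>z by (simp add: power_mono)
  moreover have "(cmod z)\<^sup>2 < 1" using z by (simp add: abs_square_less_1)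
  ultimately show ?thesis
    unfolding eq a_def[symmetric] using a2 by (intro mult_mono) auto
qed

text \<open>
  Along the ray through the contact point the Hermitian form
  \<open>Q z = (cmod (a z + b))\<^sup>2 - (cmod (c z + d))\<^sup>2\<close> is a quadratic polynomial in \<open>t\<close> that vanishes at \<open>t = 1\<close>.
  The Schwarz-Pick estimate inside the disk bounds its slope there from below by a positive constant,
  so beyond the circle \<open>Q\<close> is positive and at least of order \<open>e\<close>, which is the assertion about \<open>\<phi>\<close>.
\<close>

lemma contact_pole_distance:
  fixes a b c d \<zeta> :: complex
  assumes hol: "\<phi> holomorphic_on ball 0 1" and less: "\<And>w. cmod w < 1 \<Longrightarrow> cmod (\<phi> w) < 1"
    and \<phi>: "\<phi> = (\<lambda>z. (a * z + b) / (c * z + d))"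
    and m0: "m0 > 0" "\<And>z. cmod z \<le> 1 \<Longrightarrow> m0 \<le> cmod (c * z + d)"
    and \<zeta>: "cmod \<zeta> = 1" "cmod (\<phi> \<zeta>) = 1"
  obtains e0 \<kappa> where "0 < e0" "e0 \<le> 1" "0 < \<kappa>" "\<kappa> \<le> 1"
    "\<And>e. 0 < e \<Longrightarrow> e < e0 \<Longrightarrow> m0 / 2 \<le> cmod (c * (\<zeta> * of_real (1 + e)) + d)"
    "\<And>e. 0 < e \<Longrightarrow> e < e0 \<Longrightarrow> 1 + \<kappa> * e \<le> cmod (\<phi> (\<zeta> * of_real (1 + e)))"
proof -
  define A where "A = (cmod a)\<^sup>2 - (cmod c)\<^sup>2"
  define C where "C = (cmod b)\<^sup>2 - (cmod d)\<^sup>2"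
  define Q where "Q z = (cmod (a * z + b))\<^sup>2 - (cmod (c * z + d))\<^sup>2" for z
  have Q_eq: "Q z = (cmod (c * z + d))\<^sup>2 * ((cmod (\<phi> z))\<^sup>2 - 1)" if "c * z + d \<noteq> 0" for z
    using that by (simp add: Q_def \<phi> norm_divide power_divide field_simps)
  define B where "B = 2 * Re ((a * cnj b - c * cnj d) * \<zeta>)"
  have sq: "(cmod (x * (\<zeta> * of_real t) + y))\<^sup>2 = (cmod x)\<^sup>2 * t\<^sup>2 + 2 * t * Re (x * cnj y * \<zeta>) + (cmod y)\<^sup>2" for x y t
  proof -
    have "(cmod (u + y))\<^sup>2 = (cmod u)\<^sup>2 + 2 * Re (u * cnj y) + (cmod y)\<^sup>2" for u
      unfolding cmod_power2 by (simp add: power2_eq_square algebra_simps)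
    from this[of "x * (\<zeta> * of_real t)"] show ?thesis
      using \<zeta>(1) by (simp add: norm_mult power_mult_distrib algebra_simps)
  qed
  have Q_poly: "Q (\<zeta> * of_real t) = A * t\<^sup>2 + B * t + C" for t
    unfolding Q_def sq by (simp add: A_def B_def C_def algebra_simps)
  have "Q \<zeta> = 0" using Q_eq[of \<zeta>] m0(2)[of \<zeta>] m0(1) \<zeta> by force
  then have "A + B + C = 0" using Q_poly[of 1] by simp
  then have B_eq: "B = - A - C" by simp
  have Q_fact: "Q (\<zeta> * of_real t) = (t - 1) * (A * t - C)" for t
    unfolding Q_poly B_eq by (simp add: power2_eq_square algebra_simps)
  define \<kappa>2 where "\<kappa>2 = m0\<^sup>2 * ((1 - (cmod (\<phi> 0))\<^sup>2) / 4)"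
  have \<phi>0: "(cmod (\<phi> 0))\<^sup>2 < 1" using less[of 0] by (simp add: abs_square_less_1)
  have \<kappa>2: "\<kappa>2 > 0" using m0 \<phi>0 by (simp add: \<kappa>2_def)
  have slope: "\<kappa>2 \<le> A * t - C" if t: "0 \<le> t" "t < 1" for t
  proof -
    define z where "z = \<zeta> * of_real t"
    have cz: "cmod z = t" unfolding z_def norm_mult norm_of_real using \<zeta> t by simp
    have nz: "m0 \<le> cmod (c * z + d)" using m0(2) cz t by simp
    then have nz0: "c * z + d \<noteq> 0" using m0(1) by auto
    have def: "(1 - (cmod (\<phi> 0))\<^sup>2) / 4 * (1 - t\<^sup>2) \<le> 1 - (cmod (\<phi> z))\<^sup>2"
      using schwarz_pick_defect[OF hol less, of z] cz t by simp
    have t2: "1 - t \<le> 1 - t\<^sup>2" using t by (simp add: power2_eq_square mult_left_le)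
    have "\<kappa>2 * (1 - t) \<le> \<kappa>2 * (1 - t\<^sup>2)" using t2 \<kappa>2 by (intro mult_left_mono) auto
    also have "\<dots> = m0\<^sup>2 * ((1 - (cmod (\<phi> 0))\<^sup>2) / 4 * (1 - t\<^sup>2))" by (simp add: \<kappa>2_def)
    also have "\<dots> \<le> (cmod (c * z + d))\<^sup>2 * (1 - (cmod (\<phi> z))\<^sup>2)"
      using nz m0(1) def t2 t \<phi>0 by (intro mult_mono power_mono) (auto intro!: mult_nonneg_nonneg)
    also have "\<dots> = - Q z" using Q_eq[OF nz0] by (simp add: algebra_simps)
    also have "\<dots> = (A * t - C) * (1 - t)" unfolding z_def Q_fact by (simp add: algebra_simps)
    finally show ?thesis by (rule mult_right_le_imp_le) (use t in simp)
  qed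
  have AC: "\<kappa>2 \<le> A - C"
  proof (rule field_le_epsilon)
    fix \<delta> :: real assume \<delta>: "\<delta> > 0"
    define s where "s = min (1/2) (\<delta> / (\<bar>A\<bar> + 1))"
    have s: "0 < s" "s \<le> 1/2" "s \<le> \<delta> / (\<bar>A\<bar> + 1)"
      using \<delta> unfolding s_def by (simp_all only: min.cobounded1 min.cobounded2) (simp add: add_nonneg_pos)
    have "s * \<bar>A\<bar> \<le> s * (\<bar>A\<bar> + 1)" using s by (intro mult_left_mono) auto
    also have "\<dots> \<le> \<delta>" using s(3) by (simp add: field_simps)
    finally have "- (A * s) \<le> \<delta>" by (metis abs_ge_minus_self abs_mult abs_of_pos mult.commute order_trans s(1))
    moreover have "\<kappa>2 \<le> A * (1 - s) - C" using s by (intro slope) auto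
    ultimately show "\<kappa>2 \<le> A - C + \<delta>" by (simp add: algebra_simps)
  qed
  define M where "M = 2 * cmod c + cmod d + 1"
  have M: "M > 0" by (simp add: M_def add_nonneg_pos)
  define \<eta> where "\<eta> = \<kappa>2 / (2 * M\<^sup>2)"
  have \<eta>: "\<eta> > 0" using \<kappa>2 M by (simp add: \<eta>_def)
  define \<kappa> where "\<kappa> = min 1 (\<eta> / 3)"
  have \<kappa>: "0 < \<kappa>" "\<kappa> \<le> 1" "3 * \<kappa> \<le> \<eta>" using \<eta> by (auto simp: \<kappa>_def)
  \<comment> \<open>the second bound keeps the denominator away from \<open>0\<close>, the third one keeps the slope of \<open>Q\<close> above \<open>\<kappa>2 / 2\<close>\<close>
  define e0 where "e0 = min 1 (min (m0 / (2 * (cmod c + 1))) (\<kappa>2 / (2 * (\<bar>A\<bar> + 1))))"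
  have c1: "cmod c + 1 > 0" "\<bar>A\<bar> + 1 > 0" by (auto simp: add_nonneg_pos)
  have e0: "0 < e0" "e0 \<le> 1" "e0 \<le> m0 / (2 * (cmod c + 1))" "e0 \<le> \<kappa>2 / (2 * (\<bar>A\<bar> + 1))"
    using m0 \<kappa>2 c1 by (auto simp: e0_def)
  have lower: "m0 / 2 \<le> cmod (c * (\<zeta> * of_real (1 + e)) + d)" if e: "0 < e" "e < e0" for e
  proof -
    have "e * cmod c \<le> e * (cmod c + 1)" using e by (intro mult_left_mono) auto
    also have "\<dots> \<le> m0 / (2 * (cmod c + 1)) * (cmod c + 1)" using e e0(3) c1 by (intro mult_right_mono) auto
    also have "\<dots> = m0 / 2" using c1 by (simp add: field_simps)
    finally have "e * cmod c \<le> m0 / 2" .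
    moreover have "cmod (c * \<zeta> * complex_of_real e) = e * cmod c" using e \<zeta> by (simp add: norm_mult)
    moreover have "m0 \<le> cmod (c * \<zeta> + d)" using m0(2)[of \<zeta>] \<zeta> by simp
    moreover have eq: "c * (\<zeta> * of_real (1 + e)) + d = (c * \<zeta> + d) - (- (c * \<zeta> * of_real e))"
      by (simp add: algebra_simps)
    ultimately show ?thesis
      unfolding eq using norm_triangle_ineq2[of "c * \<zeta> + d" "- (c * \<zeta> * of_real e)"]
      unfolding norm_minus_cancel by linarith
  qed
  have dist: "1 + \<kappa> * e \<le> cmod (\<phi> (\<zeta> * of_real (1 + e)))" if e: "0 < e" "e < e0" for e
  proof -
    define p where "p = \<zeta> * of_real (1 + e)"
    have cp: "cmod p = 1 + e" unfolding p_def norm_mult norm_of_real using \<zeta> e by simp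
    have nz: "m0 / 2 \<le> cmod (c * p + d)" unfolding p_def by (rule lower[OF e])
    then have nz0: "c * p + d \<noteq> 0" using m0(1) by auto
    have "cmod (c * p + d) \<le> cmod c * (1 + e) + cmod d"
      using norm_triangle_ineq[of "c * p" d] cp by (simp add: norm_mult)
    also have "\<dots> \<le> M"
    proof -
      have "cmod c * (1 + e) \<le> cmod c * 2" using e e0(2) by (intro mult_left_mono) auto
      then show ?thesis by (simp add: M_def)
    qed
    finally have le_M: "(cmod (c * p + d))\<^sup>2 \<le> M\<^sup>2" by (intro power_mono) auto
    have "e * \<bar>A\<bar> \<le> e * (\<bar>A\<bar> + 1)" using e by (intro mult_left_mono) auto
    also have "\<dots> \<le> \<kappa>2 / (2 * (\<bar>A\<bar> + 1)) * (\<bar>A\<bar> + 1)" using e e0(4) c1 by (intro mult_right_mono) auto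
    also have "\<dots> = \<kappa>2 / 2" using c1 by (simp add: field_simps)
    finally have "- (A * e) \<le> \<kappa>2 / 2"
      by (metis abs_ge_minus_self abs_mult abs_of_pos mult.commute order_trans e(1))
    then have "\<kappa>2 / 2 \<le> A * (1 + e) - C" using AC by (simp add: algebra_simps)
    then have "e * (\<kappa>2 / 2) \<le> e * (A * (1 + e) - C)" using e by (intro mult_left_mono) auto
    also have "\<dots> = (cmod (c * p + d))\<^sup>2 * ((cmod (\<phi> p))\<^sup>2 - 1)"
      using Q_fact[of "1 + e"] Q_eq[OF nz0] by (simp add: p_def)
    finally have prod: "e * (\<kappa>2 / 2) \<le> (cmod (c * p + d))\<^sup>2 * ((cmod (\<phi> p))\<^sup>2 - 1)" .
    have pos: "0 < e * (\<kappa>2 / 2)" using e \<kappa>2 by simp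
    have cpos: "0 < (cmod (c * p + d))\<^sup>2" using nz0 by simp
    have "0 < (cmod (\<phi> p))\<^sup>2 - 1"
      using less_le_trans[OF pos prod] cpos by (simp add: zero_less_mult_iff)
    then have "(cmod (c * p + d))\<^sup>2 * ((cmod (\<phi> p))\<^sup>2 - 1) \<le> M\<^sup>2 * ((cmod (\<phi> p))\<^sup>2 - 1)"
      using le_M by (intro mult_right_mono) auto
    then have "e * (\<kappa>2 / 2) \<le> M\<^sup>2 * ((cmod (\<phi> p))\<^sup>2 - 1)" using prod by linarith
    then have "\<eta> * e \<le> (cmod (\<phi> p))\<^sup>2 - 1"
      using M by (simp add: \<eta>_def field_simps)
    moreover have "(1 + \<kappa> * e)\<^sup>2 \<le> 1 + \<eta> * e"
    proof -
      have "\<kappa> * e \<le> 1 * 1" using \<kappa> e e0(2) by (intro mult_mono) auto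
      then have "(\<kappa> * e) * (\<kappa> * e) \<le> 1 * (\<kappa> * e)" using \<kappa> e by (intro mult_right_mono) auto
      moreover have "3 * \<kappa> * e \<le> \<eta> * e" using \<kappa>(3) e by (intro mult_right_mono) auto
      ultimately show ?thesis by (simp add: power2_eq_square algebra_simps)
    qed
    ultimately have "(1 + \<kappa> * e)\<^sup>2 \<le> (cmod (\<phi> p))\<^sup>2" by linarith
    then show ?thesis unfolding p_def by (rule power2_le_imp_le) simp
  qed
  show thesis using that[OF e0(1,2) \<kappa>(1,2) lower dist] .
qed

text \<open>
  The function is \<open>u\<^sup>m\<close> for \<open>u w = (a - c w) (a - c q) / (\<Delta> (w - q))\<close> with \<open>q = \<phi> p\<close>. As \<open>\<phi>\<close> is
  linear fractional, \<open>u (\<phi> z) = 1 / (z - p)\<close> for the pole \<open>p = \<zeta> (1 + e)\<close>, and the numerators in \<open>u\<close> and in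
  \<open>deriv u\<close> are bounded independently of \<open>e\<close>.
\<close>

lemma pole_pullback:
  assumes lf: "linear_fractional_self_map \<phi>" and \<zeta>: "cmod \<zeta> = 1" "cmod (\<phi> \<zeta>) = 1"
  obtains e0 \<kappa> B where "0 < e0" "e0 \<le> 1" "0 < \<kappa>" "\<kappa> \<le> 1" "0 \<le> B"
    "\<And>e. 0 < e \<Longrightarrow> e < e0 \<Longrightarrow> \<exists>q F. 1 + \<kappa> * e \<le> cmod q \<and> F holomorphic_on ball 0 1 \<and>
      (\<forall>z. cmod z < 1 \<longrightarrow> F (\<phi> z) = 1 / (z - \<zeta> * of_real (1 + e)) ^ m) \<and>
      (\<forall>w. cmod w < 1 \<longrightarrow> cmod (F w) \<le> B / cmod (w - q) ^ m \<and>
        cmod (deriv F w) \<le> B / cmod (w - q) ^ Suc m)"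
proof -
  obtain a b c d where *: "a * d - b * c \<noteq> 0" "\<phi> = (\<lambda>z. (a * z + b) / (c * z + d))"
    "\<And>z. cmod z \<le> 1 \<Longrightarrow> c * z + d \<noteq> 0" "\<And>z. cmod z < 1 \<Longrightarrow> cmod (\<phi> z) < 1"
    by (rule linear_fractional_self_mapE[OF lf]) blast
  have "\<exists>x\<in>cball (0::complex) 1. \<forall>z\<in>cball 0 1. cmod (c * x + d) \<le> cmod (c * z + d)"
    by (intro continuous_attains_inf continuous_intros) auto
  then obtain x where x: "cmod x \<le> 1" "\<And>z. cmod z \<le> 1 \<Longrightarrow> cmod (c * x + d) \<le> cmod (c * z + d)" by auto
  define m0 where "m0 = cmod (c * x + d)"
  have m0: "m0 > 0" "\<And>z. cmod z \<le> 1 \<Longrightarrow> m0 \<le> cmod (c * z + d)"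
    using *(3)[OF x(1)] x(2) by (auto simp: m0_def)
  obtain e0 \<kappa> where e0: "0 < e0" "e0 \<le> 1" and \<kappa>: "0 < \<kappa>" "\<kappa> \<le> 1"
    and lower: "\<And>e. 0 < e \<Longrightarrow> e < e0 \<Longrightarrow> m0 / 2 \<le> cmod (c * (\<zeta> * of_real (1 + e)) + d)"
    and dist: "\<And>e. 0 < e \<Longrightarrow> e < e0 \<Longrightarrow> 1 + \<kappa> * e \<le> cmod (\<phi> (\<zeta> * of_real (1 + e)))"
    using contact_pole_distance[OF linear_fractional_holomorphic[OF lf] *(4) *(2) m0 \<zeta>] by blast
  define \<Delta> where "\<Delta> = a * d - b * c"
  have \<Delta>: "\<Delta> \<noteq> 0" using *(1) by (simp add: \<Delta>_def)
  define B1 where "B1 = (cmod a + cmod c) * (2 / m0)"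
  define B2 where "B2 = cmod \<Delta> * (2 / m0)\<^sup>2"
  have B12: "B1 \<ge> 0" "B2 \<ge> 0" using m0(1) by (auto simp: B1_def B2_def)
  define B where "B = B1 ^ m + real m * B1 ^ (m - 1) * B2"
  have B: "B \<ge> 0" "B1 ^ m \<le> B" "real m * B1 ^ (m - 1) * B2 \<le> B" using B12 by (auto simp: B_def)
  have main: "\<exists>q F. 1 + \<kappa> * e \<le> cmod q \<and> F holomorphic_on ball 0 1 \<and>
      (\<forall>z. cmod z < 1 \<longrightarrow> F (\<phi> z) = 1 / (z - \<zeta> * of_real (1 + e)) ^ m) \<and>
      (\<forall>w. cmod w < 1 \<longrightarrow> cmod (F w) \<le> B / cmod (w - q) ^ m \<and>
        cmod (deriv F w) \<le> B / cmod (w - q) ^ Suc m)" if e: "0 < e" "e < e0" for e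
  proof -
    define p where "p = \<zeta> * complex_of_real (1 + e)"
    define q where "q = \<phi> p"
    have cp: "m0 / 2 \<le> cmod (c * p + d)" unfolding p_def by (rule lower[OF e])
    then have cp0: "c * p + d \<noteq> 0" using m0(1) by auto
    have q1: "1 + \<kappa> * e \<le> cmod q" unfolding q_def p_def by (rule dist[OF e])
    then have q: "cmod q > 1" using \<kappa> e mult_pos_pos[of \<kappa> e] by linarith
    have wq: "w - q \<noteq> 0" if "cmod w < 1" for w using q that by auto
    have aq: "a - c * q = \<Delta> / (c * p + d)"
      using cp0 by (simp add: q_def *(2) \<Delta>_def field_simps)
    have aq_le: "cmod (a - c * q) \<le> cmod \<Delta> * (2 / m0)"
    proof -
      have "cmod \<Delta> / cmod (c * p + d) \<le> cmod \<Delta> / (m0 / 2)"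
        using cp m0(1) cp0 by (intro divide_left_mono) auto
      then show ?thesis by (simp add: aq norm_divide)
    qed
    define u where "u w = (a - c * w) * (a - c * q) / (\<Delta> * (w - q))" for w
    have u_der: "(u has_field_derivative - ((a - c * q)\<^sup>2 / (\<Delta> * (w - q)\<^sup>2))) (at w)" if "cmod w < 1" for w
    proof -
      have "((\<lambda>w. (a - c * w) / (w - q)) has_field_derivative
          (- c * (w - q) - (a - c * w) * 1) / ((w - q) * (w - q))) (at w)"
        using wq[OF that] by (auto intro!: derivative_eq_intros)
      moreover have "- c * (w - q) - (a - c * w) * 1 = - (a - c * q)" by (simp add: algebra_simps)
      ultimately have "((\<lambda>w. (a - c * w) / (w - q)) has_field_derivative
          - (a - c * q) / ((w - q) * (w - q))) (at w)" by (simp only:)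
      from DERIV_cmult[OF this, of "(a - c * q) / \<Delta>"]
      have "(u has_field_derivative (a - c * q) / \<Delta> * (- (a - c * q) / ((w - q) * (w - q)))) (at w)"
        by (simp only: u_def[abs_def] times_divide_times_eq mult.commute)
      moreover have "x / \<Delta> * (- x / (y * y)) = - (x\<^sup>2 / (\<Delta> * y\<^sup>2))" for x y
        by (simp add: power2_eq_square)
      ultimately show ?thesis by (simp only:)
    qed
    have u_le: "cmod (u w) \<le> B1 / cmod (w - q)" if w: "cmod w < 1" for w
    proof -
      have "cmod (a - c * w) \<le> cmod a + cmod c"
        using norm_triangle_ineq4[of a "c * w"] mult_left_mono[of "cmod w" 1 "cmod c"] w by (simp add: norm_mult)
      then have "cmod (a - c * w) * cmod (a - c * q) \<le> (cmod a + cmod c) * (cmod \<Delta> * (2 / m0))"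
        using aq_le by (intro mult_mono) auto
      then have "cmod (a - c * w) * cmod (a - c * q) / (cmod \<Delta> * cmod (w - q)) \<le>
          (cmod a + cmod c) * (cmod \<Delta> * (2 / m0)) / (cmod \<Delta> * cmod (w - q))"
        by (intro divide_right_mono) auto
      also have "\<dots> = B1 / cmod (w - q)" using \<Delta> by (simp add: B1_def)
      finally show ?thesis by (simp add: u_def norm_mult norm_divide)
    qed
    have u'_le: "cmod (- ((a - c * q)\<^sup>2 / (\<Delta> * (w - q)\<^sup>2))) \<le> B2 / (cmod (w - q))\<^sup>2" for w
    proof -
      have "(cmod (a - c * q))\<^sup>2 \<le> (cmod \<Delta> * (2 / m0))\<^sup>2" using aq_le by (intro power_mono) auto
      then have "(cmod (a - c * q))\<^sup>2 / (cmod \<Delta> * (cmod (w - q))\<^sup>2) \<le>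
          (cmod \<Delta> * (2 / m0))\<^sup>2 / (cmod \<Delta> * (cmod (w - q))\<^sup>2)"
        by (intro divide_right_mono) auto
      also have "\<dots> = B2 / (cmod (w - q))\<^sup>2" using \<Delta> by (simp add: B2_def power2_eq_square mult_ac)
      finally show ?thesis by (simp add: norm_mult norm_divide norm_power)
    qed
    define F where "F w = u w ^ m" for w
    have F_der: "(F has_field_derivative of_nat m * u w ^ (m - 1) * - ((a - c * q)\<^sup>2 / (\<Delta> * (w - q)\<^sup>2))) (at w)"
      if "cmod w < 1" for w
      unfolding F_def using DERIV_power[OF u_der[OF that], of m] by (simp add: mult_ac)
    have "F holomorphic_on ball 0 1"
      unfolding F_def u_def using wq \<Delta> by (intro holomorphic_intros) auto
    moreover have "F (\<phi> z) = 1 / (z - p) ^ m" if z: "cmod z < 1" for z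
    proof -
      have cz: "c * z + d \<noteq> 0" using *(3)[of z] z by simp
      have p1: "cmod p > 1" unfolding p_def norm_mult norm_of_real using \<zeta> e by simp
      have zp: "z - p \<noteq> 0" using z p1 by auto
      have az: "a - c * \<phi> z = \<Delta> / (c * z + d)" using cz by (simp add: *(2) \<Delta>_def field_simps)
      have zq: "\<phi> z - q = \<Delta> * (z - p) / ((c * z + d) * (c * p + d))"
      proof -
        have "\<phi> z - q = ((a * z + b) * (c * p + d) - (a * p + b) * (c * z + d)) / ((c * z + d) * (c * p + d))"
          unfolding q_def *(2) using cz cp0 by (simp add: diff_frac_eq)
        also have "(a * z + b) * (c * p + d) - (a * p + b) * (c * z + d) = \<Delta> * (z - p)"
          by (simp add: \<Delta>_def algebra_simps)
        finally show ?thesis .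
      qed
      have "u (\<phi> z) = 1 / (z - p)"
      proof -
        have "D / X * (D / Y) / (D * (D * Z / (X * Y))) = 1 / Z"
          if "D \<noteq> 0" "X \<noteq> 0" "Y \<noteq> 0" "Z \<noteq> 0" for D X Y Z :: complex
          using that by simp
        from this[OF \<Delta> cz cp0 zp] show ?thesis unfolding u_def az aq zq .
      qed
      then show ?thesis by (simp add: F_def power_one_over)
    qed
    moreover have "cmod (F w) \<le> B / cmod (w - q) ^ m" if w: "cmod w < 1" for w
    proof -
      have "cmod (F w) \<le> (B1 / cmod (w - q)) ^ m"
        unfolding F_def norm_power using u_le[OF w] by (intro power_mono) auto
      also have "\<dots> \<le> B / cmod (w - q) ^ m"
        unfolding power_divide using B(2) by (intro divide_right_mono) auto
      finally show ?thesis .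
    qed
    moreover have "cmod (deriv F w) \<le> B / cmod (w - q) ^ Suc m" if w: "cmod w < 1" for w
    proof (cases "m = 0")
      case True
      then have "deriv F w = 0" using DERIV_imp_deriv[OF F_der[OF w]] by simp
      then show ?thesis using B(1) by simp
    next
      case False
      have "cmod (deriv F w) = real m * cmod (u w) ^ (m - 1) * cmod (- ((a - c * q)\<^sup>2 / (\<Delta> * (w - q)\<^sup>2)))"
        unfolding DERIV_imp_deriv[OF F_der[OF w]] norm_mult norm_power norm_of_nat ..
      also have "\<dots> \<le> real m * (B1 / cmod (w - q)) ^ (m - 1) * (B2 / (cmod (w - q))\<^sup>2)"
        using u_le[OF w] u'_le[of w] B12 by (intro mult_mono mult_left_mono power_mono) auto
      also have "\<dots> = real m * B1 ^ (m - 1) * B2 / cmod (w - q) ^ Suc m"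
      proof -
        have "Suc m = (m - 1) + 2" using False by simp
        then show ?thesis by (simp only: power_add power_divide times_divide_eq_left times_divide_eq_right
            divide_divide_eq_left mult_ac)
      qed
      also have "\<dots> \<le> B / cmod (w - q) ^ Suc m" using B(3) by (intro divide_right_mono) auto
      finally show ?thesis .
    qed
    ultimately show ?thesis using q1 unfolding p_def by blast
  qed
  show thesis using that[OF e0 \<kappa> B(1) main] .
qed


text \<open>
  For \<open>\<eta> > 0\<close>, the integral of \<open>cmod g' cmod (G i)'\<close> over the set where \<open>cmod (G i)' \<le> \<eta> cmod g'\<close> is at
  most \<open>\<eta>\<close> times the energy of \<open>g\<close>. On the remaining set the Cauchy-Schwarz inequality applies, and
  the energy of \<open>g\<close> on that set tends to \<open>0\<close> by dominated convergence.
\<close>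

lemma dirichlet_weak_null:
  assumes \<alpha>: "\<alpha> > -1" and g: "g \<in> dirichlet_space \<alpha>"
    and G: "\<And>i. G i \<in> dirichlet_space \<alpha>" "\<And>i. ip_norm (dirichlet_ip \<alpha>) (G i) \<le> N"
    and lim: "\<And>w. cmod w < 1 \<Longrightarrow> (\<lambda>i::nat. deriv (G i) w) \<longlonglongrightarrow> 0" and lim0: "(\<lambda>i. G i 0) \<longlonglongrightarrow> 0"
  shows "(\<lambda>i. dirichlet_ip \<alpha> g (G i)) \<longlonglongrightarrow> 0"
proof (rule tendstoI)
  let ?M = "weighted_disk_area \<alpha>"
  fix e :: real assume e: "e > 0"
  define E where "E = (\<integral>z. (cmod (deriv g z))\<^sup>2 \<partial>?M)"
  have E: "E \<ge> 0" unfolding E_def by (rule integral_nonneg_AE) simp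
  have N: "N \<ge> 0" using G(2)[of 0] dirichlet_norm_nonneg order_trans by blast
  define \<eta> where "\<eta> = e / (2 * (E + 1))"
  have \<eta>: "\<eta> > 0" using e E by (simp add: \<eta>_def)
  have \<eta>E: "\<eta> * E < e / 2" using e E by (simp add: \<eta>_def field_simps)
  have gm: "deriv g \<in> borel_measurable ?M" and Gm: "deriv (G i) \<in> borel_measurable ?M" for i
    using measurable_deriv_disk dirichlet_spaceD(1) g G(1) by blast+
  have gi: "integrable ?M (\<lambda>z. (cmod (deriv g z))\<^sup>2)" by (rule dirichlet_spaceD(3)[OF g])
  have Gi: "integrable ?M (\<lambda>z. (cmod (deriv (G i) z))\<^sup>2)" for i by (rule dirichlet_spaceD(3)[OF G(1)])
  define v where "v i z = (if \<eta> * cmod (deriv g z) < cmod (deriv (G i) z) then deriv g z else 0)" for i z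
  have vm: "v i \<in> borel_measurable ?M" for i
    unfolding v_def using gm Gm[of i] by measurable
  have v_le: "(cmod (v i z))\<^sup>2 \<le> (cmod (deriv g z))\<^sup>2" for i z by (simp add: v_def)
  have vi: "integrable ?M (\<lambda>z. (cmod (v i z))\<^sup>2)" for i
    by (rule Bochner_Integration.integrable_bound[OF gi]) (use vm[of i] v_le in \<open>auto intro!: AE_I2\<close>)
  have "(\<lambda>i. \<integral>z. (cmod (v i z))\<^sup>2 \<partial>?M) \<longlonglongrightarrow> (\<integral>z. 0 \<partial>?M)"
  proof (rule integral_dominated_convergence[where w = "\<lambda>z. (cmod (deriv g z))\<^sup>2"])
    show "AE z in ?M. (\<lambda>i. (cmod (v i z))\<^sup>2) \<longlonglongrightarrow> 0"
    proof (rule AE_I2)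
      fix z assume "z \<in> space ?M"
      then have z: "cmod z < 1" by simp
      show "(\<lambda>i. (cmod (v i z))\<^sup>2) \<longlonglongrightarrow> 0"
      proof (cases "deriv g z = 0")
        case True
        then have "(\<lambda>i. (cmod (v i z))\<^sup>2) = (\<lambda>i. 0)" by (auto simp: v_def)
        then show ?thesis by simp
      next
        case False
        then have "0 < \<eta> * cmod (deriv g z)" using \<eta> by simp
        from order_tendstoD(2)[OF tendsto_norm_zero[OF lim[OF z]] this]
        have "\<forall>\<^sub>F i in sequentially. (cmod (v i z))\<^sup>2 = 0"
          by eventually_elim (simp add: v_def)
        then show ?thesis by (rule tendsto_eventually)
      qed
    qed
    show "(\<lambda>z. (cmod (v i z))\<^sup>2) \<in> borel_measurable ?M" for i using vm[of i] by measurable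
    show "AE z in ?M. norm ((cmod (v i z))\<^sup>2) \<le> (cmod (deriv g z))\<^sup>2" for i
      using v_le by (intro AE_I2) simp
  qed (use gi in auto)
  then have "(\<lambda>i. \<integral>z. (cmod (v i z))\<^sup>2 \<partial>?M) \<longlonglongrightarrow> 0" by simp
  from tendsto_real_sqrt[OF this]
  have "(\<lambda>i. sqrt (\<integral>z. (cmod (v i z))\<^sup>2 \<partial>?M) * N) \<longlonglongrightarrow> 0"
    by (simp only: real_sqrt_zero tendsto_mult_left_zero)
  moreover have "(\<lambda>i. cmod (g 0) * cmod (G i 0)) \<longlonglongrightarrow> 0"
    by (rule tendsto_mult_right_zero[OF tendsto_norm_zero[OF lim0]])
  ultimately have "(\<lambda>i. cmod (g 0) * cmod (G i 0) + sqrt (\<integral>z. (cmod (v i z))\<^sup>2 \<partial>?M) * N) \<longlonglongrightarrow> 0 + 0"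
    by (intro tendsto_add)
  then have "(\<lambda>i. cmod (g 0) * cmod (G i 0) + sqrt (\<integral>z. (cmod (v i z))\<^sup>2 \<partial>?M) * N) \<longlonglongrightarrow> 0" by (simp only: add_0)
  from order_tendstoD(2)[OF this half_gt_zero[OF e]]
  show "\<forall>\<^sub>F i in sequentially. dist (dirichlet_ip \<alpha> g (G i)) 0 < e"
  proof eventually_elim
    case (elim i)
    have p1: "integrable ?M (\<lambda>z. cmod (v i z) * cmod (deriv (G i) z))"
      using integrable_norm[OF integrable_mult_of_square_integrable[OF vm Gm vi Gi]] by (simp add: norm_mult)
    have p2: "integrable ?M (\<lambda>z. \<eta> * (cmod (deriv g z))\<^sup>2 + cmod (v i z) * cmod (deriv (G i) z))"
      using gi p1 by (intro Bochner_Integration.integrable_add integrable_mult_right)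
    have "cmod (\<integral>z. deriv g z * cnj (deriv (G i) z) \<partial>?M) \<le>
        (\<integral>z. \<eta> * (cmod (deriv g z))\<^sup>2 + cmod (v i z) * cmod (deriv (G i) z) \<partial>?M)"
    proof (rule Bochner_Integration.integral_norm_bound_integral[OF dirichlet_ip_integrable[OF g G(1)] p2])
      fix z
      show "cmod (deriv g z * cnj (deriv (G i) z)) \<le> \<eta> * (cmod (deriv g z))\<^sup>2 + cmod (v i z) * cmod (deriv (G i) z)"
      proof (cases "\<eta> * cmod (deriv g z) < cmod (deriv (G i) z)")
        case True
        then show ?thesis using \<eta> by (simp add: v_def norm_mult)
      next
        case False
        then have "cmod (deriv g z) * cmod (deriv (G i) z) \<le> cmod (deriv g z) * (\<eta> * cmod (deriv g z))"
          by (intro mult_left_mono) auto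
        then show ?thesis using False by (simp add: v_def norm_mult power2_eq_square mult_ac)
      qed
    qed
    also have "\<dots> = \<eta> * E + (\<integral>z. cmod (v i z) * cmod (deriv (G i) z) \<partial>?M)"
      using gi p1 by (simp add: E_def)
    also have "(\<integral>z. cmod (v i z) * cmod (deriv (G i) z) \<partial>?M) \<le>
        sqrt (\<integral>z. (cmod (v i z))\<^sup>2 \<partial>?M) * sqrt (\<integral>z. (cmod (deriv (G i) z))\<^sup>2 \<partial>?M)"
      by (rule integral_cauchy_schwarz[OF vm Gm vi Gi])
    also have "\<dots> \<le> sqrt (\<integral>z. (cmod (v i z))\<^sup>2 \<partial>?M) * N"
    proof (intro mult_left_mono)
      have "(\<integral>z. (cmod (deriv (G i) z))\<^sup>2 \<partial>?M) \<le> (ip_norm (dirichlet_ip \<alpha>) (G i))\<^sup>2" by (rule dirichlet_energy_le)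
      also have "\<dots> \<le> N\<^sup>2" using G(2) dirichlet_norm_nonneg by (intro power_mono) auto
      finally show "sqrt (\<integral>z. (cmod (deriv (G i) z))\<^sup>2 \<partial>?M) \<le> N" using N by (intro real_le_lsqrt) auto
    qed (auto intro!: integral_nonneg_AE)
    finally have int: "cmod (\<integral>z. deriv g z * cnj (deriv (G i) z) \<partial>?M) \<le> \<eta> * E + sqrt (\<integral>z. (cmod (v i z))\<^sup>2 \<partial>?M) * N"
      by simp
    have "cmod (dirichlet_ip \<alpha> g (G i)) \<le> cmod (g 0) * cmod (G i 0) + cmod (\<integral>z. deriv g z * cnj (deriv (G i) z) \<partial>?M)"
      unfolding dirichlet_ip_def by (rule order_trans[OF norm_triangle_ineq]) (simp add: norm_mult)
    then show ?case using int elim \<eta>E by simp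
  qed
qed

text \<open>
  The normalization makes the energy of the composed function independent of \<open>e\<close>, and by comparison
  of the poles \<open>p\<close> and \<open>q = \<phi> p\<close> it also keeps the norm of \<open>G\<close> bounded. The last two bounds give
  convergence to \<open>0\<close> at every point as the energy of the pole grows.
\<close>

lemma contact_test_functions:
  assumes \<alpha>: "\<alpha> > -1" and lf: "linear_fractional_self_map \<phi>" and \<zeta>: "cmod \<zeta> = 1" "cmod (\<phi> \<zeta>) = 1"
    and C: "C > 0" "\<And>e. 0 < e \<Longrightarrow> e \<le> 1 \<Longrightarrow> C / e \<le> pole_energy \<alpha> (Suc m) (\<zeta> * of_real (1 + e))"
  obtains e0 N where "0 < e0" "e0 \<le> 1" "0 \<le> N"
    "\<forall>e. 0 < e \<longrightarrow> e < e0 \<longrightarrow> (\<exists>G\<in>dirichlet_space \<alpha>.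
      comp_op \<phi> G = (\<lambda>z. if cmod z < 1 then of_real (1 / sqrt (pole_energy \<alpha> (Suc m) (\<zeta> * of_real (1 + e)))) *
        (1 / (z - \<zeta> * of_real (1 + e)) ^ m) else 0) \<and>
      ip_norm (dirichlet_ip \<alpha>) G \<le> N \<and>
      cmod (G 0) \<le> N * (1 / sqrt (pole_energy \<alpha> (Suc m) (\<zeta> * of_real (1 + e)))) \<and>
      (\<forall>w. cmod w < 1 \<longrightarrow> cmod (deriv G w) \<le>
        N / (1 - cmod w) ^ Suc m * (1 / sqrt (pole_energy \<alpha> (Suc m) (\<zeta> * of_real (1 + e))))))"
proof -
  let ?M = "weighted_disk_area \<alpha>"
  obtain e0 \<kappa> B where e0: "0 < e0" "e0 \<le> 1" and \<kappa>: "0 < \<kappa>" "\<kappa> \<le> 1" and B: "0 \<le> B"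
    and pull: "\<And>e. 0 < e \<Longrightarrow> e < e0 \<Longrightarrow> \<exists>q F. 1 + \<kappa> * e \<le> cmod q \<and> F holomorphic_on ball 0 1 \<and>
      (\<forall>z. cmod z < 1 \<longrightarrow> F (\<phi> z) = 1 / (z - \<zeta> * of_real (1 + e)) ^ m) \<and>
      (\<forall>w. cmod w < 1 \<longrightarrow> cmod (F w) \<le> B / cmod (w - q) ^ m \<and>
        cmod (deriv F w) \<le> B / cmod (w - q) ^ Suc m)"
    using pole_pullback[OF lf \<zeta>, of m] by blast
  define K where "K = B\<^sup>2 * (1 + 1 / \<kappa>) ^ (2 * Suc m)"
  have K: "K \<ge> 0" using \<kappa> by (simp add: K_def)
  define N where "N = sqrt (B\<^sup>2 / C + K) + B"
  have N: "N \<ge> 0" "B \<le> N" "sqrt (B\<^sup>2 / C + K) \<le> N" using B C(1) K by (auto simp: N_def)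
  have main: "\<exists>G\<in>dirichlet_space \<alpha>.
      comp_op \<phi> G = (\<lambda>z. if cmod z < 1 then of_real (1 / sqrt (pole_energy \<alpha> (Suc m) (\<zeta> * of_real (1 + e)))) *
        (1 / (z - \<zeta> * of_real (1 + e)) ^ m) else 0) \<and>
      ip_norm (dirichlet_ip \<alpha>) G \<le> N \<and>
      cmod (G 0) \<le> N * (1 / sqrt (pole_energy \<alpha> (Suc m) (\<zeta> * of_real (1 + e)))) \<and>
      (\<forall>w. cmod w < 1 \<longrightarrow> cmod (deriv G w) \<le>
        N / (1 - cmod w) ^ Suc m * (1 / sqrt (pole_energy \<alpha> (Suc m) (\<zeta> * of_real (1 + e)))))"
    if e: "0 < e" "e < e0" for e
  proof -
    define p where "p = \<zeta> * complex_of_real (1 + e)"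
    define J where "J = pole_energy \<alpha> (Suc m) p"
    define c where "c = 1 / sqrt J"
    have "C / 1 \<le> C / e" using C(1) e e0(2) by (intro divide_left_mono) auto
    then have J: "C \<le> J" "J > 0" using C(2)[of e] e e0(2) C(1) by (auto simp: J_def p_def)
    have c: "c > 0" "c\<^sup>2 = 1 / J" using J by (auto simp: c_def power_divide)
    have cC: "c\<^sup>2 \<le> 1 / C" unfolding c(2) using J C(1) by (intro divide_left_mono) auto
    obtain q F where q: "1 + \<kappa> * e \<le> cmod q" and F: "F holomorphic_on ball 0 1"
      "\<And>z. cmod z < 1 \<Longrightarrow> F (\<phi> z) = 1 / (z - p) ^ m"
      "\<And>w. cmod w < 1 \<Longrightarrow> cmod (F w) \<le> B / cmod (w - q) ^ m"
      "\<And>w. cmod w < 1 \<Longrightarrow> cmod (deriv F w) \<le> B / cmod (w - q) ^ Suc m"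
      using pull[OF e] unfolding p_def by blast
    have q1: "cmod q > 1" using q \<kappa>(1) e(1) mult_pos_pos[of \<kappa> e] by linarith
    define G where "G w = (if cmod w < 1 then of_real c * F w else 0)" for w
    have cF: "(\<lambda>w. of_real c * F w) holomorphic_on ball 0 1" by (intro holomorphic_intros F)
    have G_hol: "G holomorphic_on ball 0 1"
      by (rule holomorphic_transform[OF cF]) (simp add: G_def)
    have G_deriv: "deriv G w = of_real c * deriv F w" if w: "cmod w < 1" for w
    proof -
      have "((\<lambda>w. of_real c * F w) has_field_derivative of_real c * deriv F w) (at w)"
        by (intro DERIV_cmult holomorphic_derivI[OF F(1) open_ball]) (use w in auto)
      then show ?thesis by (rule deriv_disk_eqI) (use w in \<open>auto simp: G_def\<close>)
    qed
    have dG: "cmod (deriv G w) \<le> c * (B / cmod (w - q) ^ Suc m)" if w: "cmod w < 1" for w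
      using mult_left_mono[OF F(4)[OF w] less_imp_le[OF c(1)]]
      unfolding G_deriv[OF w] norm_mult norm_of_real abs_of_pos[OF c(1)] .
    have dG2: "(cmod (deriv G w))\<^sup>2 \<le> c\<^sup>2 * B\<^sup>2 * (cmod (1 / (w - q) ^ Suc m))\<^sup>2" if w: "cmod w < 1" for w
    proof -
      have "(cmod (deriv G w))\<^sup>2 \<le> (c * (B * cmod (1 / (w - q) ^ Suc m)))\<^sup>2"
        using dG[OF w] by (intro power_mono) (auto simp: norm_divide norm_power norm_mult)
      then show ?thesis by (simp add: power_mult_distrib mult.assoc)
    qed
    have int: "integrable ?M (\<lambda>w. c\<^sup>2 * B\<^sup>2 * (cmod (1 / (w - q) ^ Suc m))\<^sup>2)"
      by (intro integrable_mult_right pole_integrable[OF \<alpha> q1])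
    have Gi: "integrable ?M (\<lambda>w. (cmod (deriv G w))\<^sup>2)"
    proof (rule Bochner_Integration.integrable_bound[OF int])
      show "(\<lambda>w. (cmod (deriv G w))\<^sup>2) \<in> borel_measurable ?M"
        using measurable_deriv_disk[OF G_hol] by measurable
      show "AE w in ?M. norm ((cmod (deriv G w))\<^sup>2) \<le> norm (c\<^sup>2 * B\<^sup>2 * (cmod (1 / (w - q) ^ Suc m))\<^sup>2)"
        using order_trans[OF dG2 abs_ge_self]
        by (intro AE_I2) (simp only: real_norm_def space_weighted_disk_area mem_ball_0 abs_power2)
    qed
    have "(\<integral>w. (cmod (deriv G w))\<^sup>2 \<partial>?M) \<le> (\<integral>w. c\<^sup>2 * B\<^sup>2 * (cmod (1 / (w - q) ^ Suc m))\<^sup>2 \<partial>?M)"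
      by (rule integral_mono_AE[OF Gi int]) (use dG2 in \<open>auto intro!: AE_I2\<close>)
    also have "\<dots> = c\<^sup>2 * B\<^sup>2 * pole_energy \<alpha> (Suc m) q"
      unfolding pole_energy_def by (rule integral_mult_right_zero)
    also have "\<dots> \<le> c\<^sup>2 * B\<^sup>2 * ((1 + 1 / \<kappa>) ^ (2 * Suc m) * J)"
      unfolding J_def p_def by (intro mult_left_mono pole_energy_compare[OF \<alpha> \<zeta>(1) e(1) \<kappa> q]) auto
    also have "\<dots> = K" unfolding c(2) K_def using J(2) by simp
    finally have energy: "(\<integral>w. (cmod (deriv G w))\<^sup>2 \<partial>?M) \<le> K" .
    have G0: "cmod (G 0) \<le> c * B"
    proof -
      have "1 \<le> cmod (0 - q) ^ m" using q1 by (simp add: one_le_power)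
      then have "B / cmod (0 - q) ^ m \<le> B / 1" using B by (intro frac_le) auto
      then have "cmod (F 0) \<le> B" using F(3)[of 0] by simp
      then show ?thesis using c(1) by (simp add: G_def norm_mult mult_left_mono)
    qed
    have G_mem: "G \<in> dirichlet_space \<alpha>"
      using G_hol Gi by (simp add: dirichlet_space_def G_def)
    have "(ip_norm (dirichlet_ip \<alpha>) G)\<^sup>2 \<le> (c * B)\<^sup>2 + K"
      unfolding dirichlet_norm_square using G0 energy by (intro add_mono power_mono) auto
    also have "(c * B)\<^sup>2 \<le> B\<^sup>2 / C"
      using mult_right_mono[OF cC, of "B\<^sup>2"] by (simp add: power_mult_distrib)
    finally have "ip_norm (dirichlet_ip \<alpha>) G \<le> sqrt (B\<^sup>2 / C + K)"
      by (intro real_le_rsqrt) simp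
    then have G_nrm: "ip_norm (dirichlet_ip \<alpha>) G \<le> N" using N(3) by linarith
    have G0': "cmod (G 0) \<le> N * c"
      using order_trans[OF G0 mult_left_mono[OF N(2) less_imp_le[OF c(1)]]] by (simp only: mult.commute)
    have dG': "cmod (deriv G w) \<le> N / (1 - cmod w) ^ Suc m * c" if w: "cmod w < 1" for w
    proof -
      have "1 - cmod w \<le> cmod (w - q)"
        using norm_triangle_ineq2[of q w] q1 by (simp add: norm_minus_commute)
      then have "B / cmod (w - q) ^ Suc m \<le> N / (1 - cmod w) ^ Suc m"
        using B N w by (intro frac_le power_mono zero_less_power) auto
      then have "c * (B / cmod (w - q) ^ Suc m) \<le> c * (N / (1 - cmod w) ^ Suc m)"
        using c(1) by (intro mult_left_mono) auto
      then show ?thesis using dG[OF w] by (simp only: mult.commute)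
    qed
    have comp: "comp_op \<phi> G = (\<lambda>z. if cmod z < 1 then of_real c * (1 / (z - p) ^ m) else 0)"
      using linear_fractional_less_1[OF lf] F(2) by (auto simp: comp_op_def G_def fun_eq_iff)
    show ?thesis
      using G_mem comp G_nrm G0' dG' unfolding c_def J_def p_def by blast
  qed
  show thesis by (rule that[OF e0 N(1)]) (intro allI impI main)
qed

text \<open>
  The normalized function \<open>k e\<close> with a pole of order \<open>m\<close> at \<open>\<zeta> (1 + e)\<close> can be written both as \<open>F \<circ> \<phi>\<close>
  and as \<open>G \<circ> \<psi>\<close>, with \<open>F\<close> and \<open>G\<close> bounded in norm. So \<open>\<langle>T F, G\<rangle> = \<parallel>k e\<parallel>\<^sup>2 \<ge> m\<^sup>2 \<ge> 1\<close>. As \<open>e\<close> tends to \<open>0\<close>, the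
  functions \<open>G\<close> tend weakly to \<open>0\<close>; if the images \<open>T F\<close> had a convergent subsequence, the inner
  products would tend to \<open>0\<close> along it.
\<close>

theorem not_compact_if_common_contact:
  assumes \<alpha>: "\<alpha> > -1" and \<phi>: "linear_fractional_self_map \<phi>" and \<psi>: "linear_fractional_self_map \<psi>"
    and \<zeta>: "cmod \<zeta> = 1" "cmod (\<phi> \<zeta>) = 1" "cmod (\<psi> \<zeta>) = 1"
  shows "\<not> compact_operator (dirichlet_space \<alpha>) (dirichlet_ip \<alpha>)
    (hilbert_adjoint (dirichlet_space \<alpha>) (dirichlet_ip \<alpha>) (comp_op \<psi>) \<circ> comp_op \<phi>)"
proof
  let ?M = "weighted_disk_area \<alpha>"
  let ?H = "dirichlet_space \<alpha>"
  define T where "T = hilbert_adjoint ?H (dirichlet_ip \<alpha>) (comp_op \<psi>) \<circ> comp_op \<phi>"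
  assume "compact_operator ?H (dirichlet_ip \<alpha>) (hilbert_adjoint ?H (dirichlet_ip \<alpha>) (comp_op \<psi>) \<circ> comp_op \<phi>)"
  then have compact: "compact_operator ?H (dirichlet_ip \<alpha>) T" by (simp add: T_def)
  interpret function_hilbert_space ?H "dirichlet_ip \<alpha>" by (rule dirichlet_hilbert_space[OF \<alpha>])
  have T: "bounded_operator T" unfolding T_def by (rule adjoint_comp_bounded[OF \<alpha> \<phi> \<psi>])
  obtain n C where n: "n \<ge> 2" and C: "C > 0"
    and lower: "\<And>e. 0 < e \<Longrightarrow> e \<le> 1 \<Longrightarrow> C / e \<le> pole_energy \<alpha> n (\<zeta> * of_real (1 + e))"
    using pole_energy_lower[OF \<alpha>] \<zeta>(1) by blast
  define m where "m = n - 1"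
  have m: "m \<ge> 1" "n = Suc m" using n by (auto simp: m_def)
  define J where "J e = pole_energy \<alpha> (Suc m) (\<zeta> * of_real (1 + e))" for e
  define k where "k e = (\<lambda>z. if cmod z < 1 then of_real (1 / sqrt (J e)) * (1 / (z - \<zeta> * of_real (1 + e)) ^ m) else 0)" for e
  have lower': "C / e \<le> J e" if "0 < e" "e \<le> 1" for e using lower[OF that] by (simp add: J_def m)
  obtain e1 N1 where e1: "0 < e1" "e1 \<le> 1" "0 \<le> N1"
    and G1: "\<forall>e. 0 < e \<longrightarrow> e < e1 \<longrightarrow> (\<exists>G\<in>?H. comp_op \<phi> G = k e \<and> nrm G \<le> N1 \<and> cmod (G 0) \<le> N1 * (1 / sqrt (J e)) \<and>
      (\<forall>w. cmod w < 1 \<longrightarrow> cmod (deriv G w) \<le> N1 / (1 - cmod w) ^ Suc m * (1 / sqrt (J e))))"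
    unfolding k_def J_def
    by (rule contact_test_functions[OF \<alpha> \<phi> \<zeta>(1,2) C lower[unfolded m(2)]])
  obtain e2 N2 where e2: "0 < e2" "e2 \<le> 1" "0 \<le> N2"
    and G2: "\<forall>e. 0 < e \<longrightarrow> e < e2 \<longrightarrow> (\<exists>G\<in>?H. comp_op \<psi> G = k e \<and> nrm G \<le> N2 \<and> cmod (G 0) \<le> N2 * (1 / sqrt (J e)) \<and>
      (\<forall>w. cmod w < 1 \<longrightarrow> cmod (deriv G w) \<le> N2 / (1 - cmod w) ^ Suc m * (1 / sqrt (J e))))"
    unfolding k_def J_def
    by (rule contact_test_functions[OF \<alpha> \<psi> \<zeta>(1,3) C lower[unfolded m(2)]])
  define e where "e i = min e1 e2 / real (i + 2)" for i
  have e: "0 < e i" "e i < e1" "e i < e2" "e i \<le> 1" for i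
  proof -
    have "min e1 e2 > 0" using e1 e2 by simp
    moreover from this have "min e1 e2 / real (i + 2) < min e1 e2 / 1"
      by (intro divide_strict_left_mono) auto
    ultimately have "e i < min e1 e2" "0 < e i" unfolding e_def by simp_all
    then show "0 < e i" "e i < e1" "e i < e2" "e i \<le> 1" using e1(2) by auto
  qed
  have "\<forall>i. \<exists>G. G \<in> ?H \<and> comp_op \<phi> G = k (e i) \<and> nrm G \<le> N1" using G1 e by blast
  from choice[OF this] obtain F
    where F: "\<And>i. F i \<in> ?H" "\<And>i. comp_op \<phi> (F i) = k (e i)" "\<And>i. nrm (F i) \<le> N1" by blast
  have "\<forall>i. \<exists>G. G \<in> ?H \<and> comp_op \<psi> G = k (e i) \<and> nrm G \<le> N2 \<and> cmod (G 0) \<le> N2 * (1 / sqrt (J (e i))) \<and>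
      (\<forall>w. cmod w < 1 \<longrightarrow> cmod (deriv G w) \<le> N2 / (1 - cmod w) ^ Suc m * (1 / sqrt (J (e i))))"
    using G2 e by blast
  from choice[OF this] obtain G
    where G: "\<And>i. G i \<in> ?H" "\<And>i. comp_op \<psi> (G i) = k (e i)" "\<And>i. nrm (G i) \<le> N2"
      "\<And>i. cmod (G i 0) \<le> N2 * (1 / sqrt (J (e i)))"
      "\<And>i w. cmod w < 1 \<Longrightarrow> cmod (deriv (G i) w) \<le> N2 / (1 - cmod w) ^ Suc m * (1 / sqrt (J (e i)))" by blast
  have Jpos: "J (e i) > 0" for i using lower'[OF e(1,4), of i] C e(1)[of i] by (meson divide_pos_pos less_le_trans)
  have c_lim: "(\<lambda>i. 1 / sqrt (J (e i))) \<longlonglongrightarrow> 0"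
  proof -
    have "(\<lambda>i. 1 / J (e i)) \<longlonglongrightarrow> 0"
    proof (rule Lim_null_comparison)
      show "\<forall>\<^sub>F i in sequentially. norm (1 / J (e i)) \<le> 1 / C * (1 / real (Suc i))"
      proof (intro always_eventually allI)
        fix i
        have "e i \<le> 1 / real (Suc i)"
          unfolding e_def using e1 e2 by (intro frac_le) auto
        then have "C / (1 / real (Suc i)) \<le> C / e i" using C e(1)[of i] by (intro divide_left_mono) auto
        then have "C * real (Suc i) \<le> J (e i)" using lower'[OF e(1,4), of i] by simp
        then have "1 / J (e i) \<le> 1 / (C * real (Suc i))" using C by (intro divide_left_mono mult_pos_pos Jpos) auto
        then show "norm (1 / J (e i)) \<le> 1 / C * (1 / real (Suc i))" using Jpos[of i] by simp
      qed
      have "(\<lambda>i. 1 / real (Suc i)) \<longlonglongrightarrow> 0" using LIMSEQ_inverse_real_of_nat by (simp add: inverse_eq_divide)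
      then show "(\<lambda>i. 1 / C * (1 / real (Suc i))) \<longlonglongrightarrow> 0" by (rule tendsto_mult_right_zero)
    qed
    from tendsto_real_sqrt[OF this] show ?thesis by (simp add: real_sqrt_divide)
  qed
  have big: "1 \<le> cmod (dirichlet_ip \<alpha> (T (F i)) (G i))" for i
  proof -
    define p where "p = \<zeta> * complex_of_real (1 + e i)"
    define c where "c = 1 / sqrt (J (e i))"
    have c: "c\<^sup>2 = 1 / J (e i)" using Jpos[of i] by (simp add: c_def power_divide)
    have p1: "cmod p > 1" unfolding p_def norm_mult norm_of_real using \<zeta>(1) e(1)[of i] by simp
    have kH: "k (e i) \<in> ?H" using bounded_operator_mem[OF comp_op_bounded[OF \<alpha> \<phi>] F(1)[of i]] F(2) by simp
    have k_eq: "k (e i) = (\<lambda>z. if cmod z < 1 then of_real c * (1 / (z - p) ^ m) else 0)"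
      unfolding k_def c_def p_def ..
    have dk: "(cmod (deriv (k (e i)) z))\<^sup>2 = (real m)\<^sup>2 * c\<^sup>2 * (cmod (1 / (z - p) ^ Suc m))\<^sup>2" if z: "cmod z < 1" for z
    proof -
      have zp: "z - p \<noteq> 0" using z p1 by auto
      have d: "((\<lambda>z. (z - p) powi (- int m)) has_field_derivative of_int (- int m) * (z - p) powi (- int m - 1)) (at z)"
        using zp by (auto intro!: derivative_eq_intros)
      have e1: "(\<lambda>z. (z - p) powi (- int m)) = (\<lambda>z. 1 / (z - p) ^ m)"
        by (simp add: power_int_minus inverse_eq_divide)
      have "- int m - 1 = - int (Suc m)" by simp
      then have e2: "(z - p) powi (- int m - 1) = 1 / (z - p) ^ Suc m"
        by (simp only: power_int_minus power_int_of_nat inverse_eq_divide)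
      have "((\<lambda>z. of_real c * (1 / (z - p) ^ m)) has_field_derivative
          of_real c * (of_int (- int m) * (1 / (z - p) ^ Suc m))) (at z)"
        using DERIV_cmult[OF d[unfolded e1 e2]] .
      then have "deriv (k (e i)) z = of_real c * (of_int (- int m) * (1 / (z - p) ^ Suc m))"
        by (rule deriv_disk_eqI) (use z in \<open>auto simp: k_eq\<close>)
      moreover have "(cmod (of_real c * (of_int (- int m) * x)))\<^sup>2 = (real m)\<^sup>2 * c\<^sup>2 * (cmod x)\<^sup>2" for x
        by (simp add: norm_mult power_mult_distrib)
      ultimately show ?thesis by (simp only:)
    qed
    have "(\<integral>z. (cmod (deriv (k (e i)) z))\<^sup>2 \<partial>?M) = (\<integral>z. (real m)\<^sup>2 * c\<^sup>2 * (cmod (1 / (z - p) ^ Suc m))\<^sup>2 \<partial>?M)"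
      by (rule integral_weighted_disk_area_cong) (rule dk)
    also have "\<dots> = (real m)\<^sup>2 * c\<^sup>2 * J (e i)"
      unfolding J_def pole_energy_def p_def by (rule integral_mult_right_zero)
    also have "\<dots> = (real m)\<^sup>2" using c Jpos[of i] by simp
    finally have "(real m)\<^sup>2 \<le> (nrm (k (e i)))\<^sup>2" by (simp add: dirichlet_norm_square)
    moreover have "1 \<le> (real m)\<^sup>2" using m(1) by (simp add: one_le_power)
    moreover have "dirichlet_ip \<alpha> (T (F i)) (G i) = of_real ((nrm (k (e i)))\<^sup>2)"
      unfolding T_def adjoint_comp_ip[OF \<alpha> \<phi> \<psi> F(1) G(1)] F(2) G(2) by (rule ip_self[OF kH])
    ultimately show ?thesis by (simp add: norm_power)
  qed
  obtain r g where r: "strict_mono (r :: nat \<Rightarrow> nat)" and g: "g \<in> ?H"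
    and conv: "(\<lambda>i. nrm (T (F (r i)) - g)) \<longlonglongrightarrow> 0"
    using compact F(1,3) unfolding compact_operator_def by blast
  have "(\<lambda>i. dirichlet_ip \<alpha> g (G i)) \<longlonglongrightarrow> 0"
  proof (rule dirichlet_weak_null[OF \<alpha> g G(1,3)])
    show "(\<lambda>i. G i 0) \<longlonglongrightarrow> 0"
      by (rule Lim_null_comparison[OF always_eventually[OF allI[OF G(4)]] tendsto_mult_right_zero[OF c_lim]])
    show "(\<lambda>i. deriv (G i) w) \<longlonglongrightarrow> 0" if "cmod w < 1" for w
      by (rule Lim_null_comparison[OF always_eventually[OF allI[OF G(5)[OF that]]] tendsto_mult_right_zero[OF c_lim]])
  qed
  from LIMSEQ_subseq_LIMSEQ[OF this r]
  have l1: "(\<lambda>i. dirichlet_ip \<alpha> g (G (r i))) \<longlonglongrightarrow> 0" by (simp add: o_def)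
  have l2: "(\<lambda>i. dirichlet_ip \<alpha> (T (F (r i)) - g) (G (r i))) \<longlonglongrightarrow> 0"
  proof (rule Lim_null_comparison[OF always_eventually[OF allI] tendsto_mult_left_zero[OF conv]])
    fix i
    have mem: "T (F (r i)) - g \<in> ?H" using bounded_operator_mem[OF T F(1)] g by (rule diff_mem)
    show "norm (dirichlet_ip \<alpha> (T (F (r i)) - g) (G (r i))) \<le> nrm (T (F (r i)) - g) * N2"
      by (rule order_trans[OF cauchy_schwarz[OF mem G(1)] mult_left_mono[OF G(3) nrm_nonneg[OF mem]]])
  qed
  have "(\<lambda>i. dirichlet_ip \<alpha> (T (F (r i)) - g) (G (r i)) + dirichlet_ip \<alpha> g (G (r i))) \<longlonglongrightarrow> 0 + 0"
    by (rule tendsto_add[OF l2 l1])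
  moreover have "dirichlet_ip \<alpha> (T (F (r i)) - g) (G (r i)) + dirichlet_ip \<alpha> g (G (r i)) =
      dirichlet_ip \<alpha> (T (F (r i))) (G (r i))" for i
    by (simp only: ip_diff_left[OF bounded_operator_mem[OF T F(1)] g G(1)] diff_add_cancel)
  ultimately have "(\<lambda>i. dirichlet_ip \<alpha> (T (F (r i))) (G (r i))) \<longlonglongrightarrow> 0" by (simp only: add_0)
  from order_tendstoD(2)[OF tendsto_norm_zero[OF this] zero_less_one]
  obtain i where "cmod (dirichlet_ip \<alpha> (T (F (r i))) (G (r i))) < 1"
    unfolding eventually_sequentially by blast
  then show False using big[of "r i"] by simp
qed

section \<open>The characterization\<close>

theorem theorem4p8:
  fixes \<alpha> p :: real and \<phi> \<psi> :: "complex \<Rightarrow> complex"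
  assumes "\<alpha> > -1" and "p > 0"
    and "linear_fractional_self_map \<phi>" and "linear_fractional_self_map \<psi>"
  shows "(hilbert_adjoint (dirichlet_space \<alpha>) (dirichlet_ip \<alpha>) (comp_op \<psi>) \<circ> comp_op \<phi>
            \<in> schatten_class p (dirichlet_space \<alpha>) (dirichlet_ip \<alpha>)
          \<longleftrightarrow> \<phi> -` unit_circle \<inter> \<psi> -` unit_circle \<inter> unit_circle = {})
       \<and> (\<phi> -` unit_circle \<inter> \<psi> -` unit_circle \<inter> unit_circle = {} \<longrightarrow>
            (\<forall>q>0. hilbert_adjoint (dirichlet_space \<alpha>) (dirichlet_ip \<alpha>) (comp_op \<psi>) \<circ> comp_op \<phi>
                     \<in> schatten_class q (dirichlet_space \<alpha>) (dirichlet_ip \<alpha>)))"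
proof -
  interpret function_hilbert_space "dirichlet_space \<alpha>" "dirichlet_ip \<alpha>"
    by (rule dirichlet_hilbert_space[OF assms(1)])
  let ?T = "hilbert_adjoint (dirichlet_space \<alpha>) (dirichlet_ip \<alpha>) (comp_op \<psi>) \<circ> comp_op \<phi>"
  let ?contact = "\<phi> -` unit_circle \<inter> \<psi> -` unit_circle \<inter> unit_circle"
  have sufficient: "?T \<in> schatten_class q (dirichlet_space \<alpha>) (dirichlet_ip \<alpha>)"
    if empty: "?contact = {}" and q: "q > 0" for q
  proof -
    have "continuous_on (cball 0 1) (\<lambda>z. min (cmod (\<phi> z)) (cmod (\<psi> z)))"
      by (intro continuous_intros linear_fractional_continuous assms)
    then have "\<exists>x\<in>cball 0 1. \<forall>z\<in>cball 0 1. min (cmod (\<phi> z)) (cmod (\<psi> z)) \<le> min (cmod (\<phi> x)) (cmod (\<psi> x))"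
      by (intro continuous_attains_sup) auto
    then obtain x where x: "cmod x \<le> 1"
      "\<And>z. cmod z \<le> 1 \<Longrightarrow> min (cmod (\<phi> z)) (cmod (\<psi> z)) \<le> min (cmod (\<phi> x)) (cmod (\<psi> x))" by auto
    have le1: "cmod (\<phi> x) \<le> 1" "cmod (\<psi> x) \<le> 1"
      by (rule linear_fractional_le_1[OF assms(3) x(1)], rule linear_fractional_le_1[OF assms(4) x(1)])
    have "min (cmod (\<phi> x)) (cmod (\<psi> x)) < 1"
    proof (cases "cmod x < 1")
      case True
      then show ?thesis using linear_fractional_less_1[OF assms(3) True] by simp
    next
      case False
      then have "x \<in> unit_circle" using x(1) by simp
      then have "\<not> (cmod (\<phi> x) = 1 \<and> cmod (\<psi> x) = 1)" using empty by auto
      then show ?thesis using le1 by auto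
    qed
    moreover define r where "r = max (1/2) (min (cmod (\<phi> x)) (cmod (\<psi> x)))"
    ultimately have r: "0 < r" "r < 1" by auto
    have "cmod (\<phi> z) \<le> r \<or> cmod (\<psi> z) \<le> r" if "cmod z < 1" for z
      using x(2)[of z] that unfolding r_def by linarith
    then obtain C \<rho> where "0 < \<rho>" "\<rho> < 1" "\<And>N. approximable ?T (2 * N + 1) (C * \<rho> ^ N)"
      using adjoint_comp_approximable[OF assms(1,3,4) r] by blast
    then show ?thesis by (intro schatten_if_approximable adjoint_comp_bounded assms q)
  qed
  have necessary: "?contact = {}" if "?T \<in> schatten_class p (dirichlet_space \<alpha>) (dirichlet_ip \<alpha>)"
  proof (rule ccontr)
    assume "?contact \<noteq> {}"
    then obtain \<zeta> where "cmod \<zeta> = 1" "cmod (\<phi> \<zeta>) = 1" "cmod (\<psi> \<zeta>) = 1" by auto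
    from not_compact_if_common_contact[OF assms(1,3,4) this]
    show False using that by (simp add: schatten_class_def)
  qed
  show ?thesis using sufficient necessary assms(2) by blast
qed

end
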